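(* Let $m\ge2$. (1) Let $\mathfrak g$ be a symmetrizable Kac-Moody Lie algebra with a fixed Coxeter quiver $Q(\mathfrak g)$, and let $w=r_{s_1}\cdots r_{s_k}\in W(\mathfrak g)$ be a reduced expression. Then the mutation sequence $R(w)=R(s_1)\cdots R(s_k)$ of $Q_m(\mathfrak g)$ is a green sequence, i.e. starting from the principal coefficients on $Q_m(\mathfrak g)$, at each mutation in the sequence the coefficient at the vertex to be mutated has positive tropical sign. (2) Suppose moreover that $\mathfrak g$ is of finite type, let $Q=Q(\mathfrak g)$ be a Coxeter quiver, and let $w_0=r_{s_1}\cdots r_{s_l}$ be a reduced expression of the longest element such that $(s_1,\dots,s_l)$ is adapted to $Q$. Then the cluster Donaldson-Thomas transformation for the quiver $Q_m(\mathfrak g)$ is $\sigma_Q\circ R(w_0)$, where $\sigma_Q$ is the seed isomorphism defined by $\sigma_Q^{-1}(v_i^s)=v_{i+n_{s^*}}^{s^*}$; here $s\mapsto s^*$ is the Dynkin involution, $\alpha_{s^*}=-w_0\alpha_s$, and $n_s$ is the number of occurrences of $s$ in $(s_1,\dots,s_l)$.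
   Context: Cluster conventions. A weighted quiver $Q$ with finite vertex set $I$ (no frozen vertices) consists of positive integers $d_i$ and an integral skew-symmetric matrix $\sigma_{ij}=\#\{i\to j\}-\#\{j\to i\}$; its exchange matrix is $\varepsilon_{ij}=\sigma_{ij}d_i/\gcd(d_i,d_j)$. Mutation $\mu_k$: $\varepsilon'_{ij}=-\varepsilon_{ij}$ if $k\in\{i,j\}$, $\varepsilon'_{ij}=\varepsilon_{ij}+\frac{|\varepsilon_{ik}|\varepsilon_{kj}+\varepsilon_{ik}|\varepsilon_{kj}|}{2}$ otherwise, $d'=d$. For a semifield $(\mathbb P,\oplus,\cdot)$ and a coefficient tuple $\mathbf x=(x_i)_{i\in I}\in\mathbb P^I$, $\mu_k$ sends $\mathbf x$ to $x_k'=x_k^{-1}$, $x_i'=x_i\cdot(1\oplus x_k^{-\mathrm{sgn}(\varepsilon_{ik})})^{-\varepsilon_{ik}}$ ($i\ne k$). On seeds $(Q,\mathbf X,\mathbf A)$, $\mu_k$ acts on $\mathbf X$ by the same formula with ordinary addition, and on $\mathbf A$ by $A'_k=A_k^{-1}(\prod_{\varepsilon_{kj}>0}A_j^{\varepsilon_{kj}}+\prod_{\varepsilon_{kj}<0}A_j^{-\varepsilon_{kj}})$, $A_i'=A_i$ ($i\ne k$). A seed permutation $\pi$ sends each datum $z_i$ to $z'_i=z_{\pi^{-1}(i)}$ (and $\varepsilon'_{ij}=\varepsilon_{\pi^{-1}(i)\pi^{-1}(j)}$); it is a seed isomorphism if $\varepsilon'=\varepsilon$. A mutation sequence is a finite composition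 (applied right to left) of mutations and seed permutations. $\Gamma_Q$ is the group of mutation sequences preserving $Q$ modulo those preserving the seed. Tropical semifields. $\mathbb P_{\rm trop}(\mathbf u)$, $\mathbf u=(u_i)_{i\in I}$, is the set of Laurent monomials in the $u_i$ with usual product and $\prod u_i^{a_i}\oplus\prod u_i^{b_i}=\prod u_i^{\min(a_i,b_i)}$. An element $\prod u_i^{c_i}$ is positive ($>0$) if all $c_i\ge0$, negative if all $c_i\le0$. Principal coefficients: $\mathbf x=(u_i)_{i\in I}$. A mutation sequence starting at $(Q,(u_i)_{i\in I})$ is green if at each of its mutations the current coefficient at the mutated vertex is positive. $\mathbb Z^{\rm trop}$ is $\mathbb Z$ with $a\oplus b=\min(a,b)$, $a\cdot b=a+b$; a mutation sequence $\phi$ preserving $Q$ induces a map $\phi^{\rm trop}:\mathbb Z^I\to\mathbb Z^I$ on $\mathbb Z^{\rm trop}$-valued coefficient tuples. With $l_i^{\pm}\in\mathbb Z^I$ the tuple with $j$-th coordinate $\pm\delta_{ij}$, an element $\mathbf K\in\Gamma_Q$ is the (unique, if it exists) cluster Donaldson-Thomas transformation if $\mathbf K^{\rm trop}(l_i^+)=l_i^-$ for all $i\in I$. Kac-Moody data. $C=(C_{st})_{s,t\in S}$ is a generalized Cartan matrix, symmetrizable by positive integers $d_s$, $\gcd(d_s)=1$, $d_sC_{st}=d_tC_{ts}$; $\mathfrak g$ the Kac-Moody algebra with simple roots $\alpha_s$; $W(\mathfrak g)$ generated by $r_s$, $r_s\alpha_t=\alpha_t-C_{st}\alpha_s$. A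 Coxeter quiver $Q(\mathfrak g)$ is a weighted quiver with vertex set $S$, weights $d_s$ and $|\varepsilon_{st}|=-C_{ts}$ for $s\neq t$; $\sigma_{st}$ denotes its signed arrow numbers. $Q_m(\mathfrak g)$ has vertices $v_i^s$ ($s\in S,i\in\mathbb Z_m=\mathbb Z/m\mathbb Z$) of weight $d_s$, an arrow $v_i^s\to v_{i+1}^s$ for all $s,i$ (for $m=2$ these cancel), and, whenever $\sigma_{st}\ge1$, $\sigma_{st}$ arrows $v_i^s\to v_i^t$ and $\sigma_{st}$ arrows $v_{i+1}^t\to v_i^s$. $R(s)$ denotes the mutation sequence $R(s,i)=(M_i^s)^{-1}\circ(v^s_{m+i-2},v^s_{m+i-1})\circ\mu^s_{m+i-1}\mu^s_{m+i-2}\circ M_i^s$, $M_i^s=\mu^s_{m+i-3}\cdots\mu^s_{i+1}\mu^s_i$ (empty for $m=2$), where $\mu_i^s$ is mutation at $v_i^s$ and $(v,v')$ is a transposition of vertices; $R(s,i)$ preserves $Q_m(\mathfrak g)$ and its class in $\Gamma_{Q_m(\mathfrak g)}$ does not depend on $i\in\mathbb Z_m$. The map $r_s\mapsto R(s)$ extends to a homomorphism $R:W(\mathfrak g)\to\Gamma_{Q_m(\mathfrak g)}$. Adapted words. For a sink or source $s$ of $Q$, $r_s(Q)$ is the quiver obtained by reversing all arrows at $s$. A reduced word $(s_1,\dots,s_l)$ is adapted to $Q$ if $s_t$ is a sink of $r_{s_{t-1}}\cdots r_{s_1}(Q)$ for all $t=1,\dots,l$. (For finite type such a reduced word of $w_0$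 exists.) *)

theory Defs
  imports
    Complex_Main
    "HOL-Library.Countable"
    "HOL-Library.Poly_Mapping"
    "HOL-Computational_Algebra.Fraction_Field"
    "HOL-Combinatorics.Permutations"
    "HOL-Algebra.Group"
begin

(* "inv" is used below for inverse functions only *)
no_notation m_inv (\<open>(\<open>open_block notation=\<open>prefix inv\<close>\<close>inv\<index> _)\<close> [81] 80)

section \<open>Semifields\<close>

class semifield = comm_semiring + comm_monoid_mult + inverse +
  assumes semifield_left_inverse: "inverse a * a = 1"
    and semifield_divide: "a / b = a * inverse b"

datatype ztrop = ZTrop (unZTrop: int)

instantiation ztrop :: semifield
begin
definition "a + b = ZTrop (min (unZTrop a) (unZTrop b))"
definition "a * b = ZTrop (unZTrop a + unZTrop b)"
definition "1 = ZTrop 0"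
definition "inverse a = ZTrop (- unZTrop a)"
definition "a div b = ZTrop (unZTrop a - unZTrop b)"
instance
  by standard
    (auto simp: plus_ztrop_def times_ztrop_def one_ztrop_def inverse_ztrop_def divide_ztrop_def
      intro: ztrop.expand)
end

text \<open>Laurent monomials in variables \<open>u\<^sub>v\<close> indexed by the type \<^typ>\<open>'v\<close>, given by their exponents.\<close>

typedef 'v trop_monom = "{e :: 'v \<Rightarrow> int. finite {v. e v \<noteq> 0}}"
  morphisms expo Abs_trop_monom
  by (rule exI[of _ "\<lambda>_. 0"]) simp

setup_lifting type_definition_trop_monom

instantiation trop_monom :: (type) semifield
begin
lift_definition plus_trop_monom :: "'a trop_monom \<Rightarrow> 'a trop_monom \<Rightarrow> 'a trop_monom"
  is "\<lambda>a b v. min (a v) (b v)"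
  subgoal for a b by (rule finite_subset[of _ "{v. a v \<noteq> 0} \<union> {v. b v \<noteq> 0}"]) (auto simp: min_def)
  done
lift_definition times_trop_monom :: "'a trop_monom \<Rightarrow> 'a trop_monom \<Rightarrow> 'a trop_monom"
  is "\<lambda>a b v. a v + b v"
  subgoal for a b by (rule finite_subset[of _ "{v. a v \<noteq> 0} \<union> {v. b v \<noteq> 0}"]) auto
  done
lift_definition one_trop_monom :: "'a trop_monom" is "\<lambda>v. 0"
  by simp
lift_definition inverse_trop_monom :: "'a trop_monom \<Rightarrow> 'a trop_monom" is "\<lambda>a v. - a v"
  by simp
lift_definition divide_trop_monom :: "'a trop_monom \<Rightarrow> 'a trop_monom \<Rightarrow> 'a trop_monom"
  is "\<lambda>a b v. a v - b v"
  subgoal for a b by (rule finite_subset[of _ "{v. a v \<noteq> 0} \<union> {v. b v \<noteq> 0}"]) auto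
  done
instance
  by standard (transfer; auto simp: fun_eq_iff)+
end

lift_definition trop_var :: "'v \<Rightarrow> 'v trop_monom" is "\<lambda>v w. if w = v then 1 else 0"
  by simp

definition trop_positive :: "'v trop_monom \<Rightarrow> bool" where
  "trop_positive a \<longleftrightarrow> (\<forall>v. expo a v \<ge> 0)"


section \<open>Weighted quivers, seeds and mutations\<close>

text \<open>The arrow numbers \<open>\<sigma>\<close> of a weighted quiver are recovered from the weights and the exchange
  matrix, so the latter two are stored.\<close>

record 'v wquiver =
  verts :: "'v set"
  wt :: "'v \<Rightarrow> nat"
  exch :: "'v \<Rightarrow> 'v \<Rightarrow> int"

text \<open>The division is exact.\<close>

definition exch_of :: "('v \<Rightarrow> nat) \<Rightarrow> ('v \<Rightarrow> 'v \<Rightarrow> int) \<Rightarrow> 'v \<Rightarrow> 'v \<Rightarrow> int" where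
  "exch_of d \<sigma> i j = \<sigma> i j * int (d i) div int (gcd (d i) (d j))"

definition mut_exch :: "('v \<Rightarrow> 'v \<Rightarrow> int) \<Rightarrow> 'v \<Rightarrow> 'v \<Rightarrow> 'v \<Rightarrow> int" where
  "mut_exch \<epsilon> k i j =
     (if k = i \<or> k = j then - \<epsilon> i j
      else \<epsilon> i j + (\<bar>\<epsilon> i k\<bar> * \<epsilon> k j + \<epsilon> i k * \<bar>\<epsilon> k j\<bar>) div 2)"

text \<open>The sort constraint covers both semifields and the field of rational functions.\<close>

definition mut_coeff ::
    "('v \<Rightarrow> 'v \<Rightarrow> int) \<Rightarrow> 'v \<Rightarrow> ('v \<Rightarrow> 'p) \<Rightarrow> 'v \<Rightarrow> 'p :: {plus, power, inverse}" where
  "mut_coeff \<epsilon> k x i =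
     (if i = k then inverse (x k)
      else x i * (1 + x k powi (- sgn (\<epsilon> i k))) powi (- \<epsilon> i k))"

definition mut_A ::
    "'v set \<Rightarrow> ('v \<Rightarrow> 'v \<Rightarrow> int) \<Rightarrow> 'v \<Rightarrow> ('v \<Rightarrow> 'a) \<Rightarrow> 'v \<Rightarrow> 'a :: field" where
  "mut_A I \<epsilon> k A i =
     (if i = k
      then inverse (A k) * ((\<Prod>j \<in> {j \<in> I. \<epsilon> k j > 0}. A j powi \<epsilon> k j)
                          + (\<Prod>j \<in> {j \<in> I. \<epsilon> k j < 0}. A j powi (- \<epsilon> k j)))
      else A i)"

text \<open>A mutation sequence is a list of steps, read as a composition: the last entry is applied
  first, and concatenation is composition.\<close>

datatype 'v mstep = Mut 'v | Perm "'v \<Rightarrow> 'v"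

type_synonym 'v mseq = "'v mstep list"

fun valid_step :: "'v set \<Rightarrow> 'v mstep \<Rightarrow> bool" where
  "valid_step I (Mut k) \<longleftrightarrow> k \<in> I"
| "valid_step I (Perm \<pi>) \<longleftrightarrow> \<pi> permutes I"

definition mutation_sequence :: "'v set \<Rightarrow> 'v mseq \<Rightarrow> bool" where
  "mutation_sequence I \<phi> \<longleftrightarrow> (\<forall>f \<in> set \<phi>. valid_step I f)"

fun step_inv :: "'v mstep \<Rightarrow> 'v mstep" where
  "step_inv (Mut k) = Mut k"
| "step_inv (Perm \<pi>) = Perm (inv \<pi>)"

definition mseq_inv :: "'v mseq \<Rightarrow> 'v mseq" where
  "mseq_inv \<phi> = rev (map step_inv \<phi>)"

definition relabel :: "('v \<Rightarrow> 'v) \<Rightarrow> ('v \<Rightarrow> 'a) \<Rightarrow> 'v \<Rightarrow> 'a" where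
  "relabel \<pi> z i = z (inv \<pi> i)"

fun quiver_step :: "'v mstep \<Rightarrow> 'v wquiver \<Rightarrow> 'v wquiver" where
  "quiver_step (Mut k) Q = Q\<lparr>exch := mut_exch (exch Q) k\<rparr>"
| "quiver_step (Perm \<pi>) Q =
     Q\<lparr>wt := relabel \<pi> (wt Q), exch := (\<lambda>i j. exch Q (inv \<pi> i) (inv \<pi> j))\<rparr>"

fun coeff_step :: "'v mstep \<Rightarrow> 'v wquiver \<times> ('v \<Rightarrow> 'p) \<Rightarrow>
    'v wquiver \<times> ('v \<Rightarrow> 'p :: {plus, power, inverse})" where
  "coeff_step (Mut k) (Q, x) = (quiver_step (Mut k) Q, mut_coeff (exch Q) k x)"
| "coeff_step (Perm \<pi>) (Q, x) = (quiver_step (Perm \<pi>) Q, relabel \<pi> x)"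

fun seed_step :: "'v mstep \<Rightarrow> 'v wquiver \<times> ('v \<Rightarrow> 'a) \<times> ('v \<Rightarrow> 'a) \<Rightarrow>
    'v wquiver \<times> ('v \<Rightarrow> 'a) \<times> ('v \<Rightarrow> 'a :: field)" where
  "seed_step (Mut k) (Q, X, A) =
     (quiver_step (Mut k) Q, mut_coeff (exch Q) k X, mut_A (verts Q) (exch Q) k A)"
| "seed_step (Perm \<pi>) (Q, X, A) = (quiver_step (Perm \<pi>) Q, relabel \<pi> X, relabel \<pi> A)"

definition quiver_run :: "'v mseq \<Rightarrow> 'v wquiver \<Rightarrow> 'v wquiver" where
  "quiver_run \<phi> = foldr quiver_step \<phi>"

definition coeff_run :: "'v mseq \<Rightarrow> 'v wquiver \<times> ('v \<Rightarrow> 'p) \<Rightarrow>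
    'v wquiver \<times> ('v \<Rightarrow> 'p :: {plus, power, inverse})" where
  "coeff_run \<phi> = foldr coeff_step \<phi>"

definition seed_run :: "'v mseq \<Rightarrow> 'v wquiver \<times> ('v \<Rightarrow> 'a) \<times> ('v \<Rightarrow> 'a) \<Rightarrow>
    'v wquiver \<times> ('v \<Rightarrow> 'a) \<times> ('v \<Rightarrow> 'a :: field)" where
  "seed_run \<phi> = foldr seed_step \<phi>"


section \<open>The cluster modular group\<close>

definition preserves_quiver :: "'v wquiver \<Rightarrow> 'v mseq \<Rightarrow> bool" where
  "preserves_quiver Q \<phi> \<longleftrightarrow>
     mutation_sequence (verts Q) \<phi> \<and>
     (\<forall>i \<in> verts Q. wt (quiver_run \<phi> Q) i = wt Q i) \<and>
     (\<forall>i \<in> verts Q. \<forall>j \<in> verts Q. exch (quiver_run \<phi> Q) i j = exch Q i j)"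

definition seed_isomorphism :: "'v wquiver \<Rightarrow> ('v \<Rightarrow> 'v) \<Rightarrow> bool" where
  "seed_isomorphism Q \<pi> \<longleftrightarrow>
     \<pi> permutes verts Q \<and>
     (\<forall>i \<in> verts Q. \<forall>j \<in> verts Q. exch (quiver_step (Perm \<pi>) Q) i j = exch Q i j)"

text \<open>The field of rational functions over the rationals in countably many variables, as the
  fraction field of an integer polynomial ring. The vertices are numbered by \<^const>\<open>to_nat\<close> because
  the library needs linearly ordered variables to know that the polynomial ring is a domain.\<close>

type_synonym ratfun = "((nat \<Rightarrow>\<^sub>0 nat) \<Rightarrow>\<^sub>0 int) fract"

definition rat_var :: "'v :: countable \<Rightarrow> ratfun" where
  "rat_var v = Fract (Poly_Mapping.single (Poly_Mapping.single (to_nat v) 1) 1) 1"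

text \<open>The \<open>X\<close>- and the \<open>A\<close>-variables of a seed live in two separate copies of this field.\<close>

definition preserves_seed :: "'v :: countable wquiver \<Rightarrow> 'v mseq \<Rightarrow> bool" where
  "preserves_seed Q \<phi> \<longleftrightarrow>
     preserves_quiver Q \<phi> \<and>
     (case seed_run \<phi> (Q, rat_var, rat_var) of (Q', X, A) \<Rightarrow>
        \<forall>i \<in> verts Q. X i = rat_var i \<and> A i = rat_var i)"

definition modular_rel :: "'v :: countable wquiver \<Rightarrow> ('v mseq \<times> 'v mseq) set" where
  "modular_rel Q = {(\<phi>, \<psi>). preserves_quiver Q \<phi> \<and> preserves_quiver Q \<psi> \<and>
                             preserves_seed Q (mseq_inv \<psi> @ \<phi>)}"

definition modular_group :: "'v :: countable wquiver \<Rightarrow> 'v mseq set monoid" where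
  "modular_group Q =
     \<lparr>carrier = {\<phi>. preserves_quiver Q \<phi>} // modular_rel Q,
      mult = (\<lambda>K L. \<Union>\<phi>\<in>K. \<Union>\<psi>\<in>L. modular_rel Q `` {\<phi> @ \<psi>}),
      one = modular_rel Q `` {[]}\<rparr>"


section \<open>Green sequences and Donaldson-Thomas transformations\<close>

fun green_from :: "'v wquiver \<times> ('v \<Rightarrow> 'v trop_monom) \<Rightarrow> 'v mseq \<Rightarrow> bool" where
  "green_from z [] \<longleftrightarrow> True"
| "green_from z (Mut k # \<phi>) \<longleftrightarrow> green_from z \<phi> \<and> trop_positive (snd (coeff_run \<phi> z) k)"
| "green_from z (Perm \<pi> # \<phi>) \<longleftrightarrow> green_from z \<phi>"

definition green_sequence :: "'v wquiver \<Rightarrow> 'v mseq \<Rightarrow> bool" where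
  "green_sequence Q \<phi> \<longleftrightarrow> mutation_sequence (verts Q) \<phi> \<and> green_from (Q, trop_var) \<phi>"

definition trop_map :: "'v wquiver \<Rightarrow> 'v mseq \<Rightarrow> ('v \<Rightarrow> int) \<Rightarrow> 'v \<Rightarrow> int" where
  "trop_map Q \<phi> x = (\<lambda>i. unZTrop (snd (coeff_run \<phi> (Q, \<lambda>j. ZTrop (x j))) i))"

definition l_plus :: "'v \<Rightarrow> 'v \<Rightarrow> int" where
  "l_plus i j = (if i = j then 1 else 0)"

definition l_minus :: "'v \<Rightarrow> 'v \<Rightarrow> int" where
  "l_minus i j = (if i = j then - 1 else 0)"

text \<open>All representatives of a class induce the same map on tropical points; the condition is
  imposed on each of them.\<close>

definition cluster_DT :: "'v :: countable wquiver \<Rightarrow> 'v mseq set \<Rightarrow> bool" where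
  "cluster_DT Q K \<longleftrightarrow>
     K \<in> carrier (modular_group Q) \<and>
     (\<forall>\<phi> \<in> K. \<forall>i \<in> verts Q. \<forall>j \<in> verts Q. trop_map Q \<phi> (l_plus i) j = l_minus i j)"


section \<open>Cartan matrices and Weyl groups\<close>

definition symmetrizable_GCM :: "('s :: finite \<Rightarrow> 's \<Rightarrow> int) \<Rightarrow> ('s \<Rightarrow> nat) \<Rightarrow> bool" where
  "symmetrizable_GCM C d \<longleftrightarrow>
     (\<forall>s. C s s = 2) \<and>
     (\<forall>s t. s \<noteq> t \<longrightarrow> C s t \<le> 0) \<and>
     (\<forall>s t. C s t = 0 \<longleftrightarrow> C t s = 0) \<and>
     (\<forall>s. d s > 0) \<and> Gcd (range d) = 1 \<and>
     (\<forall>s t. int (d s) * C s t = int (d t) * C t s)"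

text \<open>Finite type: the symmetrized Cartan matrix is positive definite.\<close>

definition finite_type :: "('s :: finite \<Rightarrow> 's \<Rightarrow> int) \<Rightarrow> ('s \<Rightarrow> nat) \<Rightarrow> bool" where
  "finite_type C d \<longleftrightarrow>
     (\<forall>x :: 's \<Rightarrow> real. x \<noteq> (\<lambda>_. 0) \<longrightarrow>
        (\<Sum>s\<in>UNIV. \<Sum>t\<in>UNIV. real (d s) * real_of_int (C s t) * x s * x t) > 0)"

text \<open>The root lattice is \<^typ>\<open>'s \<Rightarrow> int\<close>, with the simple roots as its basis. The reflection is the
  linear map with \<open>r\<^sub>s \<alpha>\<^sub>t = \<alpha>\<^sub>t - C\<^sub>s\<^sub>t \<alpha>\<^sub>s\<close>. The Weyl group acts faithfully on the root
  lattice and is identified with its image.\<close>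

definition simple_root :: "'s \<Rightarrow> 's \<Rightarrow> int" where
  "simple_root s t = (if s = t then 1 else 0)"

definition simple_refl :: "('s :: finite \<Rightarrow> 's \<Rightarrow> int) \<Rightarrow> 's \<Rightarrow> ('s \<Rightarrow> int) \<Rightarrow> 's \<Rightarrow> int" where
  "simple_refl C s \<beta> = (\<lambda>u. \<beta> u - (\<Sum>t\<in>UNIV. C s t * \<beta> t) * simple_root s u)"

definition weyl_elt :: "('s :: finite \<Rightarrow> 's \<Rightarrow> int) \<Rightarrow> 's list \<Rightarrow> ('s \<Rightarrow> int) \<Rightarrow> 's \<Rightarrow> int" where
  "weyl_elt C ws = foldr (simple_refl C) ws"

definition weyl_group :: "('s :: finite \<Rightarrow> 's \<Rightarrow> int) \<Rightarrow> (('s \<Rightarrow> int) \<Rightarrow> 's \<Rightarrow> int) set" where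
  "weyl_group C = range (weyl_elt C)"

definition weyl_length :: "('s :: finite \<Rightarrow> 's \<Rightarrow> int) \<Rightarrow> (('s \<Rightarrow> int) \<Rightarrow> 's \<Rightarrow> int) \<Rightarrow> nat" where
  "weyl_length C w = (LEAST n. \<exists>ws. length ws = n \<and> weyl_elt C ws = w)"

definition reduced_expression ::
    "('s :: finite \<Rightarrow> 's \<Rightarrow> int) \<Rightarrow> (('s \<Rightarrow> int) \<Rightarrow> 's \<Rightarrow> int) \<Rightarrow> 's list \<Rightarrow> bool" where
  "reduced_expression C w ws \<longleftrightarrow> weyl_elt C ws = w \<and> length ws = weyl_length C w"

definition longest_element ::
    "('s :: finite \<Rightarrow> 's \<Rightarrow> int) \<Rightarrow> (('s \<Rightarrow> int) \<Rightarrow> 's \<Rightarrow> int) \<Rightarrow> bool" where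
  "longest_element C w \<longleftrightarrow>
     w \<in> weyl_group C \<and> (\<forall>v \<in> weyl_group C. weyl_length C v \<le> weyl_length C w)"

definition dynkin_involution :: "(('s \<Rightarrow> int) \<Rightarrow> 's \<Rightarrow> int) \<Rightarrow> 's \<Rightarrow> 's" where
  "dynkin_involution w0 s = (THE t. simple_root t = (\<lambda>u. - w0 (simple_root s) u))"


section \<open>Coxeter quivers and adapted words\<close>

definition coxeter_quiver ::
    "('s :: finite \<Rightarrow> 's \<Rightarrow> int) \<Rightarrow> ('s \<Rightarrow> nat) \<Rightarrow> ('s \<Rightarrow> 's \<Rightarrow> int) \<Rightarrow> bool" where
  "coxeter_quiver C d \<sigma> \<longleftrightarrow>
     (\<forall>s t. \<sigma> s t = - \<sigma> t s) \<and>
     (\<forall>s t. s \<noteq> t \<longrightarrow> \<bar>exch_of d \<sigma> s t\<bar> = - C t s)"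

definition sink :: "('s \<Rightarrow> 's \<Rightarrow> int) \<Rightarrow> 's \<Rightarrow> bool" where
  "sink \<sigma> s \<longleftrightarrow> (\<forall>t. \<sigma> s t \<le> 0)"

definition reverse_at :: "'s \<Rightarrow> ('s \<Rightarrow> 's \<Rightarrow> int) \<Rightarrow> 's \<Rightarrow> 's \<Rightarrow> int" where
  "reverse_at s \<sigma> t u = (if t = s \<or> u = s then - \<sigma> t u else \<sigma> t u)"

fun adapted :: "('s \<Rightarrow> 's \<Rightarrow> int) \<Rightarrow> 's list \<Rightarrow> bool" where
  "adapted \<sigma> [] \<longleftrightarrow> True"
| "adapted \<sigma> (s # ws) \<longleftrightarrow> sink \<sigma> s \<and> adapted (reverse_at s \<sigma>) ws"


section \<open>The quivers \<open>Q\<^sub>m\<close> and the Weyl group action\<close>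

text \<open>The vertex \<open>v\<^sub>i\<^sup>s\<close> is the pair of \<open>s\<close> and the representative of \<open>i\<close> in \<open>{0..<m}\<close>.\<close>

definition vtx :: "nat \<Rightarrow> 's \<Rightarrow> nat \<Rightarrow> 's \<times> nat" where
  "vtx m s i = (s, i mod m)"

definition Qm_verts :: "nat \<Rightarrow> ('s \<times> nat) set" where
  "Qm_verts m = UNIV \<times> {0..<m}"

text \<open>The number of arrows from one vertex to another, before cancelling opposite arrows.\<close>

fun Qm_arrows :: "nat \<Rightarrow> ('s \<Rightarrow> 's \<Rightarrow> int) \<Rightarrow> 's \<times> nat \<Rightarrow> 's \<times> nat \<Rightarrow> int" where
  "Qm_arrows m \<sigma> (s, i) (t, j) =
     (if (s, i) \<in> Qm_verts m \<and> (t, j) \<in> Qm_verts m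
      then (if s = t \<and> j = (i + 1) mod m then 1 else 0)
         + (if \<sigma> s t \<ge> 1 \<and> i = j then \<sigma> s t else 0)
         + (if \<sigma> t s \<ge> 1 \<and> i = (j + 1) mod m then \<sigma> t s else 0)
      else 0)"

definition Qm :: "nat \<Rightarrow> ('s \<Rightarrow> nat) \<Rightarrow> ('s \<Rightarrow> 's \<Rightarrow> int) \<Rightarrow> ('s \<times> nat) wquiver" where
  "Qm m d \<sigma> =
     \<lparr>verts = Qm_verts m,
      wt = (\<lambda>v. d (fst v)),
      exch = exch_of (\<lambda>v. d (fst v)) (\<lambda>v w. Qm_arrows m \<sigma> v w - Qm_arrows m \<sigma> w v)\<rparr>"

definition M_seq :: "nat \<Rightarrow> 's \<Rightarrow> nat \<Rightarrow> ('s \<times> nat) mseq" where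
  "M_seq m s i = rev (map (\<lambda>j. Mut (vtx m s j)) [i ..< m + i - 2])"

definition R_refl :: "nat \<Rightarrow> 's \<Rightarrow> nat \<Rightarrow> ('s \<times> nat) mseq" where
  "R_refl m s i =
     mseq_inv (M_seq m s i)
     @ [Perm (transpose (vtx m s (m + i - 2)) (vtx m s (m + i - 1))),
        Mut (vtx m s (m + i - 1)), Mut (vtx m s (m + i - 2))]
     @ M_seq m s i"

text \<open>The second list holds the choices of the base points \<open>i\<close>, one for each letter of the word.\<close>

definition R_word :: "nat \<Rightarrow> 's list \<Rightarrow> nat list \<Rightarrow> ('s \<times> nat) mseq" where
  "R_word m ws js = concat (map2 (R_refl m) ws js)"

text \<open>Outside the vertices of \<open>Q\<^sub>m\<close> the permutation \<open>\<sigma>\<^sub>Q\<close> is the identity.\<close>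

fun sigma_Q_inv :: "nat \<Rightarrow> ('s \<Rightarrow> 's) \<Rightarrow> 's list \<Rightarrow> 's \<times> nat \<Rightarrow> 's \<times> nat" where
  "sigma_Q_inv m star ws (s, i) =
     (if (s, i) \<in> Qm_verts m then vtx m (star s) (i + count_list ws (star s)) else (s, i))"

definition sigma_Q :: "nat \<Rightarrow> ('s \<Rightarrow> 's) \<Rightarrow> 's list \<Rightarrow> 's \<times> nat \<Rightarrow> 's \<times> nat" where
  "sigma_Q m star ws = inv (sigma_Q_inv m star ws)"

end

theory Submission
  imports Defs
    "HOL-Computational_Algebra.Polynomial"
    "HOL-Number_Theory.Cong"
begin

text \<open>
  A mutation at a vertex with positive coefficient changes the c-vectors by
  \<open>c\<^sub>i \<mapsto> c\<^sub>i + [\<epsilon>\<^sub>i\<^sub>k]\<^sub>+ c\<^sub>k\<close>, and the exchange matrix stays the Gram matrix of the c-vectors. If the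
  coefficients at the vertices of type \<open>s\<close> are positive, then \<open>R(s)\<close> is green; it sends the c-vector at
  \<open>v\<^sub>i\<^sup>s\<close> to minus the one at \<open>v\<^sub>i\<^sub>-\<^sub>1\<^sup>s\<close>, and adds to the one at \<open>v\<^sub>i\<^sup>t\<close> the multiple \<open>- C\<^sub>s\<^sub>t\<close> of the one at
  \<open>v\<^sub>i\<^sup>s\<close> or \<open>v\<^sub>i\<^sub>-\<^sub>1\<^sup>s\<close>, depending on the direction of the arrow between \<open>s\<close> and \<open>t\<close>. Writing the shift of
  \<open>i\<close> as multiplication by \<open>q\<close>, this is a deformation \<open>T\<^sub>s\<close> of the simple reflection \<open>r\<^sub>s\<close> that satisfies
  the braid relations. Hence \<open>T\<^sub>w\<close> is well defined for reduced words, and if \<open>l(w r\<^sub>s) > l(w)\<close> then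
  \<open>T\<^sub>w \<alpha>\<^sub>s\<close> has nonnegative coefficients, by the usual reduction to rank two. This is the greenness of \<open>R(w)\<close>.

  At a sink \<open>T\<^sub>s\<close> is \<open>r\<^sub>s\<close> composed with the scaling of \<open>\<alpha>\<^sub>s\<close> by \<open>q\<close>, and this scaling intertwines the
  deformations for the two orientations. For an adapted word of \<open>w\<^sub>0\<close> the product therefore telescopes to
  \<open>T \<alpha>\<^sub>s = - q\<^sup>n \<alpha>\<^sub>s\<^sub>*\<close> with \<open>n = n\<^sub>s\<close>, so that \<open>\<sigma>\<^sub>Q \<circ> R(w\<^sub>0)\<close> inverts all principal coefficients. The
  compatibility of \<open>\<sigma>\<^sub>Q\<close> with the arrows follows from \<open>T\<^bsub>w\<^sub>0\<^esub> T\<^sub>s = T\<^sub>s\<^sub>* T\<^bsub>w\<^sub>0\<^esub>\<close>.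
\<close>

section \<open>Deformed reflections\<close>

text \<open>On simple roots this is alpha_t |-> alpha_t + c_st alpha_s and alpha_s |-> -q alpha_s,
  written in coordinates. The parameters stay abstract so that one braid computation serves both the
  deformed action and the ordinary one, \<open>q = 1\<close> and \<open>c = -C\<close>.\<close>

definition defl :: "'a::idom \<Rightarrow> ('s::finite \<Rightarrow> 's \<Rightarrow> 'a) \<Rightarrow> 's \<Rightarrow> ('s \<Rightarrow> 'a) \<Rightarrow> 's \<Rightarrow> 'a" where
  "defl q c s y = y(s := (\<Sum>r\<in>UNIV - {s}. c s r * y r) - q * y s)"

definition word_op :: "'a::idom \<Rightarrow> ('s::finite \<Rightarrow> 's \<Rightarrow> 'a) \<Rightarrow> 's list \<Rightarrow> ('s \<Rightarrow> 'a) \<Rightarrow> 's \<Rightarrow> 'a" where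
  "word_op q c ws = foldr (defl q c) ws"

definition unit_vec :: "'s \<Rightarrow> 's \<Rightarrow> 'a::zero_neq_one" where
  "unit_vec s t = (if s = t then 1 else 0)"

fun alternating :: "nat \<Rightarrow> 's \<Rightarrow> 's \<Rightarrow> 's list" where
  "alternating 0 s t = []"
| "alternating (Suc n) s t = alternating n t s @ [t]"

lemma word_op_Nil [simp]: "word_op q c [] y = y"
  by (simp add: word_op_def)

lemma word_op_Cons [simp]: "word_op q c (s # ws) y = defl q c s (word_op q c ws y)"
  by (simp add: word_op_def)

lemma word_op_append [simp]: "word_op q c (a @ b) y = word_op q c a (word_op q c b y)"
  by (induction a) auto

lemma defl_linear:
  "defl q c s (\<lambda>u. a * y u + b * z u) = (\<lambda>u. a * defl q c s y u + b * defl q c s z u)"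
  by (auto simp: defl_def fun_eq_iff algebra_simps sum.distrib sum_distrib_left)

lemma word_op_linear:
  "word_op q c ws (\<lambda>u. a * y u + b * z u) = (\<lambda>u. a * word_op q c ws y u + b * word_op q c ws z u)"
  by (induction ws) (auto simp: defl_linear)

lemma word_op_scale: "word_op q c ws (\<lambda>u. a * y u) = (\<lambda>u. a * word_op q c ws y u)"
  using word_op_linear[of q c ws a y 0 y] by simp

lemma defl_unit_vec:
  "defl q c s (unit_vec t) = (if s = t then (\<lambda>u. - q * unit_vec s u)
     else (\<lambda>u. unit_vec t u + c s t * unit_vec s u))"
  by (auto simp: defl_def fun_eq_iff unit_vec_def if_distrib[of "\<lambda>x. _ * x"] sum.delta cong: if_cong)

text \<open>Reflections at \<open>s\<close> and \<open>t\<close> move only these two coordinates;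
  all others enter through a constant sum. The braid relations thereby become identities in two
  unknowns.\<close>

lemma defl_update:
  assumes "s \<noteq> t"
  shows "defl q c s (y(s := a, t := b)) =
           y(s := c s t * b - q * a + (\<Sum>r\<in>UNIV - {s, t}. c s r * y r), t := b)"
proof -
  have "UNIV - {s} = insert t (UNIV - {s, t})" using assms by auto
  then have "(\<Sum>r\<in>UNIV - {s}. c s r * (y(s := a, t := b)) r) =
      c s t * b + (\<Sum>r\<in>UNIV - {s, t}. c s r * (y(s := a, t := b)) r)" by simp
  also have "(\<Sum>r\<in>UNIV - {s, t}. c s r * (y(s := a, t := b)) r) = (\<Sum>r\<in>UNIV - {s, t}. c s r * y r)"
    by (rule sum.cong) auto
  finally show ?thesis using assms unfolding defl_def by (intro ext) (simp del: fun_upd_apply add: fun_upd_same fun_upd_other, simp)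
qed

lemma defl_update':
  assumes "s \<noteq> t"
  shows "defl q c t (y(s := a, t := b)) =
           y(s := a, t := c t s * a - q * b + (\<Sum>r\<in>UNIV - {s, t}. c t r * y r))"
  using defl_update[of t s q c y b a] assms by (simp add: fun_upd_twist insert_commute)

section \<open>Braid relations in rank two\<close>

lemma braid2:
  assumes "s \<noteq> t" "c s t = 0" "c t s = 0"
  shows "word_op q c [s, t] y = word_op q c [t, s] y"
proof -
  have y: "y = y(s := y s, t := y t)" by simp
  show ?thesis by (subst (1 2) y) (simp add: defl_update defl_update' assms del: fun_upd_triv)
qed

text \<open>Here \<open>a\<close>, \<open>b\<close> are the coordinates at \<open>s\<close>,
  \<open>t\<close>, while \<open>u\<close>, \<open>w\<close> are the two coupling coefficients and
  \<open>K\<close>, \<open>L\<close> the constant contributions of all other coordinates. The next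
  two identities are read in the same way.\<close>

lemma braid3_alg:
  fixes u w q a b K L :: "'a::idom"
  assumes "u * w = q"
  shows "u * (w * (u * b - q * a + K) - q * b + L) - q * (u * b - q * a + K) + K =
    u * (w * a - q * b + L) - q * a + K"
  unfolding assms[symmetric] by (simp add: algebra_simps)

lemma braid4_alg:
  fixes u w q a b K L :: "'a::idom"
  assumes "u * w = 2 * q"
  shows "u * (w * (u * (w * a - q * b + L) - q * a + K) - q * (w * a - q * b + L) + L) -
      q * (u * (w * a - q * b + L) - q * a + K) + K =
    u * (w * (u * b - q * a + K) - q * b + L) - q * (u * b - q * a + K) + K"
  using assms by algebra

lemma braid6_alg:
  fixes u w q a b K L :: "'a::idom"
  assumes "u * w = 3 * q"
  shows "u * (w * (u * (w * (u * (w * a - q * b + L) - q * a + K) - q * (w * a - q * b + L) + L) -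
      q * (u * (w * a - q * b + L) - q * a + K) + K) -
      q * (w * (u * (w * a - q * b + L) - q * a + K) - q * (w * a - q * b + L) + L) + L) -
      q * (u * (w * (u * (w * a - q * b + L) - q * a + K) - q * (w * a - q * b + L) + L) -
      q * (u * (w * a - q * b + L) - q * a + K) + K) + K =
    u * (w * (u * (w * (u * b - q * a + K) - q * b + L) - q * (u * b - q * a + K) + K) - 
       q * (w * (u * b - q * a + K) - q * b + L) + L) -
      q * (u * (w * (u * b - q * a + K) - q * b + L) - q * (u * b - q * a + K) + K) + K"
  using assms by algebra

lemma braid3:
  assumes "s \<noteq> t" "c s t * c t s = q"
  shows "word_op q c [s, t, s] y = word_op q c [t, s, t] y"
proof -
  have y: "y = y(s := y s, t := y t)" by simp
  show ?thesis
    apply (subst (1 2) y)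
    apply (simp add: defl_update[OF assms(1)] defl_update'[OF assms(1)] del: fun_upd_triv)
    apply (rule arg_cong2[where f = "\<lambda>a b. y(s := a, t := b)"])
     apply (rule braid3_alg[OF assms(2)])
    \<comment> \<open>The coordinate at \<open>t\<close> satisfies the same identity with
      \<open>s\<close> and \<open>t\<close> exchanged, read backwards.\<close>
    apply (rule braid3_alg[OF assms(2)[unfolded mult.commute[of "c s t"]], symmetric])
    done
qed

lemma braid4:
  assumes "s \<noteq> t" "c s t * c t s = 2 * q"
  shows "word_op q c [s, t, s, t] y = word_op q c [t, s, t, s] y"
proof -
  have y: "y = y(s := y s, t := y t)" by simp
  show ?thesis
    apply (subst (1 2) y)
    apply (simp add: defl_update[OF assms(1)] defl_update'[OF assms(1)] del: fun_upd_triv)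
    apply (rule arg_cong2[where f = "\<lambda>a b. y(s := a, t := b)"])
     apply (rule braid4_alg[OF assms(2)])
    apply (rule braid4_alg[OF assms(2)[unfolded mult.commute[of "c s t"]], symmetric])
    done
qed

lemma braid6:
  assumes "s \<noteq> t" "c s t * c t s = 3 * q"
  shows "word_op q c [s, t, s, t, s, t] y = word_op q c [t, s, t, s, t, s] y"
proof -
  have y: "y = y(s := y s, t := y t)" by simp
  show ?thesis
    apply (subst (1 2) y)
    apply (simp add: defl_update[OF assms(1)] defl_update'[OF assms(1)] del: fun_upd_triv)
    apply (rule arg_cong2[where f = "\<lambda>a b. y(s := a, t := b)"])
     apply (rule braid6_alg[OF assms(2)])
    apply (rule braid6_alg[OF assms(2)[unfolded mult.commute[of "c s t"]], symmetric])
    done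
qed

definition nonneg_poly :: "int poly \<Rightarrow> bool" where
  "nonneg_poly p \<longleftrightarrow> (\<forall>n. coeff p n \<ge> 0)"

lemma nonneg_poly_add: "nonneg_poly p \<Longrightarrow> nonneg_poly r \<Longrightarrow> nonneg_poly (p + r)"
  by (simp add: nonneg_poly_def)

lemma nonneg_poly_mult: "nonneg_poly p \<Longrightarrow> nonneg_poly r \<Longrightarrow> nonneg_poly (p * r)"
  by (auto simp: nonneg_poly_def coeff_mult intro!: sum_nonneg)

lemma nonneg_poly_monom: "a \<ge> 0 \<Longrightarrow> nonneg_poly (monom a n)"
  by (simp add: nonneg_poly_def)

lemma nonneg_poly_0 [simp]: "nonneg_poly 0" and nonneg_poly_1 [simp]: "nonneg_poly 1"
  by (simp_all add: nonneg_poly_def coeff_1)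

lemma poly_1_nonneg: "nonneg_poly p \<Longrightarrow> poly p 1 \<ge> 0"
  by (auto simp: nonneg_poly_def poly_altdef intro!: sum_nonneg)

text \<open>For \<open>N = C s t * C t s\<close> below 4 this is the order of r_s r_t.\<close>

fun cox_order :: "nat \<Rightarrow> nat" where
  "cox_order N = (if N = 0 then 2 else if N = 1 then 3 else if N = 2 then 4 else 6)"

text \<open>For \<open>N = 0\<close> the product condition only forces one of the two coefficients
  to vanish, whereas commutation needs both; the last hypothesis supplies this.\<close>

lemma braid:
  assumes "s \<noteq> t" "c s t * c t s = of_nat N * q" "N < 4" "N = 0 \<Longrightarrow> c s t = 0 \<and> c t s = 0"
  shows "word_op q c (alternating (cox_order N) s t) = word_op q c (alternating (cox_order N) t s)"
proof -
  consider "N = 0" | "N = 1" | "N = 2" | "N = 3" using assms(3) by linarith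
  then show ?thesis
  proof cases
    case 1 then show ?thesis using braid2[of s t c q] assms by (simp add: fun_eq_iff numeral_eq_Suc)
  next
    case 2 then show ?thesis using braid3[of s t c q] assms by (simp add: fun_eq_iff numeral_eq_Suc)
  next
    case 3 then show ?thesis using braid4[of s t c q] assms by (simp add: fun_eq_iff numeral_eq_Suc)
  next
    case 4 then show ?thesis using braid6[of s t c q] assms by (simp add: fun_eq_iff numeral_eq_Suc)
  qed
qed

text \<open>Exposes a suffix of prescribed length, so that a braid relation can be applied at the
  right end of a longer alternating word.\<close>

lemma alternating_add: "\<exists>x y. alternating (a + b) s t = alternating a x y @ alternating b s t"
proof (induction b arbitrary: s t)
  case (Suc b)
  then obtain x y where "alternating (a + b) t s = alternating a x y @ alternating b t s" by blast
  then show ?case by auto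
qed auto

lemma length_alternating [simp]: "length (alternating n s t) = n"
  by (induction n arbitrary: s t) auto

lemma alternating_Suc: "alternating (Suc n) s t = (if even n then t else s) # alternating n s t"
  by (induction n arbitrary: s t) auto

lemma simple_refl_defl:
  assumes "C s s = 2"
  shows "simple_refl C s = defl 1 (\<lambda>s t. - C s t) s"
proof (intro ext)
  fix \<beta> u
  have "(\<Sum>t\<in>UNIV. C s t * \<beta> t) = C s s * \<beta> s + (\<Sum>t\<in>UNIV - {s}. C s t * \<beta> t)"
    by (rule sum.remove) auto
  then show "simple_refl C s \<beta> u = defl 1 (\<lambda>s t. - C s t) s \<beta> u"
    using assms by (auto simp: simple_refl_def defl_def simple_root_def sum_negf)
qed

section \<open>The deformed and the ordinary Weyl group action\<close>

text \<open>The factor q marks the edges oriented from \<open>s\<close> to \<open>t\<close>. Each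
  edge carries it in exactly one direction, so c_st c_ts = C_st C_ts q, which is the shape the braid
  relations require.\<close>

definition oriented_coeff :: "('s \<Rightarrow> 's \<Rightarrow> int) \<Rightarrow> ('s \<Rightarrow> 's \<Rightarrow> bool) \<Rightarrow> 's \<Rightarrow> 's \<Rightarrow> int poly" where
  "oriented_coeff C ori s t = monom (- C s t) (of_bool (ori s t))"

locale oriented_cartan =
  fixes C :: "'s::finite \<Rightarrow> 's \<Rightarrow> int" and ori :: "'s \<Rightarrow> 's \<Rightarrow> bool"
  assumes C_diag: "C s s = 2"
    and C_nonpos: "s \<noteq> t \<Longrightarrow> C s t \<le> 0"
    and C_zero_iff: "C s t = 0 \<longleftrightarrow> C t s = 0"
    and ori_antisym: "s \<noteq> t \<Longrightarrow> C s t \<noteq> 0 \<Longrightarrow> ori s t \<longleftrightarrow> \<not> ori t s"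
begin

abbreviation qcoeff :: "'s \<Rightarrow> 's \<Rightarrow> int poly" where
  "qcoeff \<equiv> oriented_coeff C ori"

definition T :: "'s list \<Rightarrow> ('s \<Rightarrow> int poly) \<Rightarrow> 's \<Rightarrow> int poly" where
  "T = word_op (monom 1 1) qcoeff"

definition W :: "'s list \<Rightarrow> ('s \<Rightarrow> int) \<Rightarrow> 's \<Rightarrow> int" where
  "W = word_op 1 (\<lambda>s t. - C s t)"

lemma W_weyl_elt: "W = weyl_elt C"
proof -
  have "simple_refl C = defl 1 (\<lambda>s t. - C s t)"
    by (rule ext, rule simple_refl_defl) (rule C_diag)
  then show ?thesis by (intro ext) (simp only: W_def word_op_def weyl_elt_def)
qed

lemma qcoeff_nonneg: "s \<noteq> t \<Longrightarrow> nonneg_poly (qcoeff s t)"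
  unfolding oriented_coeff_def by (rule nonneg_poly_monom) (use C_nonpos in auto)

lemma qcoeff_mult: "s \<noteq> t \<Longrightarrow> qcoeff s t * qcoeff t s = monom (C s t * C t s) 1"
  using ori_antisym[of s t] C_zero_iff[of s t] by (auto simp: oriented_coeff_def mult_monom)

text \<open>Setting q = 1 recovers the Weyl group, so that positivity of polynomials can be compared
  with signs of roots.\<close>

lemma T_at_1: "poly (T ws y s) 1 = W ws (\<lambda>s. poly (y s) 1) s"
proof (induction ws arbitrary: s)
  case (Cons a ws)
  then show ?case by (simp add: T_def W_def defl_def poly_sum oriented_coeff_def poly_monom)
qed (auto simp: T_def W_def)

lemma W_involution: "defl 1 (\<lambda>s t. - C s t) s (defl 1 (\<lambda>s t. - C s t) s y) = y"
  by (auto simp: defl_def fun_eq_iff)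

lemma W_append: "W (a @ b) y = W a (W b y)" and W_Cons: "W (s # b) y = W [s] (W b y)"
    and W_Nil [simp]: "W [] y = y"
  by (simp_all add: W_def)

lemma T_append: "T (a @ b) y = T a (T b y)" and T_Cons: "T (s # b) y = T [s] (T b y)"
    and T_Nil [simp]: "T [] y = y"
  by (simp_all add: T_def)

lemma W_twice [simp]: "W [s] (W [s] y) = y"
  by (simp add: W_def W_involution)

lemma W_rev [simp]: "W (rev ws) (W ws y) = y"
proof (induction ws arbitrary: y)
  case (Cons s ws)
  have "W (rev (s # ws)) (W (s # ws) y) = W (rev ws) (W [s] (W [s] (W ws y)))"
    using W_Cons[of s ws] by (simp add: W_append)
  then show ?case using Cons by simp
qed simp

lemma W_unit_self: "W [s] (unit_vec s) = (\<lambda>u. - unit_vec s u)"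
  by (simp add: W_def defl_unit_vec)

lemma W_uminus: "W ws (\<lambda>u. - y u) = (\<lambda>u. - W ws y u)"
  using word_op_scale[of 1 "\<lambda>s t. - C s t" ws "-1" y] by (simp add: W_def)

lemma W_unit_nonzero: "W ws (unit_vec s) \<noteq> (\<lambda>_. 0)"
proof
  assume a: "W ws (unit_vec s) = (\<lambda>_. 0)"
  have "unit_vec s = W (rev ws) (W ws (unit_vec s))" by simp
  also have "\<dots> = (\<lambda>_. 0)" unfolding a using W_uminus[of "rev ws" "\<lambda>_. 0"] by (auto simp: fun_eq_iff)
  finally show False by (auto simp: fun_eq_iff unit_vec_def split: if_splits)
qed

text \<open>The braid relation applied to the last \<open>M\<close> letters changes the final letter
  from \<open>t\<close> to \<open>s\<close>. It is recorded for \<open>T\<close> and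
  \<open>W\<close> at once, with the same \<open>b\<close>, because the replacement word must be
  valid in both actions.\<close>

lemma dihedral_braid:
  assumes "s \<noteq> t" "C s t * C t s < 4" "n \<ge> cox_order (nat (C s t * C t s))"
  shows "\<exists>b. T (alternating n s t) = T (b @ [s]) \<and> W (alternating n s t) = W (b @ [s]) \<and> n = Suc (length b)"
proof -
  define M where "M = cox_order (nat (C s t * C t s))"
  have N: "C s t * C t s \<ge> 0" using C_nonpos[of s t] C_nonpos[of t s] assms(1)
    by (simp add: mult_nonpos_nonpos)
  have z: "C s t = 0 \<and> C t s = 0" if "nat (C s t * C t s) = 0" using that N C_zero_iff[of s t] by auto
  have less: "nat (C s t * C t s) < 4" using assms(2) by simp
  have bT: "T (alternating M s t) = T (alternating M t s)"
    unfolding T_def M_def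
  proof (rule braid)
    show "qcoeff s t * qcoeff t s = of_nat (nat (C s t * C t s)) * monom 1 1"
      using N by (simp add: qcoeff_mult[OF assms(1)] of_nat_monom mult_monom)
    show "nat (C s t * C t s) = 0 \<Longrightarrow> qcoeff s t = 0 \<and> qcoeff t s = 0"
      using z unfolding oriented_coeff_def by simp
  qed (use assms(1) less in simp_all)
  have bW: "W (alternating M s t) = W (alternating M t s)"
    unfolding W_def M_def
  proof (rule braid)
    show "- C s t * - C t s = of_nat (nat (C s t * C t s)) * 1" using N by simp
    show "nat (C s t * C t s) = 0 \<Longrightarrow> - C s t = 0 \<and> - C t s = 0" using z by simp
  qed (use assms(1) less in simp_all)
  obtain x y where xy: "alternating n s t = alternating (n - M) x y @ alternating M s t"
    using alternating_add[of "n - M" M s t] assms(3) M_def by auto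
  obtain k where k: "M = Suc k" using M_def by (cases M) (auto split: if_splits)
  let ?b = "alternating (n - M) x y @ alternating k s t"
  have e: "alternating (n - M) x y @ alternating M t s = ?b @ [s]" using k by simp
  have "T (alternating n s t) = T (?b @ [s])" unfolding xy e[symmetric]
    by (intro ext) (simp only: T_append bT)
  moreover have "W (alternating n s t) = W (?b @ [s])" unfolding xy e[symmetric]
    by (intro ext) (simp only: W_append bW)
  moreover have "n = Suc (length ?b)" using k assms(3) M_def by simp
  ultimately show ?thesis by blast
qed

lemma T_step_s:
  assumes "s \<noteq> t"
  shows "T [s] ((\<lambda>_. 0)(s := a, t := b)) = (\<lambda>_. 0)(s := qcoeff s t * b - monom 1 1 * a, t := b)"
  using defl_update[OF assms, of "monom 1 1" qcoeff "\<lambda>_. 0"] by (simp add: T_def)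

lemma T_step_t:
  assumes "s \<noteq> t"
  shows "T [t] ((\<lambda>_. 0)(s := a, t := b)) = (\<lambda>_. 0)(s := a, t := qcoeff t s * a - monom 1 1 * b)"
  using defl_update'[OF assms, of "monom 1 1" qcoeff "\<lambda>_. 0"] by (simp add: T_def)

text \<open>The coordinate changed last stays at least half as large as the positive term of its update.\<close>

lemma dihedral_infinite:
  assumes "s \<noteq> t" "C s t * C t s \<ge> 4"
  shows "\<exists>a b. T (alternating n s t) (unit_vec s) = (\<lambda>_. 0)(s := a, t := b) \<and>
     nonneg_poly a \<and> nonneg_poly b \<and>
     (even n \<longrightarrow> nonneg_poly (2 * a - qcoeff s t * b)) \<and>
     (odd n \<longrightarrow> nonneg_poly (2 * b - qcoeff t s * a))"
proof (induction n)
  case 0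
  have "unit_vec s = (\<lambda>_. 0)(s := 1, t := 0::int poly)" using assms by (auto simp: unit_vec_def)
  moreover have "nonneg_poly (2 :: int poly)" by (simp add: nonneg_poly_def numeral_poly coeff_pCons split: nat.split)
  moreover have "T (alternating 0 s t) (unit_vec s) = unit_vec s" by simp
  ultimately show ?case by (rule_tac x = 1 in exI, rule_tac x = 0 in exI) (auto simp del: fun_upd_apply)
next
  case (Suc n)
  then obtain a b where ab: "T (alternating n s t) (unit_vec s) = (\<lambda>_. 0)(s := a, t := b)"
     "nonneg_poly a" "nonneg_poly b" and ev: "even n \<Longrightarrow> nonneg_poly (2 * a - qcoeff s t * b)"
     and od: "odd n \<Longrightarrow> nonneg_poly (2 * b - qcoeff t s * a)" by blast
  define q where "q = (monom 1 1 :: int poly)"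
  \<comment> \<open>\<open>x\<close> is the coordinate changed last and \<open>w * x - q * y\<close>
    the new value of the other one. Multiplying the invariant by \<open>w\<close> gives 2wx >= Nqy
    >= 4qy coefficientwise, hence wx >= 2qy. This yields both the sign and the next
    invariant.\<close>
  have key: "nonneg_poly (w * x - q * y) \<and> nonneg_poly (2 * (w * x - q * y) - w * x)"
    if "nonneg_poly (2 * x - u * y)" "u * w = monom N 1" "N \<ge> 4" "nonneg_poly w" "nonneg_poly x" "nonneg_poly y" "nonneg_poly (w * x)"
    for x y u w N
  proof -
    have "nonneg_poly (w * (2 * x - u * y))" using that by (intro nonneg_poly_mult)
    moreover have "w * (2 * x - u * y) = 2 * (w * x) - (u * w) * y" by (simp add: algebra_simps)
    ultimately have "nonneg_poly (2 * (w * x) - monom N 1 * y)" by (simp only: that(2))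
    then have c: "coeff (monom N 1 * y) k \<le> 2 * coeff (w * x) k" for k
      by (auto simp: nonneg_poly_def numeral_poly dest: spec[of _ k])
    have e: "coeff (monom N 1 * y) k = N * coeff (q * y) k" for k
      unfolding q_def by (cases k) (simp_all add: coeff_monom_mult)
    have "coeff (q * y) k \<ge> 0" for k using that unfolding q_def
      by (simp add: coeff_monom_mult nonneg_poly_def)
    then have f: "4 * coeff (q * y) k \<le> N * coeff (q * y) k" for k
      using that(3) by (intro mult_right_mono) auto
    have g: "2 * coeff (q * y) k \<le> coeff (w * x) k" for k using c[of k] e[of k] f[of k] by linarith
    have h: "coeff (q * y) k \<ge> 0" for k using \<open>\<And>k. coeff (q * y) k \<ge> 0\<close> .
    have g': "coeff (q * y) k \<le> coeff (w * x) k" for k using g[of k] h[of k] by linarith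
    show ?thesis unfolding nonneg_poly_def using g g' by (simp add: numeral_poly)
  qed
  show ?case
  proof (cases "even n")
    case True
    have "T (alternating (Suc n) s t) (unit_vec s) = T [t] (T (alternating n s t) (unit_vec s))"
      using True by (simp only: alternating_Suc if_True T_Cons[of t "alternating n s t"])
    also have "\<dots> = (\<lambda>_. 0)(s := a, t := qcoeff t s * a - q * b)"
      unfolding ab(1) q_def by (rule T_step_t) fact
    finally have 1: "T (alternating (Suc n) s t) (unit_vec s) = \<dots>" .
    have "nonneg_poly (qcoeff t s * a - q * b) \<and> nonneg_poly (2 * (qcoeff t s * a - q * b) - qcoeff t s * a)"
    proof (rule key[OF ev[OF True] qcoeff_mult])
      show "nonneg_poly (qcoeff t s * a)" by (intro nonneg_poly_mult qcoeff_nonneg ab) (use assms in simp)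
    qed (use assms ab qcoeff_nonneg[of t s] in simp_all)
    then show ?thesis using 1 True ab(2)
      by (rule_tac x = a in exI, rule_tac x = "qcoeff t s * a - q * b" in exI)
         (simp del: fun_upd_apply alternating.simps)
  next
    case False
    have "T (alternating (Suc n) s t) (unit_vec s) = T [s] (T (alternating n s t) (unit_vec s))"
      using False by (simp only: alternating_Suc if_False T_Cons[of s "alternating n s t"])
    also have "\<dots> = (\<lambda>_. 0)(s := qcoeff s t * b - q * a, t := b)"
      unfolding ab(1) q_def by (rule T_step_s) fact
    finally have 1: "T (alternating (Suc n) s t) (unit_vec s) = \<dots>" .
    have "nonneg_poly (qcoeff s t * b - q * a) \<and> nonneg_poly (2 * (qcoeff s t * b - q * a) - qcoeff s t * b)"
    proof (rule key[OF od[OF False] qcoeff_mult])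
      show "nonneg_poly (qcoeff s t * b)" by (intro nonneg_poly_mult qcoeff_nonneg ab) (use assms in simp)
    qed (use assms ab qcoeff_nonneg[of s t] in \<open>simp_all add: mult.commute\<close>)
    then show ?thesis using 1 False ab(3)
      by (rule_tac x = "qcoeff s t * b - q * a" in exI, rule_tac x = b in exI)
         (simp del: fun_upd_apply alternating.simps)
  qed
qed


text \<open>Below the length of the braid relation only the six vectors \<open>v 0\<close>, ...,
  \<open>v 5\<close> can occur. They are computed for general \<open>N\<close>, the product of the
  two Cartan entries.\<close>

lemma dihedral_finite:
  assumes "s \<noteq> t" "C s t * C t s < 4" "n < cox_order (nat (C s t * C t s))"
  shows "\<exists>a b. T (alternating n s t) (unit_vec s) = (\<lambda>_. 0)(s := a, t := b) \<and>
     nonneg_poly a \<and> nonneg_poly b"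
proof -
  define N where "N = C s t * C t s"
  define u where "u = qcoeff s t"
  define w where "w = qcoeff t s"
  have N0: "N \<ge> 0" using C_nonpos[of s t] C_nonpos[of t s] assms(1)
    by (simp add: mult_nonpos_nonpos N_def)
  have uw: "u * w = monom N 1" unfolding u_def w_def N_def by (rule qcoeff_mult) fact
  have w: "nonneg_poly w" unfolding w_def by (rule qcoeff_nonneg) (use assms in simp)
  define v where "v n = T (alternating n s t) (unit_vec s)" for n
  have v0: "v 0 = (\<lambda>_. 0)(s := 1, t := 0)" using assms(1) by (auto simp: v_def unit_vec_def fun_eq_iff)
  have odd_step: "v (Suc n) = (\<lambda>_. 0)(s := a, t := w * a - monom 1 1 * b)"
    if "even n" "v n = (\<lambda>_. 0)(s := a, t := b)" for n a b
    using that T_step_t[OF assms(1), of a b] T_Cons[of t "alternating n s t"]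
    unfolding v_def w_def by (simp del: fun_upd_apply alternating.simps add: alternating_Suc)
  have even_step: "v (Suc n) = (\<lambda>_. 0)(s := u * b - monom 1 1 * a, t := b)"
    if "odd n" "v n = (\<lambda>_. 0)(s := a, t := b)" for n a b
    using that T_step_s[OF assms(1), of a b] T_Cons[of s "alternating n s t"]
    unfolding v_def u_def by (simp del: fun_upd_apply alternating.simps add: alternating_Suc)
  have v1: "v 1 = (\<lambda>_. 0)(s := 1, t := w)" using odd_step[OF _ v0] by simp
  have v2: "v 2 = (\<lambda>_. 0)(s := monom (N - 1) 1, t := w)"
    using even_step[OF _ v1] by (simp add: uw diff_monom numeral_2_eq_2)
  have v3: "v 3 = (\<lambda>_. 0)(s := monom (N - 1) 1, t := w * monom (N - 2) 1)"
  proof -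
    have "w * monom (N - 1) 1 - monom 1 1 * w = w * (monom (N - 1) 1 - monom 1 1)"
      by (simp add: algebra_simps)
    then show ?thesis using odd_step[OF _ v2] by (simp add: diff_monom numeral_3_eq_3 numeral_2_eq_2)
  qed
  have v4: "v 4 = (\<lambda>_. 0)(s := monom (N * (N - 2) - (N - 1)) 2, t := w * monom (N - 2) 1)"
  proof -
    have "u * (w * monom (N - 2) 1) = monom (N * (N - 2)) 2"
      unfolding mult.assoc[symmetric] uw by (simp add: mult_monom numeral_2_eq_2)
    moreover have "odd (3::nat)" by simp
    ultimately show ?thesis using even_step[OF _ v3]
      by (simp add: diff_monom mult_monom numeral_eq_Suc)
  qed
  have v5: "v 5 = (\<lambda>_. 0)(s := monom (N * (N - 2) - (N - 1)) 2, t := w * monom (N * (N - 2) - (N - 1) - (N - 2)) 2)"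
  proof -
    have "monom 1 1 * (w * monom (N - 2) 1) = w * monom (N - 2) 2"
      by (simp add: mult_monom numeral_2_eq_2 mult.left_commute[of _ w])
    then have "w * monom (N * (N - 2) - (N - 1)) 2 - monom 1 1 * (w * monom (N - 2) 1) =
        w * monom (N * (N - 2) - (N - 1) - (N - 2)) 2"
      by (simp only: right_diff_distrib[symmetric] diff_monom)
    moreover have "even (4::nat)" by simp
    ultimately show ?thesis using odd_step[OF _ v4] by (simp add: numeral_eq_Suc)
  qed
  note nn = nonneg_poly_mult[OF w nonneg_poly_monom] nonneg_poly_monom w nonneg_poly_0 nonneg_poly_1
  have "N = 0 \<or> N = 1 \<or> N = 2 \<or> N = 3" using N0 assms(2) N_def by linarith
  \<comment> \<open>In each listed case the bound on \<open>N\<close> makes the coefficients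
    computed above nonnegative.\<close>
  then have n: "n = 0 \<or> n = 1 \<or> (n = 2 \<and> N \<ge> 1) \<or> (n = 3 \<and> N \<ge> 2) \<or> (n = 4 \<and> N = 3) \<or> (n = 5 \<and> N = 3)"
    using assms(3) unfolding N_def[symmetric] by (elim disjE; simp; linarith)
  have ex: "\<exists>a b. v n = (\<lambda>_. 0)(s := a, t := b) \<and> nonneg_poly a \<and> nonneg_poly b"
    if "v n = (\<lambda>_. 0)(s := a, t := b)" "nonneg_poly a" "nonneg_poly b" for a b using that by blast
  have "\<exists>a b. v n = (\<lambda>_. 0)(s := a, t := b) \<and> nonneg_poly a \<and> nonneg_poly b"
    using n
  proof (elim disjE conjE)
    assume "n = 0" then show ?thesis using v0 ex[of 1 0] by (simp del: fun_upd_apply)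
  next
    assume "n = 1" then show ?thesis using v1
      by (intro ex[of "1" "w"] nn) (simp_all del: fun_upd_apply)
  next
    assume "n = 2" "N \<ge> 1" then show ?thesis using v2
      by (intro ex[of "monom (N - 1) 1" "w"] nn) (simp_all del: fun_upd_apply)
  next
    assume "n = 3" "N \<ge> 2" then show ?thesis using v3
      by (intro ex[of "monom (N - 1) 1" "w * monom (N - 2) 1"] nn) (simp_all del: fun_upd_apply)
  next
    assume "n = 4" "N = 3" then show ?thesis using v4
      by (intro ex[of "monom (N * (N - 2) - (N - 1)) 2" "w * monom (N - 2) 1"] nn) (simp_all del: fun_upd_apply)
  next
    assume "n = 5" "N = 3" then show ?thesis using v5
      by (intro ex[of "monom (N * (N - 2) - (N - 1)) 2" "w * monom (N * (N - 2) - (N - 1) - (N - 2)) 2"] nn) (simp_all del: fun_upd_apply)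
  qed
  then show ?thesis unfolding v_def .
qed

subsection \<open>Reduced words\<close>

definition reduced :: "'s list \<Rightarrow> bool" where
  "reduced ws \<longleftrightarrow> (\<forall>us. W us = W ws \<longrightarrow> length ws \<le> length us)"

text \<open>For reduced \<open>a\<close> this is l(w r_s) > l(w): the two lengths never agree, so
  the weak inequality suffices and no parity argument is needed.\<close>

definition ascent :: "'s list \<Rightarrow> 's \<Rightarrow> bool" where
  "ascent a s \<longleftrightarrow> (\<forall>us. W us = W (a @ [s]) \<longrightarrow> length a \<le> length us)"

lemma W_cong_append: "W a = W a' \<Longrightarrow> W b = W b' \<Longrightarrow> W (a @ b) = W (a' @ b')"
  by (intro ext) (simp only: W_append)

lemma T_cong_append: "T a = T a' \<Longrightarrow> T b = T b' \<Longrightarrow> T (a @ b) = T (a' @ b')"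
  by (intro ext) (simp only: T_append)

lemma W_cancel: "W (a @ s # s # b) = W (a @ b)"
proof -
  have "W (s # s # b) = W b" using W_Cons[of s "s # b"] W_Cons[of s b] by (intro ext) simp
  then show ?thesis by (intro W_cong_append) auto
qed

lemma reduced_append1: "reduced (a @ b) \<Longrightarrow> reduced a"
  unfolding reduced_def
proof safe
  fix us assume 1: "\<forall>us. W us = W (a @ b) \<longrightarrow> length (a @ b) \<le> length us" and "W us = W a"
  then have "W (us @ b) = W (a @ b)" by (intro W_cong_append) auto
  then show "length a \<le> length us" using 1 by fastforce
qed

lemma reduced_append2: "reduced (a @ b) \<Longrightarrow> reduced b"
  unfolding reduced_def
proof safe
  fix us assume 1: "\<forall>us. W us = W (a @ b) \<longrightarrow> length (a @ b) \<le> length us" and "W us = W b"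
  then have "W (a @ us) = W (a @ b)" by (intro W_cong_append) auto
  then show "length b \<le> length us" using 1 by fastforce
qed

lemma reduced_cong: "reduced a \<Longrightarrow> W b = W a \<Longrightarrow> length b = length a \<Longrightarrow> reduced b"
  by (simp add: reduced_def)

lemma reduced_snoc_ascent: "reduced (a @ [s]) \<Longrightarrow> ascent a s"
  unfolding reduced_def ascent_def by fastforce

text \<open>Among the length-additive factorizations with \<open>b\<close> in the letters
  \<open>s\<close>, \<open>t\<close>, one with \<open>b\<close> of maximal length is taken. Then
  \<open>a\<close> is a minimal coset representative, since a descent of \<open>a\<close> at
  \<open>s\<close> or \<open>t\<close> could be moved into \<open>b\<close>.\<close>

lemma peel:
  assumes "reduced w"
  shows "\<exists>a b. W (a @ b) = W w \<and> length a + length b = length w \<and> set b \<subseteq> {s, t} \<and> ascent a s \<and> ascent a t"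
proof -
  define P where "P k \<longleftrightarrow> (\<exists>a b. W (a @ b) = W w \<and> length a + length b = length w \<and>
      set b \<subseteq> {s, t} \<and> length b = k)" for k
  have "P 0" unfolding P_def by (intro exI[of _ w] exI[of _ "[]"]) simp
  moreover have "\<forall>k. P k \<longrightarrow> k \<le> length w" unfolding P_def by auto
  ultimately obtain k where k: "P k" "\<And>j. P j \<Longrightarrow> j \<le> k"
    using Nat.ex_has_greatest_nat[of P 0 "length w"] by blast
  obtain a b where ab: "W (a @ b) = W w" "length a + length b = length w" "set b \<subseteq> {s, t}" "length b = k"
    using k(1) unfolding P_def by blast
  have "ascent a x" if x: "x \<in> {s, t}" for x
  proof (rule ccontr)
    assume "\<not> ascent a x"
    then obtain us where us: "W us = W (a @ [x])" "length us < length a" unfolding ascent_def by force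
    have "W (us @ x # b) = W ((a @ [x]) @ x # b)" by (rule W_cong_append) (use us in auto)
    then have 1: "W (us @ x # b) = W w" using W_cancel[of a x b] ab by simp
    then have "length w \<le> length (us @ x # b)" using assms unfolding reduced_def by blast
    then have "length us + length (x # b) = length w" using us ab by simp
    then have "P (Suc k)" unfolding P_def using 1 ab x by (intro exI[of _ us] exI[of _ "x # b"]) auto
    then show False using k(2) by fastforce
  qed
  then show ?thesis using ab by blast
qed

text \<open>Two equal neighbours would cancel, so a reduced word in two letters is determined by its
  length and its last letter.\<close>

lemma reduced_alternating:
  "reduced b \<Longrightarrow> set b \<subseteq> {s, t} \<Longrightarrow> b \<noteq> [] \<Longrightarrow> last b = t \<Longrightarrow> b = alternating (length b) s t"
proof (induction b arbitrary: s t rule: rev_induct)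
  case (snoc x b)
  show ?case
  proof (cases "b = []")
    case False
    have "last b \<noteq> t"
    proof
      assume "last b = t"
      then obtain b1 where "b = b1 @ [t]" using False by (metis append_butlast_last_id)
      then have "W (b @ [x]) = W b1" using W_cancel[of b1 t "[]"] snoc by simp
      then show False using snoc(2) \<open>b = b1 @ [t]\<close> unfolding reduced_def
        by (metis append_assoc append_eq_append_conv2 length_append length_append_singleton not_less_eq_eq le_add1 le_SucI)
    qed
    then have "last b = s" using last_in_set[OF False] snoc(3) by auto
    then have "b = alternating (length b) t s" using snoc False reduced_append1 by (intro snoc.IH) auto
    then show ?thesis using snoc by simp
  qed (use snoc in simp)
qed simp

text \<open>If \<open>b\<close> is at least as long as a braid relation between \<open>s\<close> and
  \<open>t\<close>, it can be rewritten to end in \<open>s\<close>. If it is shorter, or if there is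
  no such relation, the explicit dihedral vectors are nonnegative.\<close>

lemma rank_two:
  assumes "reduced b" "set b \<subseteq> {s, t}" "b \<noteq> []" "last b = t" "s \<noteq> t"
  shows "(\<exists>b'. T b = T (b' @ [s]) \<and> W b = W (b' @ [s]) \<and> length b = Suc (length b')) \<or>
    (\<exists>p r. nonneg_poly p \<and> nonneg_poly r \<and> T b (unit_vec s) = (\<lambda>u. p * unit_vec s u + r * unit_vec t u))"
proof -
  define n where "n = length b"
  have b: "b = alternating n s t" unfolding n_def by (rule reduced_alternating) (use assms in auto)
  have upd: "(\<lambda>_. 0)(s := p, t := r) = (\<lambda>u. p * unit_vec s u + r * unit_vec t u)" for p r :: "int poly"
    using assms(5) by (auto simp: unit_vec_def fun_eq_iff)
  show ?thesis
  proof (cases "C s t * C t s < 4 \<and> n \<ge> cox_order (nat (C s t * C t s))")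
    case True
    then show ?thesis using dihedral_braid[OF assms(5), of n] unfolding b by simp
  next
    case False
    then have "\<exists>p r. T b (unit_vec s) = (\<lambda>_. 0)(s := p, t := r) \<and> nonneg_poly p \<and> nonneg_poly r"
      using dihedral_finite[OF assms(5), of n] dihedral_infinite[OF assms(5), of n] unfolding b
      by (meson not_less)
    then show ?thesis unfolding upd by blast
  qed
qed


lemma W_unit_vec: "W ws (unit_vec s) u = poly (T ws (unit_vec s) u) 1"
proof -
  have "(\<lambda>t. poly (unit_vec s t) 1) = (unit_vec s :: 's \<Rightarrow> int)" by (auto simp: unit_vec_def)
  then show ?thesis by (simp add: T_at_1)
qed

lemma W_unit_vec_nonneg: "(\<And>u. nonneg_poly (T ws (unit_vec s) u)) \<Longrightarrow> W ws (unit_vec s) u \<ge> 0"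
  unfolding W_unit_vec by (rule poly_1_nonneg)

lemma W_snoc_unit: "W (a @ [s]) (unit_vec s) = (\<lambda>u. - W a (unit_vec s) u)"
  by (simp add: W_append W_unit_self W_uminus)

text \<open>Since r_s negates alpha_s, its image under \<open>b\<close> is minus a nonnegative
  vector, and this vector is nonzero because words act invertibly.\<close>

lemma descent_not_nonneg:
  assumes "\<And>u. nonneg_poly (T a (unit_vec s) u)" "W (a @ [s]) = W b"
  shows "\<not> (\<forall>u. W b (unit_vec s) u \<ge> 0)"
proof
  assume "\<forall>u. W b (unit_vec s) u \<ge> 0"
  then have "- W a (unit_vec s) u \<ge> 0" for u
    using fun_cong[OF W_snoc_unit[of a s], of u] unfolding assms(2) by metis
  moreover have "W a (unit_vec s) u \<ge> 0" for u by (rule W_unit_vec_nonneg[OF assms(1)])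
  ultimately have "W a (unit_vec s) = (\<lambda>_. 0)" by (intro ext order.antisym) (simp_all add: le_minus_iff)
  then show False using W_unit_nonzero[of a s] by contradiction
qed

text \<open>The final letter \<open>t\<close> is a descent of \<open>w\<close>, whereas
  \<open>a\<close> has an ascent there, so \<open>b\<close> cannot be empty.\<close>

lemma peel_descent:
  assumes "reduced w" "w = w' @ [t]"
  shows "\<exists>a b. reduced (a @ b) \<and> W (a @ b) = W w \<and> length a + length b = length w \<and> set b \<subseteq> {s, t} \<and>
    ascent a s \<and> ascent a t \<and> b \<noteq> []"
proof -
  obtain a b where ab: "W (a @ b) = W w" "length a + length b = length w" "set b \<subseteq> {s, t}" "ascent a s" "ascent a t"
    using peel[OF assms(1), of s t] by blast
  have "b \<noteq> []"
  proof
    assume b: "b = []"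
    then have "W (a @ [t]) = W (w @ [t])" using ab by (intro W_cong_append) auto
    also have "\<dots> = W w'" using W_cancel[of w' t "[]"] assms by simp
    finally have "length a \<le> length w'" using ab(5) unfolding ascent_def by metis
    then show False using ab b assms by simp
  qed
  moreover have "reduced (a @ b)" by (rule reduced_cong[OF assms(1)]) (use ab in auto)
  ultimately show ?thesis using ab by blast
qed

lemma T_positive_combination:
  assumes "T b (unit_vec s) = (\<lambda>u. p * unit_vec s u + r * unit_vec t u)" "nonneg_poly p" "nonneg_poly r"
    "\<And>u. nonneg_poly (T a (unit_vec s) u)" "\<And>u. nonneg_poly (T a (unit_vec t) u)"
  shows "nonneg_poly (T (a @ b) (unit_vec s) u)"
proof -
  have "T (a @ b) (unit_vec s) u = p * T a (unit_vec s) u + r * T a (unit_vec t) u"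
    unfolding T_append assms(1) unfolding T_def word_op_linear ..
  then show ?thesis using assms by (auto intro: nonneg_poly_add nonneg_poly_mult)
qed

text \<open>The two claims need each other: positivity of a word is read off another reduced word of the
  same element, and two reduced words with different last letters \<open>s\<close>, \<open>t\<close> are compared through a word
  ending in an alternating word of \<open>s\<close> and \<open>t\<close>, which positivity forces to be long enough for a braid
  relation.\<close>

lemma matsumoto_positivity:
  "(\<forall>a b. reduced a \<longrightarrow> reduced b \<longrightarrow> length a = n \<longrightarrow> length b = n \<longrightarrow> W a = W b \<longrightarrow> T a = T b) \<and>
   (\<forall>a s u. reduced a \<longrightarrow> length a = n \<longrightarrow> ascent a s \<longrightarrow> nonneg_poly (T a (unit_vec s) u))"
proof (induction n rule: less_induct)
  case (less n)
  have A: "T a = T b" if "reduced a" "reduced b" "length a < n" "length b = length a" "W a = W b" for a b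
    using conjunct1[OF less[OF that(3)]] that by metis
  have B: "nonneg_poly (T a (unit_vec s) u)" if "reduced a" "length a < n" "ascent a s" for a s u
    using conjunct2[OF less[OF that(2)]] that by metis
  have A_last: "T a = T b"
    if "reduced a" "reduced b" "length a = n" "length b = n" "W a = W b" "a = a' @ [s]" "b = b' @ [s]" for a b a' b' s
  proof -
    have "W a' = W (a @ [s])" using W_cancel[of a' s "[]"] that by simp
    also have "\<dots> = W (b @ [s])" by (rule W_cong_append) (use that in auto)
    also have "\<dots> = W b'" using W_cancel[of b' s "[]"] that by simp
    finally have "T a' = T b'" using that by (intro A) (auto dest: reduced_append1)
    then show ?thesis unfolding that by (intro T_cong_append) auto
  qed
  \<comment> \<open>The word \<open>v @ [s]\<close> shows that alpha_s is sent to a vector that is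
    not nonnegative. By the induction hypothesis for \<open>a\<close> this excludes the positive
    alternative of \<open>rank_two\<close>, so the braid alternative rewrites \<open>w\<close> to
    end in \<open>s\<close> without changing \<open>T\<close>.\<close>
  have half: "\<exists>w'. T w = T (w' @ [s]) \<and> W w = W (w' @ [s]) \<and> length (w' @ [s]) = n \<and> reduced (w' @ [s])"
    if w: "reduced w" "length w = n" "w = a @ b" "b \<noteq> []" "set b \<subseteq> {s, t}" "last b = t" "s \<noteq> t"
      "ascent a s" "ascent a t" and neg: "reduced (v @ [s])" "length (v @ [s]) = n" "W (v @ [s]) = W w"
    for w a b s t v
  proof -
    have rb: "reduced b" "reduced a" using w reduced_append1 reduced_append2 by blast+
    have la: "length a < n" using w by auto
    have "\<not> (\<forall>u. W w (unit_vec s) u \<ge> 0)"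
    proof (rule descent_not_nonneg)
      show "nonneg_poly (T v (unit_vec s) u)" for u
        by (rule B) (use neg reduced_append1 reduced_snoc_ascent in auto)
    qed (use neg in simp)
    then have "\<not> (\<forall>u. nonneg_poly (T (a @ b) (unit_vec s) u))" using W_unit_vec_nonneg[of w s] w(3) by blast
    then have "\<exists>b'. T b = T (b' @ [s]) \<and> W b = W (b' @ [s]) \<and> length b = Suc (length b')"
      using rank_two[OF rb(1) w(5,4,6,7)] T_positive_combination B[OF rb(2) la w(8)] B[OF rb(2) la w(9)] by blast
    then obtain b' where b': "T b = T (b' @ [s])" "W b = W (b' @ [s])" "length b = Suc (length b')" by blast
    have "T w = T (a @ b' @ [s])" unfolding w(3) by (rule T_cong_append) (use b' in auto)
    moreover have W: "W w = W (a @ b' @ [s])" unfolding w(3) by (rule W_cong_append) (use b' in auto)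
    moreover have l: "length (a @ b' @ [s]) = n" using b' w by auto
    moreover have "reduced (a @ b' @ [s])" by (rule reduced_cong[OF w(1)]) (use W l w in auto)
    ultimately show ?thesis by (intro exI[of _ "a @ b'"]) simp
  qed
  have A_n: "T x = T y" if xy: "reduced x" "reduced y" "length x = n" "length y = n" "W x = W y" for x y
  proof (cases "n = 0")
    case False
    then obtain x' s y' t where x': "x = x' @ [s]" and y': "y = y' @ [t]"
      using xy by (metis length_0_conv rev_exhaust)
    show ?thesis
    proof (cases "s = t")
      case True then show ?thesis using A_last[OF xy] x' y' by blast
    next
      case False
      \<comment> \<open>This intermediate word ends in \<open>s\<close> or in \<open>t\<close>. It
        is compared directly with the given word of the same last letter, and through
        \<open>half\<close> with the other one.\<close>
      obtain a b where ab: "reduced (a @ b)" "W (a @ b) = W y" "length a + length b = n" "set b \<subseteq> {s, t}"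
          "ascent a s" "ascent a t" "b \<noteq> []"
        using peel_descent[OF xy(2) y', of s] xy by metis
      have L: "length (a @ b) = n" using ab by simp
      have "last b = s \<or> last b = t" using last_in_set[OF ab(7)] ab(4) by blast
      then show ?thesis
      proof
        assume l: "last b = t"
        then have "a @ b = (a @ butlast b) @ [t]" using append_butlast_last_id[OF ab(7)] by simp
        then have "T y = T (a @ b)" using A_last[OF xy(2) ab(1) xy(4) L ab(2)[symmetric] y'] by blast
        moreover obtain w' where w': "T (a @ b) = T (w' @ [s])" "W (a @ b) = W (w' @ [s])"
            "length (w' @ [s]) = n" "reduced (w' @ [s])"
          using half[OF ab(1) L refl ab(7,4) l False ab(5,6), of x'] xy x' ab(2) by metis
        moreover have "T x = T (w' @ [s])"
          by (rule A_last[OF xy(1) w'(4) xy(3) w'(3) _ x' refl]) (use w'(2) ab(2) xy(5) in simp)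
        ultimately show ?thesis by simp
      next
        assume l: "last b = s"
        then have "a @ b = (a @ butlast b) @ [s]" using append_butlast_last_id[OF ab(7)] by simp
        then have "T x = T (a @ b)" using A_last[OF xy(1) ab(1) xy(3) L _ x'] ab(2) xy by metis
        moreover have "set b \<subseteq> {t, s}" using ab by auto
        moreover obtain w' where w': "T (a @ b) = T (w' @ [t])" "W (a @ b) = W (w' @ [t])"
            "length (w' @ [t]) = n" "reduced (w' @ [t])"
          using half[OF ab(1) L refl ab(7) \<open>set b \<subseteq> {t, s}\<close> l not_sym[OF False] ab(6,5), of y'] xy y' ab(2) by metis
        moreover have "T y = T (w' @ [t])"
          by (rule A_last[OF xy(2) w'(4) xy(4) w'(3) _ y' refl]) (use w'(2) ab(2) in simp)
        ultimately show ?thesis by simp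
      qed
    qed
  qed (use that in auto)
  have B_n: "nonneg_poly (T x (unit_vec s) u)" if x: "reduced x" "length x = n" "ascent x s" for x s u
  proof (cases "n = 0")
    case True then show ?thesis using x by (simp add: unit_vec_def)
  next
    case False
    then obtain x' t where x': "x = x' @ [t]"
      using x by (metis length_0_conv rev_exhaust)
    \<comment> \<open>An ascent at \<open>s\<close> forbids reduced words ending in
      \<open>s\<close>; this rules out the braid alternative of \<open>rank_two\<close>
      below.\<close>
    have no_s: False if "W x = W (z @ [s])" "length x = Suc (length z)" for z
    proof -
      have "W (x @ [s]) = W ((z @ [s]) @ [s])" by (rule W_cong_append) (use that in auto)
      also have "\<dots> = W z" using W_cancel[of z s "[]"] by simp
      finally show False using x(3) that unfolding ascent_def by fastforce
    qed
    have "s \<noteq> t" using no_s[of x'] x' by auto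
    obtain a b where ab: "reduced (a @ b)" "W (a @ b) = W x" "length a + length b = n" "set b \<subseteq> {s, t}"
          "ascent a s" "ascent a t" "b \<noteq> []"
      using peel_descent[OF x(1) x', of s] x by metis
    have "last b \<noteq> s"
    proof
      assume "last b = s"
      then have "a @ b = (a @ butlast b) @ [s]" using append_butlast_last_id[OF ab(7)] by simp
      then show False using no_s[of "a @ butlast b"] ab x by (metis length_append length_append_singleton)
    qed
    then have lb: "last b = t" using last_in_set[OF ab(7)] ab(4) by blast
    have rb: "reduced b" "reduced a" using ab reduced_append1 reduced_append2 by blast+
    have la: "length a < n" using ab by (cases b) auto
    have "\<not> (\<exists>b'. T b = T (b' @ [s]) \<and> W b = W (b' @ [s]) \<and> length b = Suc (length b'))"
    proof
      assume "\<exists>b'. T b = T (b' @ [s]) \<and> W b = W (b' @ [s]) \<and> length b = Suc (length b')"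
      then obtain b' where b': "W b = W (b' @ [s])" "length b = Suc (length b')" by blast
      then have "W (a @ b) = W (a @ b' @ [s])" by (intro W_cong_append) auto
      then show False using no_s[of "a @ b'"] ab x b' by simp
    qed
    then have "nonneg_poly (T (a @ b) (unit_vec s) u)"
      using rank_two[OF rb(1) ab(4) ab(7) lb \<open>s \<noteq> t\<close>] T_positive_combination
        B[OF rb(2) la ab(5)] B[OF rb(2) la ab(6)] by blast
    moreover have "T x = T (a @ b)" by (rule A_n) (use x ab in auto)
    ultimately show ?thesis by simp
  qed
  show ?case using A_n B_n by blast
qed

lemma matsumoto: "reduced a \<Longrightarrow> reduced b \<Longrightarrow> W a = W b \<Longrightarrow> T a = T b"
proof -
  assume r: "reduced a" "reduced b" "W a = W b"
  then have "length a = length b" unfolding reduced_def by (intro order.antisym) auto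
  then show "T a = T b" by (intro conjunct1[OF matsumoto_positivity, rule_format, OF _ _ refl]) (use r in auto)
qed

lemma T_ascent_nonneg: "reduced a \<Longrightarrow> ascent a s \<Longrightarrow> nonneg_poly (T a (unit_vec s) u)"
  using conjunct2[OF matsumoto_positivity[of "length a"]] by simp

lemma reduced_rev: "reduced ws \<Longrightarrow> reduced (rev ws)"
  unfolding reduced_def
proof safe
  fix us assume 1: "\<forall>us. W us = W ws \<longrightarrow> length ws \<le> length us" and "W us = W (rev ws)"
  then have "W us (W ws y) = y" for y by simp
  then have "W (rev us) y = W ws y" for y using W_rev[of us "W ws y"] by simp
  then have "W (rev us) = W ws" by (rule ext)
  from 1[rule_format, OF this] show "length (rev ws) \<le> length us" by simp
qed

end

section \<open>The longest element\<close>

lemma simple_root_unit_vec: "simple_root = unit_vec"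
  by (auto simp: simple_root_def unit_vec_def fun_eq_iff)

context oriented_cartan begin

lemma ex_reduced: "\<exists>us. reduced us \<and> W us = W ws"
proof -
  obtain us where "W us = W ws" "\<And>vs. W vs = W ws \<Longrightarrow> length us \<le> length vs"
    using ex_has_least_nat[of "\<lambda>us. W us = W ws" ws length] by blast
  then show ?thesis by (intro exI[of _ us]) (simp add: reduced_def)
qed

lemma weyl_length_reduced: "reduced ws \<Longrightarrow> weyl_length C (W ws) = length ws"
  unfolding weyl_length_def reduced_def W_weyl_elt by (rule Least_equality) auto

lemma reduced_expression_iff: "reduced_expression C w ws \<longleftrightarrow> W ws = w \<and> reduced ws"
proof
  assume r: "reduced_expression C w ws"
  obtain us where us: "reduced us" "W us = W ws" using ex_reduced by blast
  then have "length ws = length us"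
    using r weyl_length_reduced[OF us(1)] by (simp add: reduced_expression_def W_weyl_elt)
  then show "W ws = w \<and> reduced ws" using r us by (auto simp: reduced_expression_def W_weyl_elt reduced_def)
qed (use weyl_length_reduced[of ws] in \<open>auto simp: reduced_expression_def W_weyl_elt\<close>)

lemma W_add_scaled: "W ws (\<lambda>u. y u + a * z u) = (\<lambda>u. W ws y u + a * W ws z u)"
  using word_op_linear[of 1 "\<lambda>s t. - C s t" ws 1 y a z] by (simp add: W_def)

lemma T_add_scaled: "T ws (\<lambda>u. y u + a * z u) = (\<lambda>u. T ws y u + a * T ws z u)"
  using word_op_linear[of "monom 1 1" qcoeff ws 1 y a z] by (simp add: T_def)

lemma W_scale: "W ws (\<lambda>u. a * z u) = (\<lambda>u. a * W ws z u)"
  using word_op_scale[of 1 "\<lambda>s t. - C s t" ws a z] by (simp add: W_def)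

lemma W_sum:
  assumes "finite A"
  shows "W ws (\<lambda>u. \<Sum>i\<in>A. a i * z i u) = (\<lambda>u. \<Sum>i\<in>A. a i * W ws (z i) u)"
  using assms
proof (induction A)
  case empty
  then show ?case using W_scale[of ws 0 "\<lambda>_. 0"] by simp
next
  case (insert x F)
  then show ?case using W_add_scaled[of ws "\<lambda>u. \<Sum>i\<in>F. a i * z i u" "a x" "z x"]
    by (simp add: add.commute)
qed

lemma W_expand: "W ws y u = (\<Sum>i\<in>UNIV. y i * W ws (unit_vec i) u)"
proof -
  have "y = (\<lambda>u. \<Sum>i\<in>UNIV. y i * unit_vec i u)"
    by (auto simp: unit_vec_def if_distrib[of "\<lambda>x. _ * x"] cong: if_cong)
  then show ?thesis using W_sum[of UNIV ws y unit_vec] by simp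
qed

end

locale longest_word = oriented_cartan C ori
  for C :: "'s::finite \<Rightarrow> 's \<Rightarrow> int" and ori +
  fixes d :: "'s \<Rightarrow> nat" and ws :: "'s list"
  assumes symm: "int (d s) * C s t = int (d t) * C t s" and d_pos: "d s > 0"
    and ws_reduced: "reduced ws" and ws_longest: "reduced us \<Longrightarrow> length us \<le> length ws"
begin

text \<open>A reduced word \<open>a\<close> of v r_s has an ascent at \<open>s\<close>, because a
  r_s is \<open>v\<close>, of maximal length. So \<open>a\<close> sends alpha_s to a nonnegative
  vector, and \<open>v\<close> sends it to the negative of that vector.\<close>

lemma longest_nonpos:
  assumes "reduced v" "length v = length ws"
  shows "W v (unit_vec s) u \<le> 0"
proof -
  obtain a where a: "reduced a" "W a = W (v @ [s])" using ex_reduced by blast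
  have "W (a @ [s]) = W ((v @ [s]) @ [s])" by (rule W_cong_append) (use a in auto)
  then have as: "W (a @ [s]) = W v" using W_cancel[of v s "[]"] by simp
  have "ascent a s" unfolding ascent_def as
  proof safe
    fix us assume "W us = W v"
    then have "length v \<le> length us" using assms(1) unfolding reduced_def by blast
    then show "length a \<le> length us" using ws_longest[OF a(1)] assms(2) by simp
  qed
  then have "W a (unit_vec s) u \<ge> 0" by (intro W_unit_vec_nonneg T_ascent_nonneg a)
  then show ?thesis using fun_cong[OF W_snoc_unit[of a s], of u] unfolding as by simp
qed

text \<open>The matrices of w_0 and of its inverse have nonpositive integer entries and their
  product is the identity. No cancellation is possible in it, which leaves only minus a permutation
  matrix.\<close>

lemma W_ws_unit: "\<exists>t. W ws (unit_vec s) = (\<lambda>u. - unit_vec t u)"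
proof -
  have "\<exists>u. W ws (unit_vec s) u \<noteq> 0" using W_unit_nonzero[of ws s] by (auto simp: fun_eq_iff)
  then obtain u where u: "W ws (unit_vec s) u \<noteq> 0" ..
  have neg: "W ws (unit_vec x) v \<le> 0" "W (rev ws) (unit_vec x) v \<le> 0" for x v
    by (rule longest_nonpos, use ws_reduced reduced_rev in simp_all)+
  \<comment> \<open>The summands of this off-diagonal entry of the identity matrix are nonnegative,
    hence zero, and the one at index \<open>u\<close> has a nonzero first factor.\<close>
  have z: "W (rev ws) (unit_vec u) v = 0" if "v \<noteq> s" for v
  proof -
    have "(\<Sum>i\<in>UNIV. W ws (unit_vec s) i * W (rev ws) (unit_vec i) v) = unit_vec s v"
      by (subst W_expand[symmetric]) simp
    also have "\<dots> = 0" using that by (simp add: unit_vec_def)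
    finally have "\<forall>i\<in>UNIV. W ws (unit_vec s) i * W (rev ws) (unit_vec i) v = 0"
      by (subst sum_nonneg_eq_0_iff[symmetric]) (use neg in \<open>auto intro: mult_nonpos_nonpos\<close>)
    then show ?thesis using u by auto
  qed
  define c where "c = W (rev ws) (unit_vec u) s"
  have "W (rev ws) (unit_vec u) = (\<lambda>v. c * unit_vec s v)" using z by (auto simp: c_def unit_vec_def fun_eq_iff)
  then have "W ws (W (rev ws) (unit_vec u)) = (\<lambda>v. c * W ws (unit_vec s) v)" by (simp add: W_scale)
  then have e: "unit_vec u v = c * W ws (unit_vec s) v" for v
    using W_rev[of "rev ws" "unit_vec u"] by (simp add: fun_eq_iff)
  from e[of u] have "c * W ws (unit_vec s) u = 1" by (simp add: unit_vec_def)
  then have "c = -1" using neg(1)[of s u] zmult_eq_1_iff[of c "W ws (unit_vec s) u"] by auto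
  then show ?thesis using e by (intro exI[of _ u]) (auto simp: fun_eq_iff)
qed

definition star :: "'s \<Rightarrow> 's" where "star = dynkin_involution (W ws)"

lemma W_ws_star: "W ws (unit_vec s) = (\<lambda>u. - unit_vec (star s) u)"
proof -
  have inj: "x = y" if "(unit_vec x :: 's \<Rightarrow> int) = unit_vec y" for x y
    using fun_cong[OF that, of x] by (auto simp: unit_vec_def split: if_splits)
  obtain t where t: "W ws (unit_vec s) = (\<lambda>u. - unit_vec t u)" using W_ws_unit by blast
  have "star s = (THE t. (unit_vec t :: 's \<Rightarrow> int) = (\<lambda>u. - W ws (unit_vec s) u))"
    by (simp add: star_def dynkin_involution_def simple_root_unit_vec)
  also have "\<dots> = t" by (rule the_equality) (use t inj in auto)
  finally show ?thesis using t by simp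
qed

text \<open>The square of w_0 sends simple roots to simple roots, whereas a nonempty reduced word
  makes the simple root of its last letter negative.\<close>

lemma W_ws_twice: "W (ws @ ws) = W []"
proof -
  obtain z where z: "reduced z" "W z = W (ws @ ws)" using ex_reduced by blast
  have "z = []"
  proof (rule ccontr)
    assume "z \<noteq> []"
    then obtain z' s where z': "z = z' @ [s]" by (metis rev_exhaust)
    have "\<not> (\<forall>u. W z (unit_vec s) u \<ge> 0)"
    proof (rule descent_not_nonneg)
      show "nonneg_poly (T z' (unit_vec s) u)" for u
        using z z' by (intro T_ascent_nonneg) (auto dest: reduced_append1 reduced_snoc_ascent)
    qed (use z' in simp)
    moreover have "W z (unit_vec s) = unit_vec (star (star s))"
      unfolding z(2) W_append W_ws_star W_uminus by simp
    ultimately show False by (auto simp: unit_vec_def split: if_splits)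
  qed
  then show ?thesis using z(2) by metis
qed

lemma star_star [simp]: "star (star s) = s"
proof -
  have "unit_vec (star (star s)) = W (ws @ ws) (unit_vec s)"
    unfolding W_append W_ws_star W_uminus by simp
  then have "(unit_vec (star (star s)) :: 's \<Rightarrow> int) = unit_vec s" by (simp add: W_ws_twice)
  from fun_cong[OF this, of s] show ?thesis by (auto simp: unit_vec_def split: if_splits)
qed

lemma star_eq_iff [simp]: "star s = star t \<longleftrightarrow> s = t"
  by (metis star_star)

text \<open>As w_0 is an involution, \<open>rev ws\<close> is another reduced word for it. This
  reconciles the reversed words governing the c-vectors along \<open>R_word\<close> with the order
  in which \<open>ws\<close> is adapted.\<close>

lemma T_rev_ws: "T (rev ws) = T ws"
proof (rule matsumoto[OF reduced_rev[OF ws_reduced] ws_reduced], rule ext)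
  fix y
  have "W (rev ws) (W ws (W ws y)) = W ws y" by simp
  moreover have "W ws (W ws y) = y" using W_ws_twice by (metis W_append W_Nil)
  ultimately show "W (rev ws) y = W ws y" by simp
qed

section \<open>The invariant form and the symmetries of the Dynkin involution\<close>

definition form :: "('s \<Rightarrow> int) \<Rightarrow> ('s \<Rightarrow> int) \<Rightarrow> int" where
  "form x y = (\<Sum>s\<in>UNIV. \<Sum>t\<in>UNIV. int (d s) * C s t * x s * y t)"

lemma form_commute: "form x y = form y x"
proof -
  have "int (d s) * C s t * x s * y t = int (d t) * C t s * y t * x s" for s t
    unfolding symm[of s t] by simp
  then show ?thesis unfolding form_def by (subst sum.swap) (intro sum.cong refl)
qed

lemma form_add_scaled: "form (\<lambda>u. x u + a * z u) y = form x y + a * form z y"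
  unfolding form_def by (simp add: algebra_simps sum.distrib sum_distrib_left)

lemma form_unit_vec: "form (unit_vec s) y = int (d s) * (\<Sum>t\<in>UNIV. C s t * y t)"
proof -
  have "form (unit_vec s) y = (\<Sum>s'\<in>UNIV. if s' = s then \<Sum>t\<in>UNIV. int (d s') * C s' t * y t else 0)"
    unfolding form_def by (intro sum.cong) (auto simp: unit_vec_def)
  then show ?thesis by (simp add: sum_distrib_left mult.assoc)
qed

lemma form_unit_unit: "form (unit_vec s) (unit_vec t) = int (d s) * C s t"
  unfolding form_unit_vec by (simp add: unit_vec_def if_distrib[of "\<lambda>x. _ * x"] cong: if_cong)

lemma W_single: "W [s] y = (\<lambda>u. y u + - (\<Sum>t\<in>UNIV. C s t * y t) * unit_vec s u)"
  by (simp add: W_weyl_elt weyl_elt_def simple_refl_def simple_root_unit_vec)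

lemma form_W_single: "form (W [s] x) (W [s] y) = form x y"
proof -
  define f where "f y = (\<Sum>t\<in>UNIV. C s t * y t)" for y
  have 1: "form (\<lambda>u. x u + - f x * unit_vec s u) z = form x z - f x * (int (d s) * f z)" for x z
    by (simp only: form_add_scaled form_unit_vec f_def)
  have "f (\<lambda>u. y u + - f y * unit_vec s u) = f y - f y * f (unit_vec s)"
    unfolding f_def by (simp add: algebra_simps sum_subtractf sum_distrib_left)
  also have "f (unit_vec s) = 2"
    by (simp add: f_def unit_vec_def if_distrib[of "\<lambda>x. _ * x"] C_diag cong: if_cong)
  finally have 2: "f (\<lambda>u. y u + - f y * unit_vec s u) = - f y" by simp
  have "form (W [s] x) (W [s] y) = form (\<lambda>u. x u + - f x * unit_vec s u) (\<lambda>u. y u + - f y * unit_vec s u)"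
    by (simp only: W_single f_def)
  also have "\<dots> = form (\<lambda>u. y u + - f y * unit_vec s u) x + f x * (int (d s) * f y)"
    unfolding 1 2 form_commute[of x] by simp
  also have "\<dots> = form x y" unfolding 1 form_commute[of y x] by simp
  finally show ?thesis .
qed

lemma form_W: "form (W us x) (W us y) = form x y"
proof (induction us)
  case (Cons s us)
  then show ?case using form_W_single[of s "W us x" "W us y"] W_Cons[of s us] by simp
qed simp

lemma form_uminus: "form (\<lambda>u. - x u) y = - form x y"
  unfolding form_def by (simp add: sum_negf)

text \<open>The form is preserved by w_0, and the two signs in its images of alpha_s and alpha_t
  cancel. The case \<open>s = t\<close> then separates the weights from the Cartan entries.\<close>

lemma d_C_star: "int (d (star s)) * C (star s) (star t) = int (d s) * C s t"
proof -
  have "form (W ws (unit_vec s)) (W ws (unit_vec t)) = form (unit_vec (star s)) (unit_vec (star t))"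
    unfolding W_ws_star form_uminus form_commute[of "unit_vec (star s)"] by simp
  then show ?thesis by (simp add: form_W form_unit_unit)
qed

lemma d_star [simp]: "d (star s) = d s"
  using d_C_star[of s s] by (simp add: C_diag)

lemma C_star [simp]: "C (star s) (star t) = C s t"
  using d_C_star[of s t] d_pos[of s] by simp

text \<open>Conjugation by w_0 turns a reflection into the one in the image root. In coordinates
  this is invariance of the form, since r_s subtracts a multiple given by the pairing with
  alpha_s.\<close>

lemma W_star_commute: "W [star s] (W ws y) = W ws (W [s] y)"
proof -
  have "int (d (star s)) * (\<Sum>t\<in>UNIV. C (star s) t * W ws y t) = form (unit_vec (star s)) (W ws y)"
    by (simp only: form_unit_vec)
  also have "\<dots> = - form (W ws (unit_vec s)) (W ws y)" unfolding W_ws_star form_uminus by simp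
  also have "\<dots> = int (d s) * - (\<Sum>t\<in>UNIV. C s t * y t)" by (simp add: form_W form_unit_vec)
  finally have "(\<Sum>t\<in>UNIV. C (star s) t * W ws y t) = - (\<Sum>t\<in>UNIV. C s t * y t)"
    using d_pos[of s] by (metis d_star mult_cancel_left of_nat_0_less_iff order_less_irrefl)
  then show ?thesis unfolding W_single W_add_scaled W_ws_star by (simp add: fun_eq_iff)
qed

text \<open>\<open>T_s\<close> is not an involution, so this does not follow formally from the
  relation in the Weyl group. Instead w_0 is factored as u r_s and as r_(star s) u with both words
  reduced, and independence of the reduced word gives \<open>T_u T_s\<close> =
  \<open>T_(star s) T_u\<close>.\<close>

lemma T_star_commute: "T [star s] (T ws y) = T ws (T [s] y)"
proof -
  obtain u where u: "reduced u" "W u = W (ws @ [s])" using ex_reduced by blast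
  have "W (u @ [s]) = W ((ws @ [s]) @ [s])" by (rule W_cong_append) (use u in auto)
  then have us: "W (u @ [s]) = W ws" using W_cancel[of ws s "[]"] by simp
  \<comment> \<open>Otherwise \<open>u\<close> would be longest too and send alpha_s to a
    nonpositive vector, although its negative has the entry -1.\<close>
  have "length u \<noteq> length ws"
  proof
    assume "length u = length ws"
    then have le: "W u (unit_vec s) v \<le> 0" for v by (rule longest_nonpos[OF u(1)])
    have "W ws (unit_vec s) = (\<lambda>v. - W u (unit_vec s) v)" using W_snoc_unit[of u s] us by simp
    from fun_cong[OF this, of "star s"] show False
      using le[of "star s"] unfolding W_ws_star by (simp add: unit_vec_def)
  qed
  then have lt: "length u < length ws" using ws_longest[OF u(1)] by simp
  have len: "length (u @ [s]) = length ws"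
    using ws_reduced us lt unfolding reduced_def by fastforce
  have "W (star s # u) y = W ws y" for y
    unfolding W_Cons[of "star s" u] u(2) W_append W_star_commute by simp
  then have su: "W (star s # u) = W ws" by (rule ext)
  have 1: "T (u @ [s]) = T ws"
    by (rule matsumoto) (use ws_reduced us len reduced_cong[OF ws_reduced us] in auto)
  have 2: "T (star s # u) = T ws"
    by (rule matsumoto) (use ws_reduced su len reduced_cong[OF ws_reduced su] in auto)
  have "T ws (T [s] y) = T [star s] (T u (T [s] y))"
    using T_Cons[of "star s" u] 2 by simp
  also have "T u (T [s] y) = T ws y" using T_append[of u "[s]"] 1 by simp
  finally show ?thesis by simp
qed

end

section \<open>Adapted words\<close>

lemma word_op_const_poly:
  "word_op 1 (\<lambda>s t. [:c s t:]) ws (\<lambda>u. [:y u :: 'a::idom:]) = (\<lambda>u. [:word_op 1 c ws y u:])"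
proof (induction ws)
  case (Cons s ws)
  have "(\<Sum>r\<in>A. [:f r:]) = [:\<Sum>r\<in>A. f r:]" for f :: "'b \<Rightarrow> 'a" and A
    by (induction A rule: infinite_finite_induct) auto
  then show ?case using Cons by (auto simp: defl_def fun_eq_iff mult.commute)
qed simp

definition scale_at :: "'s \<Rightarrow> ('s \<Rightarrow> int poly) \<Rightarrow> 's \<Rightarrow> int poly" where
  "scale_at s y = y(s := monom 1 1 * y s)"

abbreviation arrow_ori :: "('s \<Rightarrow> 's \<Rightarrow> int) \<Rightarrow> 's \<Rightarrow> 's \<Rightarrow> bool" where
  "arrow_ori \<sigma> \<equiv> \<lambda>s t. \<sigma> s t \<ge> 1"

context
  fixes C :: "'s::finite \<Rightarrow> 's \<Rightarrow> int"
begin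

text \<open>At a sink \<open>s\<close> the factors q of the edges at \<open>s\<close> all sit in the
  coefficients c_ts. Scaling the coordinate at \<open>s\<close> moves them to c_st, which gives the
  coefficients of the quiver reversed at \<open>s\<close>.\<close>

lemma scale_at_defl:
  assumes "sink \<sigma> s" "\<And>s t. \<sigma> s t = - \<sigma> t s" "\<forall>s t. s \<noteq> t \<longrightarrow> C s t \<noteq> 0 \<longrightarrow> \<sigma> s t \<noteq> 0"
  shows "scale_at s (defl (monom 1 1) (oriented_coeff C (arrow_ori \<sigma>)) t y) =
    defl (monom 1 1) (oriented_coeff C (arrow_ori (reverse_at s \<sigma>))) t (scale_at s y)"
proof (cases "t = s")
  case True
  have "monom 1 1 * oriented_coeff C (arrow_ori \<sigma>) s r = oriented_coeff C (arrow_ori (reverse_at s \<sigma>)) s r"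
    if "r \<noteq> s" for r
  proof (cases "C s r = 0")
    case False
    then have "\<sigma> s r < 0" using assms(1) assms(3)[rule_format, of s r] that unfolding sink_def
      by (metis order_le_less)
    then show ?thesis using that by (simp add: oriented_coeff_def reverse_at_def mult_monom)
  qed (simp add: oriented_coeff_def)
  then have "monom 1 1 * (\<Sum>r\<in>UNIV - {s}. oriented_coeff C (arrow_ori \<sigma>) s r * y r) =
      (\<Sum>r\<in>UNIV - {s}. oriented_coeff C (arrow_ori (reverse_at s \<sigma>)) s r * scale_at s y r)"
    unfolding sum_distrib_left by (intro sum.cong) (auto simp: mult.assoc[symmetric] scale_at_def)
  then show ?thesis using True by (auto simp: scale_at_def defl_def fun_eq_iff algebra_simps)
next
  case False
  have "oriented_coeff C (arrow_ori \<sigma>) t r * y r =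
      oriented_coeff C (arrow_ori (reverse_at s \<sigma>)) t r * scale_at s y r" if "r \<noteq> t" for r
  proof (cases "C t r = 0 \<or> r \<noteq> s")
    case True
    then show ?thesis using False that by (auto simp: oriented_coeff_def reverse_at_def scale_at_def)
  next
    case F: False
    then have "\<sigma> t s > 0" using assms(1) assms(3)[rule_format, of t s] assms(2)[of t s] that unfolding sink_def
      by (smt (verit))
    then show ?thesis using F False
      by (simp add: oriented_coeff_def reverse_at_def mult_monom scale_at_def mult.assoc[symmetric])
  qed
  then have "(\<Sum>r\<in>UNIV - {t}. oriented_coeff C (arrow_ori \<sigma>) t r * y r) =
      (\<Sum>r\<in>UNIV - {t}. oriented_coeff C (arrow_ori (reverse_at s \<sigma>)) t r * scale_at s y r)"
    by (intro sum.cong) auto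
  then show ?thesis using False by (auto simp: scale_at_def defl_def fun_eq_iff)
qed

lemma defl_sink:
  assumes "sink \<sigma> s"
  shows "defl (monom 1 1) (oriented_coeff C (arrow_ori \<sigma>)) s y = defl 1 (\<lambda>s t. [:- C s t:]) s (scale_at s y)"
proof -
  have "oriented_coeff C (arrow_ori \<sigma>) s r = [:- C s r:]" for r
    using assms[unfolded sink_def, rule_format, of r] by (simp add: oriented_coeff_def monom_0)
  then show ?thesis by (auto simp: defl_def scale_at_def fun_eq_iff intro!: sum.cong)
qed

text \<open>The first operator splits into r_s after the scaling at \<open>s\<close>. That scaling
  is pushed to the right through the rest of the word, which turns the quiver into the one reversed
  at \<open>s\<close>; there the tail is again adapted. The scalings accumulate to the powers of
  q.\<close>

lemma adapted_word_op:
  assumes "adapted \<sigma> ws" "\<And>s t. \<sigma> s t = - \<sigma> t s" "\<forall>s t. s \<noteq> t \<longrightarrow> C s t \<noteq> 0 \<longrightarrow> \<sigma> s t \<noteq> 0"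
  shows "word_op (monom 1 1) (oriented_coeff C (arrow_ori \<sigma>)) ws y =
     word_op 1 (\<lambda>s t. [:- C s t:]) ws (\<lambda>t. monom 1 (count_list ws t) * y t)"
  using assms
proof (induction ws arbitrary: \<sigma> y)
  case Nil
  show ?case by (simp add: monom_0)
next
  case (Cons s ws)
  have s: "sink \<sigma> s" "adapted (reverse_at s \<sigma>) ws" using Cons.prems(1) by auto
  have anti: "reverse_at s \<sigma> u t = - reverse_at s \<sigma> t u" for u t
    using Cons.prems(2)[of u t] by (simp add: reverse_at_def)
  have nz: "\<forall>u t. u \<noteq> t \<longrightarrow> C u t \<noteq> 0 \<longrightarrow> reverse_at s \<sigma> u t \<noteq> 0"
    using Cons.prems(3) by (simp add: reverse_at_def)
  have comm: "scale_at s (word_op (monom 1 1) (oriented_coeff C (arrow_ori \<sigma>)) us y) =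
      word_op (monom 1 1) (oriented_coeff C (arrow_ori (reverse_at s \<sigma>))) us (scale_at s y)" for us
    by (induction us) (simp_all only: word_op_Nil word_op_Cons scale_at_defl[OF s(1) Cons.prems(2,3)])
  have cnt: "(\<lambda>t. monom 1 (count_list ws t) * scale_at s y t) = (\<lambda>t. monom 1 (count_list (s # ws) t) * y t)"
    by (auto simp: fun_eq_iff scale_at_def mult_monom mult.assoc[symmetric])
  show ?case
    by (simp only: word_op_Cons defl_sink[OF s(1)] comm Cons.IH[OF s(2) anti nz] cnt)
qed

end


locale adapted_longest_word = longest_word C "arrow_ori \<sigma>" d ws
  for C :: "'s::finite \<Rightarrow> 's \<Rightarrow> int" and \<sigma> d ws +
  assumes adapted: "adapted \<sigma> ws" and \<sigma>_antisym: "\<sigma> s t = - \<sigma> t s"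
    and \<sigma>_nonzero: "\<forall>s t. s \<noteq> t \<longrightarrow> C s t \<noteq> 0 \<longrightarrow> \<sigma> s t \<noteq> 0"
begin

lemma T_ws_unit: "T ws (unit_vec s) = (\<lambda>u. - monom 1 (count_list ws s) * unit_vec (star s) u)"
proof -
  have "(\<lambda>t. monom 1 (count_list ws t) * unit_vec s t) =
      (\<lambda>u. monom 1 (count_list ws s) * [:unit_vec s u:] :: int poly)"
    by (auto simp: fun_eq_iff unit_vec_def)
  then have "T ws (unit_vec s) =
      (\<lambda>u. monom 1 (count_list ws s) * word_op 1 (\<lambda>s t. [:- C s t:]) ws (\<lambda>u. [:unit_vec s u:]) u)"
    unfolding T_def adapted_word_op[OF adapted \<sigma>_antisym \<sigma>_nonzero]
    by (simp only: word_op_scale)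
  also have "word_op 1 (\<lambda>s t. [:- C s t:]) ws (\<lambda>u. [:unit_vec s u:]) = (\<lambda>u. [:W ws (unit_vec s) u:])"
    unfolding word_op_const_poly W_def ..
  finally have "T ws (unit_vec s) = (\<lambda>u. monom 1 (count_list ws s) * [:- unit_vec (star s) u:])"
    unfolding W_ws_star .
  then show ?thesis by (simp only:) (auto simp: fun_eq_iff unit_vec_def)
qed

text \<open>The coefficients of alpha_(star s) in \<open>T_(star s) T_ws\<close> alpha_t and in
  \<open>T_ws T_s\<close> alpha_t are monomials with these exponents. The equation is what makes
  sigma_Q compatible with the arrows between different rows.\<close>

lemma count_star:
  assumes "s \<noteq> t" "C s t \<noteq> 0"
  shows "of_bool (\<sigma> s t \<ge> 1) + count_list ws s = of_bool (\<sigma> (star s) (star t) \<ge> 1) + count_list ws t"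
proof -
  have T1: "T [x] (unit_vec y) = (\<lambda>u. unit_vec y u + qcoeff x y * unit_vec x u)" if "x \<noteq> y" for x y
    using that by (simp add: T_def defl_unit_vec)
  have "T [star s] (T ws (unit_vec t)) =
      (\<lambda>u. - monom 1 (count_list ws t) * T [star s] (unit_vec (star t)) u)"
    unfolding T_ws_unit unfolding T_def by (rule word_op_scale)
  moreover have "T ws (T [s] (unit_vec t)) =
      (\<lambda>u. T ws (unit_vec t) u + qcoeff s t * T ws (unit_vec s) u)"
    unfolding T1[OF assms(1)] by (rule T_add_scaled)
  ultimately have "- monom 1 (count_list ws t) * T [star s] (unit_vec (star t)) (star s) =
      T ws (unit_vec t) (star s) + qcoeff s t * T ws (unit_vec s) (star s)"
    using T_star_commute[of s "unit_vec t"] by (metis (mono_tags, lifting))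
  moreover have "T [star s] (unit_vec (star t)) (star s) = qcoeff (star s) (star t)"
    using T1[of "star s" "star t"] assms by (simp add: unit_vec_def)
  moreover have "T ws (unit_vec t) (star s) = 0" "T ws (unit_vec s) (star s) = - monom 1 (count_list ws s)"
    using assms by (simp_all add: T_ws_unit unit_vec_def)
  ultimately have "monom 1 (count_list ws t) * qcoeff (star s) (star t) = qcoeff s t * monom 1 (count_list ws s)"
    by simp
  then have "monom (- C s t) (count_list ws t + of_bool (\<sigma> (star s) (star t) \<ge> 1)) =
      monom (- C s t) (of_bool (\<sigma> s t \<ge> 1) + count_list ws s)"
    by (simp add: oriented_coeff_def mult_monom del: of_bool_eq(1))
  then show ?thesis using assms(2) by (simp add: monom_eq_iff' add.commute)
qed

end

section \<open>Green mutations as changes of basis\<close>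

lemma expo_one [simp]: "expo 1 v = 0"
  by transfer simp

lemma expo_times [simp]: "expo (a * b) v = expo a v + expo b v"
  by transfer simp

lemma expo_plus [simp]: "expo (a + b) v = min (expo a v) (expo b v)"
  by transfer simp

lemma expo_inverse [simp]: "expo (inverse a) v = - expo a v"
  by transfer simp

lemma expo_trop_var: "expo (trop_var v) w = (if w = v then 1 else 0)"
  by transfer simp

lemma expo_power [simp]: "expo (a ^ n) v = int n * expo a v"
  by (induction n) (auto simp: algebra_simps)

lemma expo_power_int [simp]: "expo (a powi n) v = n * expo a v"
  by (auto simp: power_int_def)

text \<open>Positivity of \<open>x k\<close> resolves the tropical sum: adding \<open>x k\<close> to
  1 gives 1, and adding its inverse gives that inverse.\<close>

lemma expo_mut_coeff_green:
  assumes "trop_positive (x k)"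
  shows "expo (mut_coeff \<epsilon> k x i) v =
    (if i = k then - expo (x k) v else expo (x i) v + max 0 (\<epsilon> i k) * expo (x k) v)"
  using assms[unfolded trop_positive_def, rule_format, of v]
  by (cases "\<epsilon> i k" "0::int" rule: linorder_cases) (auto simp: mut_coeff_def min_def)

lemma coeff_run_Nil [simp]: "coeff_run [] z = z"
  and coeff_run_Cons [simp]: "coeff_run (f # \<phi>) z = coeff_step f (coeff_run \<phi> z)"
  and coeff_run_append: "coeff_run (\<phi> @ \<psi>) z = coeff_run \<phi> (coeff_run \<psi> z)"
  by (simp_all add: coeff_run_def)

lemma green_from_append: "green_from z (\<phi> @ \<psi>) \<longleftrightarrow> green_from z \<psi> \<and> green_from (coeff_run \<psi> z) \<phi>"
proof (induction \<phi>)
  case (Cons f \<phi>)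
  then show ?case by (cases f) (auto simp: coeff_run_append)
qed simp

lemma max_0_times_distrib: "(max 0 a :: int) * b = max 0 (a * b)" if "b \<ge> 0"
  using that mult_nonpos_nonneg[of a b] by (cases "a \<ge> 0") (simp_all add: max_def)

text \<open>The starting coefficients are arbitrary, so that the analysis of one reflection sequence
  applies at the seed reached by the preceding ones.\<close>

locale green_start =
  fixes Q0 :: "'v wquiver" and x0 :: "'v \<Rightarrow> 'v trop_monom"
  assumes finite_verts: "finite (verts Q0)"
    and wt_pos: "i \<in> verts Q0 \<Longrightarrow> wt Q0 i > 0"
    and skew: "i \<in> verts Q0 \<Longrightarrow> j \<in> verts Q0 \<Longrightarrow>
      exch Q0 i j * int (wt Q0 j) = - (exch Q0 j i * int (wt Q0 i))"
    and exch_outside: "i \<notin> verts Q0 \<or> j \<notin> verts Q0 \<Longrightarrow> exch Q0 i j = 0"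
begin

abbreviation "I \<equiv> verts Q0"
abbreviation "d \<equiv> \<lambda>i. int (wt Q0 i)"

text \<open>Since \<open>exch Q0 i j * d j\<close> is skew-symmetric, this is the skew form of the
  starting quiver on its vertex lattice.\<close>

definition gram :: "('v \<Rightarrow> int) \<Rightarrow> ('v \<Rightarrow> int) \<Rightarrow> int" where
  "gram a b = (\<Sum>i\<in>I. \<Sum>j\<in>I. a i * b j * (exch Q0 i j * d j))"

lemma gram_add_left: "gram (\<lambda>u. f u + g u) b = gram f b + gram g b"
  and gram_add_right: "gram b (\<lambda>u. f u + g u) = gram b f + gram b g"
  and gram_scale_left: "gram (\<lambda>u. n * f u) b = n * gram f b"
  and gram_scale_right: "gram b (\<lambda>u. n * f u) = n * gram b f"
  and gram_uminus_left: "gram (\<lambda>u. - f u) b = - gram f b"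
  and gram_uminus_right: "gram b (\<lambda>u. - f u) = - gram b f"
  unfolding gram_def by (simp_all add: algebra_simps sum.distrib sum_distrib_left sum_negf)

lemma gram_diff_left: "gram (\<lambda>u. f u - g u) b = gram f b - gram g b"
  using gram_add_left[of f "\<lambda>u. - g u" b] by (simp add: gram_uminus_left)

lemmas gram_linear = gram_add_left gram_add_right gram_scale_left gram_scale_right
  gram_uminus_left gram_uminus_right gram_diff_left

lemma gram_zero [simp]: "gram (\<lambda>u. 0) b = 0" "gram b (\<lambda>u. 0) = 0"
  by (simp_all add: gram_def)

lemma gram_skew: "gram a b = - gram b a"
proof -
  have "gram a b = (\<Sum>i\<in>I. \<Sum>j\<in>I. - (b j * a i * (exch Q0 j i * d i)))"
    unfolding gram_def by (intro sum.cong refl) (subst skew, simp_all)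
  also have "\<dots> = - gram b a" unfolding gram_def by (subst sum.swap) (simp add: sum_negf)
  finally show ?thesis .
qed

lemma gram_self [simp]: "gram a a = 0"
  using gram_skew[of a a] by simp

lemma gram_unit:
  assumes "i \<in> I" "j \<in> I"
  shows "gram (unit_vec i) (unit_vec j) = exch Q0 i j * d j"
proof -
  have "gram (unit_vec i) (unit_vec j) = (\<Sum>i'\<in>I. if i' = i then \<Sum>j'\<in>I. if j' = j then exch Q0 i j * d j else 0 else 0)"
    unfolding gram_def by (intro sum.cong) (auto simp: unit_vec_def intro!: sum.cong sum.neutral)
  then show ?thesis using assms finite_verts by simp
qed

text \<open>The exponents of the product of the \<open>x0 u\<close> to the powers
  \<open>a u\<close>: c-vectors are stored relative to the starting coefficients.\<close>

definition combine :: "('v \<Rightarrow> int) \<Rightarrow> 'v \<Rightarrow> int" where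
  "combine a v = (\<Sum>u\<in>I. a u * expo (x0 u) v)"

lemma combine_add: "combine (\<lambda>u. f u + g u) v = combine f v + combine g v"
  and combine_scale: "combine (\<lambda>u. n * f u) v = n * combine f v"
  and combine_uminus: "combine (\<lambda>u. - f u) v = - combine f v"
  unfolding combine_def by (simp_all add: algebra_simps sum.distrib sum_distrib_left sum_negf)

lemmas combine_linear = combine_add combine_scale combine_uminus

lemma combine_unit: "u \<in> I \<Longrightarrow> combine (unit_vec u) v = expo (x0 u) v"
  using finite_verts unfolding combine_def unit_vec_def
  by (simp add: if_distrib[of "\<lambda>x. x * _"] cong: if_cong)

text \<open>The exchange matrix of a seed reached by green mutations is the Gram matrix of its
  c-vectors \<open>B i\<close>, which determines the next mutation.\<close>

definition based :: "'v mseq \<Rightarrow> ('v \<Rightarrow> 'v \<Rightarrow> int) \<Rightarrow> bool" where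
  "based \<phi> B \<longleftrightarrow> green_from (Q0, x0) \<phi> \<and>
     (case coeff_run \<phi> (Q0, x0) of (Q, x) \<Rightarrow>
        verts Q = I \<and> wt Q = wt Q0 \<and>
        (\<forall>i\<in>I. \<forall>j\<in>I. exch Q i j * d j = gram (B i) (B j)) \<and>
        (\<forall>i j. i \<notin> I \<or> j \<notin> I \<longrightarrow> exch Q i j = 0) \<and>
        (\<forall>i\<in>I. \<forall>v. expo (x i) v = combine (B i) v))"

lemma based_Nil: "based [] unit_vec"
  by (auto simp: based_def gram_unit combine_unit exch_outside)

lemma based_cong: "based \<phi> B \<Longrightarrow> (\<And>i. i \<in> I \<Longrightarrow> B i = B' i) \<Longrightarrow> based \<phi> B'"
  by (auto simp: based_def split: prod.splits)

lemma mut_exch_signed: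
  assumes "k \<noteq> i" "k \<noteq> j"
  shows "mut_exch \<epsilon> k i j = \<epsilon> i j + max 0 (\<epsilon> i k) * \<epsilon> k j + \<epsilon> i k * max 0 (- \<epsilon> k j)"
proof -
  have "\<bar>a\<bar> * b + a * \<bar>b\<bar> = 2 * (max 0 a * b + a * max 0 (- b))" for a b :: int
    by (cases "a \<ge> 0"; cases "b \<ge> 0") (auto simp: max_def)
  then show ?thesis using assms by (simp add: mut_exch_def)
qed

text \<open>The number \<open>r\<close> is the current exchange entry, recovered from the Gram
  matrix. Applications therefore only compute with c-vectors and never with the mutated
  matrix.\<close>

lemma based_Mut:
  assumes "based \<phi> B" and k: "k \<in> I" and pos: "\<And>v. combine (B k) v \<ge> 0"
    and Bk: "B' k = (\<lambda>u. - B k u)"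
    and B': "\<And>i. i \<in> I \<Longrightarrow> i \<noteq> k \<Longrightarrow>
       \<exists>r. gram (B i) (B k) = r * d k \<and> B' i = (\<lambda>u. B i u + max 0 r * B k u)"
  shows "based (Mut k # \<phi>) B'"
proof -
  obtain Q x where run: "coeff_run \<phi> (Q0, x0) = (Q, x)" by fastforce
  define \<epsilon> where "\<epsilon> = exch Q"
  have green: "green_from (Q0, x0) \<phi>" and Q: "verts Q = I" "wt Q = wt Q0"
    and eps: "\<And>i j. i \<in> I \<Longrightarrow> j \<in> I \<Longrightarrow> \<epsilon> i j * d j = gram (B i) (B j)"
    and out: "\<And>i j. i \<notin> I \<or> j \<notin> I \<Longrightarrow> \<epsilon> i j = 0"
    and x: "\<And>i v. i \<in> I \<Longrightarrow> expo (x i) v = combine (B i) v"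
    using assms(1) unfolding based_def run \<epsilon>_def by auto
  have tp: "trop_positive (x k)" unfolding trop_positive_def using x[OF k] pos by simp
  have B'_eps: "B' i = (\<lambda>u. B i u + max 0 (\<epsilon> i k) * B k u)" if i: "i \<in> I" "i \<noteq> k" for i
  proof -
    obtain r where r: "gram (B i) (B k) = r * d k" "B' i = (\<lambda>u. B i u + max 0 r * B k u)"
      using B'[OF i] by blast
    then have "\<epsilon> i k = r" using eps[OF i(1) k] wt_pos[OF k] by simp
    then show ?thesis using r by simp
  qed
  have new_eps: "mut_exch \<epsilon> k i j * d j = gram (B' i) (B' j)" if ij: "i \<in> I" "j \<in> I" for i j
  proof -
    consider "i = k" "j = k" | "i = k" "j \<noteq> k" | "i \<noteq> k" "j = k" | "i \<noteq> k" "j \<noteq> k" by blast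
    then show ?thesis
    proof cases
      case 1 then show ?thesis using eps[OF ij] by (simp add: mut_exch_def)
    next
      case 2 then show ?thesis using eps[OF ij] ij by (simp add: mut_exch_def Bk B'_eps gram_linear)
    next
      case 3 then show ?thesis using eps[OF ij] ij by (simp add: mut_exch_def Bk B'_eps gram_linear)
    next
      case 4
      have kj: "\<epsilon> k j * d j = - (\<epsilon> j k * d k)"
        using eps[OF k ij(2)] eps[OF ij(2) k] gram_skew[of "B k" "B j"] by simp
      \<comment> \<open>Skewness moves the truncation from the entry at \<open>k\<close>,
        \<open>j\<close> to the one at \<open>j\<close>, \<open>k\<close>, which is the coefficient
        occurring in \<open>B' j\<close>.\<close>
      have "max 0 (- \<epsilon> k j) * d j = max 0 (- \<epsilon> k j * d j)" by (rule max_0_times_distrib) simp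
      also have "- \<epsilon> k j * d j = \<epsilon> j k * d k" using kj by simp
      also have "max 0 (\<epsilon> j k * d k) = max 0 (\<epsilon> j k) * d k" by (rule max_0_times_distrib[symmetric]) simp
      finally have mx: "max 0 (- \<epsilon> k j) * d j = max 0 (\<epsilon> j k) * d k" .
      have "mut_exch \<epsilon> k i j * d j = \<epsilon> i j * d j + max 0 (\<epsilon> i k) * (\<epsilon> k j * d j) + \<epsilon> i k * (max 0 (- \<epsilon> k j) * d j)"
        using 4 by (simp add: mut_exch_signed algebra_simps)
      also have "\<dots> = gram (B i) (B j) + max 0 (\<epsilon> i k) * gram (B k) (B j) + max 0 (\<epsilon> j k) * gram (B i) (B k)"
        unfolding mx eps[OF ij] eps[OF k ij(2)] eps[OF ij(1) k, symmetric] by (simp add: algebra_simps)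
      also have "\<dots> = gram (B' i) (B' j)" 
        by (simp only: B'_eps[OF ij(1) 4(1)] B'_eps[OF ij(2) 4(2)] gram_linear) (simp add: algebra_simps)
      finally show ?thesis .
    qed
  qed
  have new_x: "expo (mut_coeff \<epsilon> k x i) v = combine (B' i) v" if "i \<in> I" for i v
    unfolding expo_mut_coeff_green[of x, OF tp] using that x k Bk B'_eps by (simp add: combine_linear)
  have new_out: "mut_exch \<epsilon> k i j = 0" if "i \<notin> I \<or> j \<notin> I" for i j
    using out that by (auto simp: mut_exch_def)
  show ?thesis unfolding based_def using green tp Q new_eps new_x new_out
    by (simp add: run \<epsilon>_def)
qed

lemma based_Perm:
  assumes "based \<phi> B" "\<pi> permutes I" "\<And>i. wt Q0 (inv \<pi> i) = wt Q0 i"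
  shows "based (Perm \<pi> # \<phi>) (\<lambda>i. B (inv \<pi> i))"
proof -
  obtain Q x where run: "coeff_run \<phi> (Q0, x0) = (Q, x)" by fastforce
  have in_I: "inv \<pi> i \<in> I \<longleftrightarrow> i \<in> I" for i
    using permutes_in_image[OF permutes_inv[OF assms(2)]] .
  have "exch Q (inv \<pi> i) (inv \<pi> j) * d j = gram (B (inv \<pi> i)) (B (inv \<pi> j))" if "i \<in> I" "j \<in> I" for i j
    using assms(1) that in_I unfolding based_def run assms(3)[of j, symmetric] by auto
  then show ?thesis using assms(1,3) in_I unfolding based_def
    by (auto simp: run relabel_def fun_eq_iff)
qed

end


section \<open>The reflection sequence on an oriented cycle\<close>

text \<open>The cycle has \<open>n + 2\<close> vertices \<open>v 0, \<dots>, v (n + 1)\<close>; a vertex \<open>x\<close> outside it is attached to the arrow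
  from \<open>v (p x)\<close> to its successor with multiplicity \<open>c x\<close>.\<close>

locale row_cycle = green_start Q0 x0
  for Q0 :: "'v wquiver" and x0 +
  fixes n :: nat and v :: "nat \<Rightarrow> 'v" and c :: "'v \<Rightarrow> int" and p :: "'v \<Rightarrow> nat" and D :: nat
  assumes v_inj: "inj_on v {..<Suc (Suc n)}" and v_in: "a < Suc (Suc n) \<Longrightarrow> v a \<in> I"
    and wt_v: "a < Suc (Suc n) \<Longrightarrow> wt Q0 (v a) = D"
    and exch_v_v: "a < Suc (Suc n) \<Longrightarrow> b < Suc (Suc n) \<Longrightarrow>
      exch Q0 (v a) (v b) = of_bool (b = Suc a mod Suc (Suc n)) - of_bool (a = Suc b mod Suc (Suc n))"
    and exch_ext_v: "x \<in> I - v ` {..<Suc (Suc n)} \<Longrightarrow> a < Suc (Suc n) \<Longrightarrow>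
      exch Q0 x (v a) = c x * (of_bool (a = p x) - of_bool (a = Suc (p x) mod Suc (Suc n)))"
    and c_nonneg: "c x \<ge> 0" and p_less: "p x < Suc (Suc n)"
    and row_positive: "a < Suc (Suc n) \<Longrightarrow> trop_positive (x0 (v a))"
begin

abbreviation "m \<equiv> Suc (Suc n)"

definition nxt :: "nat \<Rightarrow> nat" where "nxt a = (if Suc a = m then 0 else Suc a)"
definition prv :: "nat \<Rightarrow> nat" where "prv a = (if a = 0 then Suc n else a - 1)"

definition E :: "nat \<Rightarrow> 'v \<Rightarrow> int" where "E a = unit_vec (v a)"
text \<open>The c-vector that accumulates at the last cycle vertex while the mutations pass along
  the vertices before position \<open>k\<close>.\<close>

definition P :: "nat \<Rightarrow> 'v \<Rightarrow> int" where "P k = (\<lambda>u. E (Suc n) u + (\<Sum>j<k. E j u))"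

text \<open>\<open>H q a\<close> and \<open>HP q k\<close> are the pairings with \<open>E a\<close> and \<open>P k\<close> of a vertex outside the cycle that is
  attached to the arrow from \<open>q\<close> to \<open>nxt q\<close>, up to a positive factor.\<close>

definition H :: "nat \<Rightarrow> nat \<Rightarrow> int" where "H q a = of_bool (a = q) - of_bool (a = nxt q)"
definition HP :: "nat \<Rightarrow> nat \<Rightarrow> int" where "HP q k = of_bool (q = prv k) - of_bool (q = n)"

lemma nxt_mod: "a < m \<Longrightarrow> Suc a mod m = nxt a"
  by (auto simp: nxt_def)

lemma prv_less: "a < m \<Longrightarrow> prv a < m"
  by (auto simp: prv_def)

lemma nxt_prv: "a < m \<Longrightarrow> nxt (prv a) = a"
  by (auto simp: nxt_def prv_def)

lemma prv_eq_iff: "a < m \<Longrightarrow> b < m \<Longrightarrow> prv b = a \<longleftrightarrow> b = nxt a"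
  by (auto simp: nxt_def prv_def)

lemma P_0: "P 0 = E (Suc n)" and P_Suc: "P (Suc k) = (\<lambda>u. P k u + E k u)"
  by (auto simp: P_def)

lemma gram_E_E: "a < m \<Longrightarrow> b < m \<Longrightarrow> gram (E a) (E b) = (of_bool (b = nxt a) - of_bool (a = nxt b)) * int D"
  unfolding E_def by (simp add: gram_unit v_in exch_v_v wt_v nxt_mod)

lemma gram_ext_E: "x \<in> I - v ` {..<m} \<Longrightarrow> a < m \<Longrightarrow> gram (unit_vec x) (E a) = c x * H (p x) a * int D"
  unfolding E_def H_def by (simp add: gram_unit v_in exch_ext_v wt_v nxt_mod p_less)

lemma gram_P: "gram f (P k) = gram f (E (Suc n)) + (\<Sum>j<k. gram f (E j))"
  by (induction k) (simp_all add: P_0 P_Suc gram_linear)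

text \<open>Over the cyclic interval n + 1, 0, ..., k - 1 the sum telescopes, so that only its two
  ends contribute.\<close>

lemma H_sum:
  assumes "q < m" "k \<le> n"
  shows "H q (Suc n) + (\<Sum>j<k. H q j) = HP q k"
proof -
  have "(\<Sum>j<k. H q j) = of_bool (q < k) - of_bool (nxt q < k)"
    by (simp add: H_def sum_subtractf of_bool_def)
  then show ?thesis using assms by (auto simp: H_def HP_def nxt_def prv_def split: if_splits)
qed

lemma gram_ext_P:
  assumes "x \<in> I - v ` {..<m}" "k \<le> n"
  shows "gram (unit_vec x) (P k) = c x * HP (p x) k * int D"
proof -
  have "gram (unit_vec x) (P k) = c x * (H (p x) (Suc n) + (\<Sum>j<k. H (p x) j)) * int D"
    using assms by (simp add: gram_P gram_ext_E sum_distrib_left sum_distrib_right algebra_simps)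
  then show ?thesis using H_sum[OF p_less assms(2)] by simp
qed

lemma gram_E_P:
  assumes "a < m" "k \<le> n"
  shows "gram (E a) (P k) = - (HP (prv a) k + HP a k) * int D"
proof -
  \<comment> \<open>A cycle vertex pairs like minus two outside vertices, attached to the arrows
    entering and leaving it, so \<open>H_sum\<close> can be applied twice.\<close>
  have eq: "of_bool (b = nxt a) - of_bool (a = nxt b) = - (H (prv a) b + H a b)" if "b < m" for b
    using that assms by (auto simp: H_def nxt_def prv_def split: if_splits)
  have "gram (E a) (P k) = (- (H (prv a) (Suc n) + H a (Suc n)) + (\<Sum>j<k. - (H (prv a) j + H a j))) * int D"
    using assms by (simp add: gram_P gram_E_E eq sum_distrib_right sum_distrib_left algebra_simps)
  also have "- (H (prv a) (Suc n) + H a (Suc n)) + (\<Sum>j<k. - (H (prv a) j + H a j)) =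
     - ((H (prv a) (Suc n) + (\<Sum>j<k. H (prv a) j)) + (H a (Suc n) + (\<Sum>j<k. H a j)))"
    by (simp add: sum.distrib sum_negf sum_subtractf)
  also have "\<dots> = - (HP (prv a) k + HP a k)"
  proof -
    have "prv a < m" using assms by (auto simp: prv_def)
    then show ?thesis using H_sum[of a k] H_sum[of "prv a" k] assms by simp
  qed
  finally show ?thesis .
qed

lemma combine_E_nonneg: "a < m \<Longrightarrow> combine (E a) w \<ge> 0"
  using row_positive unfolding E_def by (simp add: combine_unit v_in trop_positive_def)

lemma combine_P_nonneg: "k \<le> m \<Longrightarrow> combine (P k) w \<ge> 0"
  by (induction k) (auto simp: P_0 P_Suc combine_linear combine_E_nonneg)

definition row_basis :: "(nat \<Rightarrow> 'v \<Rightarrow> int) \<Rightarrow> ('v \<Rightarrow> int) \<Rightarrow> 'v \<Rightarrow> 'v \<Rightarrow> int" where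
  "row_basis R X i = (if i \<in> v ` {..<m} then R (inv_into {..<m} v i)
     else (\<lambda>u. unit_vec i u + X i * E (p i) u))"

lemma row_basis_v [simp]: "a < m \<Longrightarrow> row_basis R X (v a) = R a"
  using v_inj by (simp add: row_basis_def)

lemma row_basis_ext: "x \<notin> v ` {..<m} \<Longrightarrow> row_basis R X x = (\<lambda>u. unit_vec x u + X x * E (p x) u)"
  by (simp add: row_basis_def)

lemma based_row_cong:
  assumes "based \<phi> (row_basis R X)" "\<And>a. a < m \<Longrightarrow> R a = R' a"
    "\<And>x. x \<in> I - v ` {..<m} \<Longrightarrow> X x = X' x"
  shows "based \<phi> (row_basis R' X')"
proof (rule based_cong[OF assms(1)])
  fix i assume "i \<in> I"
  then show "row_basis R X i = row_basis R' X' i"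
    using assms by (cases "i \<in> v ` {..<m}") (auto simp: row_basis_ext)
qed

lemma based_row_Mut:
  assumes "based \<phi> (row_basis R X)" "k < m" "\<And>w. combine (R k) w \<ge> 0"
    "R' k = (\<lambda>u. - R k u)"
    "\<And>a. a < m \<Longrightarrow> a \<noteq> k \<Longrightarrow> \<exists>r. gram (R a) (R k) = r * int D \<and> R' a = (\<lambda>u. R a u + max 0 r * R k u)"
    "\<And>x. x \<in> I - v ` {..<m} \<Longrightarrow> \<exists>r. gram (unit_vec x) (R k) + X x * gram (E (p x)) (R k) = r * int D \<and>
       (\<lambda>u. X' x * E (p x) u) = (\<lambda>u. X x * E (p x) u + max 0 r * R k u)"
  shows "based (Mut (v k) # \<phi>) (row_basis R' X')"
proof (rule based_Mut[OF assms(1)])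
  fix i assume i: "i \<in> I" "i \<noteq> v k"
  show "\<exists>r. gram (row_basis R X i) (row_basis R X (v k)) = r * d (v k) \<and>
     row_basis R' X' i = (\<lambda>u. row_basis R X i u + max 0 r * row_basis R X (v k) u)"
  proof (cases "i \<in> v ` {..<m}")
    case True
    then obtain a where a: "i = v a" "a < m" by blast
    then have "a \<noteq> k" using i by auto
    then show ?thesis using assms(2) assms(5)[OF a(2)] a by (simp add: wt_v)
  next
    case False
    then obtain r where r: "gram (unit_vec i) (R k) + X i * gram (E (p i)) (R k) = r * int D"
       "(\<lambda>u. X' i * E (p i) u) = (\<lambda>u. X i * E (p i) u + max 0 r * R k u)"
      using assms(6)[of i] i by auto
    have "(\<lambda>u. unit_vec i u + X' i * E (p i) u) = (\<lambda>u. unit_vec i u + X i * E (p i) u + max 0 r * R k u)"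
      using r(2) by (auto simp: fun_eq_iff)
    then show ?thesis using False r(1) assms(2) by - (rule exI[of _ r], (simp add: row_basis_ext gram_linear wt_v))
  qed
qed (use assms v_in in auto)

text \<open>The c-vectors on the cycle after mutating at \<open>0, \<dots>, k - 1\<close> on the way forward, and when \<open>k\<close>
  mutations are left on the way back.\<close>

definition forward_row :: "nat \<Rightarrow> nat \<Rightarrow> 'v \<Rightarrow> int" where
  "forward_row k a = (if a < k then (\<lambda>u. - E a u) else if a = Suc n then P (min k (n)) else E a)"

definition backward_row :: "nat \<Rightarrow> nat \<Rightarrow> 'v \<Rightarrow> int" where
  "backward_row k a = (if Suc a < k then (\<lambda>u. - E a u) else if Suc a = k then P a
     else if a = k then (\<lambda>u. - P k u) else (\<lambda>u. - E (a - 1) u))"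

text \<open>An outside vertex picks up \<open>E (p x)\<close> exactly when \<open>v (p x)\<close>
  itself is mutated; at the other mutations its exchange entry is nonpositive.\<close>

lemma forward_step:
  assumes "based \<phi> (row_basis (forward_row k) (\<lambda>x. c x * of_bool (p x < k)))" "k < Suc n"
  shows "based (Mut (v k) # \<phi>) (row_basis (forward_row (Suc k)) (\<lambda>x. c x * of_bool (p x < Suc k)))"
proof (rule based_row_Mut[OF assms(1)])
  have Rk: "forward_row k k = E k" using assms by (simp add: forward_row_def)
  show "k < m" using assms by simp
  show "combine (forward_row k k) w \<ge> 0" for w unfolding Rk using assms combine_E_nonneg by simp
  show "forward_row (Suc k) k = (\<lambda>u. - forward_row k k u)" using assms by (simp add: forward_row_def)
  show "\<exists>r. gram (forward_row k a) (forward_row k k) = r * int D \<and>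
      forward_row (Suc k) a = (\<lambda>u. forward_row k a u + max 0 r * forward_row k k u)"
    if a: "a < m" "a \<noteq> k" for a
  proof -
    consider "a < k" | "k < a" "a < Suc n" | "a = Suc n" using a by linarith
    then show ?thesis
    proof cases
      case 1
      have "gram (forward_row k a) (E k) = (- of_bool (k = Suc a)) * int D"
        using 1 assms a by (simp add: forward_row_def gram_linear gram_E_E nxt_def)
      then show ?thesis unfolding Rk using 1 by - (rule exI[of _ "- of_bool (k = Suc a)"], (simp add: forward_row_def))
    next
      case 2
      have "gram (forward_row k a) (E k) = (- of_bool (a = Suc k)) * int D"
        using 2 assms a by (simp add: forward_row_def gram_linear gram_E_E nxt_def)
      then show ?thesis unfolding Rk using 2 by - (rule exI[of _ "- of_bool (a = Suc k)"], (simp add: forward_row_def))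
    next
      case 3
      have "forward_row k a = P k" using 3 assms by (simp add: forward_row_def min_def)
      \<comment> \<open>For \<open>k < n\<close> there is an arrow from the last vertex to
        \<open>v k\<close>. For \<open>k = n\<close> the arrows between it and \<open>v n\<close>
        have cancelled, whence the cap \<open>min k n\<close> in \<open>forward_row\<close>.\<close>
      moreover have "gram (P k) (E k) = (of_bool (k < n)) * int D"
        using assms unfolding gram_skew[of "P k"]
        by (auto simp: gram_E_P HP_def prv_def split: if_splits)
      moreover have "forward_row (Suc k) a = (\<lambda>u. P k u + of_bool (k < n) * E k u)"
      proof (cases "k = n")
        case True then show ?thesis using 3 by (simp add: forward_row_def)
      next
        case False then show ?thesis using 3 assms by (simp add: forward_row_def min_def P_Suc)
      qed
      ultimately show ?thesis unfolding Rk by - (rule exI[of _ "of_bool (k < n)"], simp)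
    qed
  qed
  show "\<exists>r. gram (unit_vec x) (forward_row k k) + c x * of_bool (p x < k) * gram (E (p x)) (forward_row k k) = r * int D \<and>
      (\<lambda>u. c x * of_bool (p x < Suc k) * E (p x) u) =
      (\<lambda>u. c x * of_bool (p x < k) * E (p x) u + max 0 r * forward_row k k u)"
    if x: "x \<in> I - v ` {..<m}" for x
  proof -
    define r where "r = c x * (H (p x) k + of_bool (p x < k) * (of_bool (k = nxt (p x)) - of_bool (p x = nxt k)))"
    have "gram (unit_vec x) (E k) + c x * of_bool (p x < k) * gram (E (p x)) (E k) = r * int D"
      using x assms p_less[of x] by (simp add: r_def gram_ext_E gram_E_E algebra_simps)
    moreover have "max 0 r = c x * of_bool (p x = k)"
      using c_nonneg[of x] assms p_less[of x]
      by (auto simp: r_def H_def nxt_def max_def split: if_splits)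
    ultimately show ?thesis unfolding Rk by - (rule exI[of _ r], (auto simp: fun_eq_iff))
  qed
qed

text \<open>On the way back only the outside vertices at the closing arrow,
  \<open>p x = Suc n\<close>, still change, and only in the final mutation at \<open>v 0\<close>,
  where \<open>P 0 = E (Suc n)\<close>.\<close>

lemma backward_step:
  assumes "based \<phi> (row_basis (backward_row (Suc k)) (\<lambda>x. c x * of_bool (p x \<le> n)))" "Suc k \<le> n"
  shows "based (Mut (v k) # \<phi>) (row_basis (backward_row k) (\<lambda>x. c x * of_bool (p x \<le> n \<or> k = 0)))"
proof (rule based_row_Mut[OF assms(1)])
  have Rk: "backward_row (Suc k) k = P k" using assms by (simp add: backward_row_def)
  show "k < m" using assms by simp
  show "combine (backward_row (Suc k) k) w \<ge> 0" for w unfolding Rk using assms combine_P_nonneg by simp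
  show "backward_row k k = (\<lambda>u. - backward_row (Suc k) k u)" using assms by (simp add: backward_row_def)
  show "\<exists>r. gram (backward_row (Suc k) a) (backward_row (Suc k) k) = r * int D \<and>
      backward_row k a = (\<lambda>u. backward_row (Suc k) a u + max 0 r * backward_row (Suc k) k u)"
    if a: "a < m" "a \<noteq> k" for a
  proof -
    consider "a < k" | "a = Suc k" | "a > Suc k" using a by linarith
    then show ?thesis
    proof cases
      case 1
      have "gram (backward_row (Suc k) a) (P k) = of_bool (Suc a = k) * int D"
        using 1 assms a by (auto simp: backward_row_def gram_linear gram_E_P HP_def prv_def split: if_splits)
      moreover have "backward_row k a = (\<lambda>u. backward_row (Suc k) a u + of_bool (Suc a = k) * P k u)"
      proof (cases "Suc a = k")
        case True then show ?thesis using P_Suc[of a] by (simp add: backward_row_def)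
      next
        case False then show ?thesis using 1 by (simp add: backward_row_def)
      qed
      ultimately show ?thesis unfolding Rk by - (rule exI[of _ "of_bool (Suc a = k)"], simp)
    next
      case 2
      have "gram (backward_row (Suc k) a) (P k) = 1 * int D"
        using 2 assms a by (auto simp: backward_row_def P_Suc gram_linear gram_E_P HP_def prv_def split: if_splits)
      moreover have "backward_row k a = (\<lambda>u. backward_row (Suc k) a u + P k u)"
        using 2 by (auto simp: backward_row_def P_Suc)
      ultimately show ?thesis unfolding Rk by - (rule exI[of _ 1], simp)
    next
      case 3
      have "gram (backward_row (Suc k) a) (P k) = (- of_bool (a = Suc n)) * int D"
      proof -
        obtain b where b: "a = Suc b" "k < b" "b \<le> n" using 3 a by (cases a) auto
        have "HP (prv b) k + HP b k = - of_bool (b = n)"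
          using b by (auto simp: HP_def prv_def)
        then show ?thesis using b assms by (simp add: backward_row_def gram_linear gram_E_P)
      qed
      moreover have "backward_row k a = backward_row (Suc k) a"
        using 3 by (simp add: backward_row_def)
      ultimately show ?thesis unfolding Rk by - (rule exI[of _ "- of_bool (a = Suc n)"], simp)
    qed
  qed
  show "\<exists>r. gram (unit_vec x) (backward_row (Suc k) k) +
        c x * of_bool (p x \<le> n) * gram (E (p x)) (backward_row (Suc k) k) = r * int D \<and>
      (\<lambda>u. c x * of_bool (p x \<le> n \<or> k = 0) * E (p x) u) =
      (\<lambda>u. c x * of_bool (p x \<le> n) * E (p x) u + max 0 r * backward_row (Suc k) k u)"
    if x: "x \<in> I - v ` {..<m}" for x
  proof -
    define r where "r = c x * (HP (p x) k - of_bool (p x \<le> n) * (HP (prv (p x)) k + HP (p x) k))"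
    have "gram (unit_vec x) (P k) + c x * of_bool (p x \<le> n) * gram (E (p x)) (P k) = r * int D"
      using x assms p_less[of x] by (simp add: r_def gram_ext_P gram_E_P algebra_simps)
    moreover have "max 0 r = c x * of_bool (p x = Suc n \<and> k = 0)"
      using c_nonneg[of x] assms p_less[of x]
      by (auto simp: r_def HP_def prv_def max_def split: if_splits)
    ultimately show ?thesis unfolding Rk using p_less[of x]
      by - (rule exI[of _ r], (auto simp: fun_eq_iff P_0))
  qed
qed

text \<open>For \<open>n = 0\<close>, the case of two vertices, there is no way back, and the
  outside vertices at the closing arrow change here instead; hence the disjunct
  \<open>n = 0\<close>. The transposition brings the last two c-vectors into the order in which the
  backward pattern starts.\<close>

lemma middle_step:
  assumes "based \<phi> (row_basis (forward_row (Suc n)) (\<lambda>x. c x * of_bool (p x < Suc n)))"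
  shows "based (Perm (transpose (v n) (v (Suc n))) # Mut (v (Suc n)) # \<phi>)
    (row_basis (backward_row (n)) (\<lambda>x. c x * of_bool (p x \<le> n \<or> n = 0)))"
proof -
  let ?P = "P (n)"
  let ?\<pi> = "transpose (v n) (v (Suc n))"
  define R' where "R' a = (if a = Suc n then (\<lambda>u. - ?P u) else if Suc a = n then P a else (\<lambda>u. - E a u))" for a
  define X' where "X' x = c x * of_bool (p x \<le> n \<or> n = 0)" for x
  have "based (Mut (v (Suc n)) # \<phi>) (row_basis R' X')"
  proof (rule based_row_Mut[OF assms])
    have Rk: "forward_row (Suc n) (Suc n) = ?P" by (simp add: forward_row_def)
    show "Suc n < m" by simp
    show "combine (forward_row (Suc n) (Suc n)) w \<ge> 0" for w unfolding Rk using combine_P_nonneg by simp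
    show "R' (Suc n) = (\<lambda>u. - forward_row (Suc n) (Suc n) u)" unfolding Rk by (simp add: R'_def)
    show "\<exists>r. gram (forward_row (Suc n) a) (forward_row (Suc n) (Suc n)) = r * int D \<and>
        R' a = (\<lambda>u. forward_row (Suc n) a u + max 0 r * forward_row (Suc n) (Suc n) u)"
      if a: "a < m" "a \<noteq> Suc n" for a
    proof -
      have "gram (forward_row (Suc n) a) ?P = of_bool (Suc a = n) * int D"
        using a by (auto simp: forward_row_def gram_linear gram_E_P HP_def prv_def split: if_splits)
      moreover have "R' a = (\<lambda>u. forward_row (Suc n) a u + of_bool (Suc a = n) * ?P u)"
      proof (cases "Suc a = n")
        case True
        have Pn: "P n = (\<lambda>u. P a u + E a u)" using P_Suc[of a] unfolding True .
        have "R' a = P a" "forward_row (Suc n) a = (\<lambda>u. - E a u)"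
          using True a by (simp_all add: R'_def forward_row_def)
        then show ?thesis unfolding Pn by (simp add: True)
      next
        case False
        then show ?thesis using a by (auto simp: R'_def forward_row_def)
      qed
      ultimately show ?thesis unfolding Rk by - (rule exI[of _ "of_bool (Suc a = n)"], simp)
    qed
    show "\<exists>r. gram (unit_vec x) (forward_row (Suc n) (Suc n)) +
          c x * of_bool (p x < Suc n) * gram (E (p x)) (forward_row (Suc n) (Suc n)) = r * int D \<and>
        (\<lambda>u. X' x * E (p x) u) =
        (\<lambda>u. c x * of_bool (p x < Suc n) * E (p x) u + max 0 r * forward_row (Suc n) (Suc n) u)"
      if x: "x \<in> I - v ` {..<m}" for x
    proof -
      define r where "r = c x * (HP (p x) (n) - of_bool (p x < Suc n) * (HP (prv (p x)) (n) + HP (p x) (n)))"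
      have "gram (unit_vec x) ?P + c x * of_bool (p x < Suc n) * gram (E (p x)) ?P = r * int D"
        using x p_less[of x] by (simp add: r_def gram_ext_P gram_E_P algebra_simps)
      moreover have "max 0 r = c x * of_bool (p x = Suc n \<and> n = 0)"
        using c_nonneg[of x] p_less[of x]
        by (auto simp: r_def HP_def prv_def max_def split: if_splits)
      moreover have "X' x * E (p x) u = c x * of_bool (p x < Suc n) * E (p x) u +
          c x * of_bool (p x = Suc n \<and> n = 0) * ?P u" for u
      proof (cases "p x = Suc n \<and> n = 0")
        case True
        then have "P n = E (p x)" by (metis P_0)
        then show ?thesis using True by (simp only: X'_def) simp
      next
        case False
        then show ?thesis using p_less[of x] by (auto simp: X'_def)
      qed
      ultimately show ?thesis unfolding Rk by - (rule exI[of _ r], simp)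
    qed
  qed
  moreover have "?\<pi> permutes I" using v_in[of n] v_in[of "Suc n"] by (intro permutes_swap_id) simp_all
  moreover have "wt Q0 (inv ?\<pi> i) = wt Q0 i" for i
    using wt_v[of "Suc n"] wt_v[of n] by (auto simp: inv_transpose_eq transpose_def)
  ultimately have "based (Perm ?\<pi> # Mut (v (Suc n)) # \<phi>) (\<lambda>i. row_basis R' X' (inv ?\<pi> i))"
    by (rule based_Perm)
  then show ?thesis
  proof (rule based_cong)
    fix i assume "i \<in> I"
    have vne: "v a = v b \<longleftrightarrow> a = b" if "a < m" "b < m" for a b
      using v_inj that by (auto simp: inj_on_def)
    show "row_basis R' X' (inv ?\<pi> i) = row_basis (backward_row (n)) (\<lambda>x. c x * of_bool (p x \<le> n \<or> n = 0)) i"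
    proof (cases "i \<in> v ` {..<m}")
      case True
      then obtain a where a: "i = v a" "a < m" by blast
      define b where "b = (if a = Suc n then n else if a = n then Suc n else a)"
      have b: "inv ?\<pi> i = v b" "b < m" using a(2)
        unfolding a(1) by (auto simp: inv_transpose_eq transpose_def vne b_def)
      have "R' b = backward_row n a"
        using a(2) by (cases "a = Suc n"; cases "a = n") (auto simp: b_def R'_def backward_row_def)
      then show ?thesis using a b by simp
    next
      case False
      then have "i \<noteq> v (Suc n)" "i \<noteq> v n" by auto
      then show ?thesis using False by (simp add: inv_transpose_eq transpose_def row_basis_ext X'_def)
    qed
  qed
qed

definition row_word :: "'v mseq" where
  "row_word = map (\<lambda>a. Mut (v a)) [0..<n] @
     [Perm (transpose (v n) (v (Suc n))), Mut (v (Suc n)), Mut (v n)] @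
     rev (map (\<lambda>a. Mut (v a)) [0..<n])"

lemma forward_based:
  "k \<le> Suc n \<Longrightarrow> based (rev (map (\<lambda>a. Mut (v a)) [0..<k]))
     (row_basis (forward_row k) (\<lambda>x. c x * of_bool (p x < k)))"
proof (induction k)
  case 0
  have "unit_vec i = row_basis (forward_row 0) (\<lambda>x. c x * of_bool (p x < 0)) i" for i
    by (cases "i \<in> v ` {..<m}") (auto simp: row_basis_ext forward_row_def E_def P_0)
  then show ?case using based_cong[OF based_Nil] by simp
next
  case (Suc k)
  then show ?case using forward_step[of "rev (map (\<lambda>a. Mut (v a)) [0..<k])" k] by simp
qed

lemma backward_based:
  assumes "based \<phi> (row_basis (backward_row (n)) (\<lambda>x. c x * of_bool (p x \<le> n \<or> n = 0)))"
  shows "k \<le> n \<Longrightarrow> based (map (\<lambda>a. Mut (v a)) [n - k..<n] @ \<phi>)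
     (row_basis (backward_row (n - k)) (\<lambda>x. c x * of_bool (p x \<le> n \<or> n - k = 0)))"
proof (induction k)
  case 0
  show ?case using assms by simp
next
  case (Suc k)
  define j where "j = n - Suc k"
  have j: "n - k = Suc j" "Suc j \<le> n" using Suc.prems by (auto simp: j_def)
  have "[j..<n] = j # [Suc j..<n]" using j by (intro upt_conv_Cons) simp
  moreover have "based (map (\<lambda>a. Mut (v a)) [Suc j..<n] @ \<phi>)
      (row_basis (backward_row (Suc j)) (\<lambda>x. c x * of_bool (p x \<le> n)))"
    using Suc.IH Suc.prems unfolding j by simp
  ultimately show ?case using backward_step[OF _ j(2)] unfolding j_def[symmetric] by simp
qed

lemma row_word_based: "based row_word (row_basis (\<lambda>a u. - E (prv a) u) c)"
proof -
  have 1: "rev (map (\<lambda>a. Mut (v a)) [0..<Suc n]) = Mut (v n) # rev (map (\<lambda>a. Mut (v a)) [0..<n])"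
  proof -
    have "[0..<Suc n] = [0..<n] @ [n]"
      using upt_Suc_append[of 0 n] by (simp add: Suc_diff_le numeral_2_eq_2 Suc_diff_Suc)
    then show ?thesis by simp
  qed
  have "based row_word (row_basis (backward_row 0) (\<lambda>x. c x * of_bool (p x \<le> n \<or> (0::nat) = 0)))"
    using backward_based[OF middle_step[OF forward_based[of "Suc n"]], of n]
    unfolding row_word_def 1 by simp
  then show ?thesis
    by (rule based_row_cong) (auto simp: backward_row_def P_0 prv_def)
qed

text \<open>The change of basis is an isometry of the skew form. As exchange matrices are Gram
  matrices of c-vectors, the sequence restores the quiver.\<close>

lemma row_basis_gram:
  assumes "i \<in> I" "j \<in> I"
  shows "gram (row_basis (\<lambda>a u. - E (prv a) u) c i) (row_basis (\<lambda>a u. - E (prv a) u) c j) =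
    gram (unit_vec i) (unit_vec j)"
proof -
  let ?B = "row_basis (\<lambda>a u. - E (prv a) u) c"
  have vv: "gram (?B (v a)) (?B (v b)) = gram (E a) (E b)" if "a < m" "b < m" for a b
    using that prv_less[of a] prv_less[of b]
    by (simp add: gram_linear gram_E_E nxt_prv prv_eq_iff)
  have xv: "gram (?B x) (?B (v a)) = gram (unit_vec x) (E a)" if "x \<in> I - v ` {..<m}" "a < m" for x a
  proof -
    have "gram (?B x) (?B (v a)) =
        - (c x * (H (p x) (prv a) + (of_bool (prv a = nxt (p x)) - of_bool (p x = nxt (prv a))))) * int D"
      using that prv_less[of a] p_less[of x]
      by (simp add: row_basis_ext gram_linear gram_ext_E gram_E_E) (simp add: algebra_simps)
    also have "\<dots> = c x * H (p x) a * int D"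
      using that p_less[of x] prv_eq_iff[of "p x" a]
      by (cases "a = p x"; cases "a = nxt (p x)") (simp_all add: H_def nxt_prv)
    finally show ?thesis using that by (simp add: gram_ext_E)
  qed
  have xx: "gram (?B x) (?B y) = gram (unit_vec x) (unit_vec y)"
    if "x \<in> I - v ` {..<m}" "y \<in> I - v ` {..<m}" for x y
  proof -
    have "gram (?B x) (?B y) = gram (unit_vec x) (unit_vec y) +
        c x * c y * (H (p x) (p y) - H (p y) (p x) + (of_bool (p y = nxt (p x)) - of_bool (p x = nxt (p y)))) * int D"
      using that p_less[of x] p_less[of y] gram_skew[of "E (p x)" "unit_vec y"]
      by (simp add: row_basis_ext gram_linear gram_ext_E gram_E_E) (simp add: algebra_simps)
    then show ?thesis by (simp add: H_def)
  qed
  show ?thesis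
  proof (cases "i \<in> v ` {..<m}"; cases "j \<in> v ` {..<m}")
    assume "i \<in> v ` {..<m}" "j \<in> v ` {..<m}"
    then show ?thesis using vv by (auto simp: E_def)
  next
    assume "i \<in> v ` {..<m}" "j \<notin> v ` {..<m}"
    then obtain a where a: "i = v a" "a < m" by blast
    have "gram (?B (v a)) (?B j) = - gram (?B j) (?B (v a))" by (rule gram_skew)
    also have "\<dots> = - gram (unit_vec j) (E a)" using xv[of j a] assms \<open>j \<notin> _\<close> a by simp
    also have "\<dots> = gram (E a) (unit_vec j)" by (rule gram_skew[symmetric])
    finally show ?thesis using a by (simp add: E_def)
  next
    assume "i \<notin> v ` {..<m}" "j \<in> v ` {..<m}"
    then show ?thesis using xv assms by (auto simp: E_def)
  next
    assume "i \<notin> v ` {..<m}" "j \<notin> v ` {..<m}"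
    then show ?thesis using xx assms by auto
  qed
qed

lemma row_word_run:
  "green_from (Q0, x0) row_word"
  "\<exists>x. coeff_run row_word (Q0, x0) = (Q0, x) \<and>
     (\<forall>a<m. \<forall>w. expo (x (v a)) w = - expo (x0 (v (prv a))) w) \<and>
     (\<forall>y\<in>I - v ` {..<m}. \<forall>w. expo (x y) w = expo (x0 y) w + c y * expo (x0 (v (p y))) w)"
proof -
  let ?B = "row_basis (\<lambda>a u. - E (prv a) u) c"
  obtain Q x where run: "coeff_run row_word (Q0, x0) = (Q, x)" by fastforce
  have green: "green_from (Q0, x0) row_word" and Q: "verts Q = I" "wt Q = wt Q0"
    and eps: "\<And>i j. i \<in> I \<Longrightarrow> j \<in> I \<Longrightarrow> exch Q i j * d j = gram (?B i) (?B j)"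
    and out: "\<And>i j. i \<notin> I \<or> j \<notin> I \<Longrightarrow> exch Q i j = 0"
    and x: "\<And>i v. i \<in> I \<Longrightarrow> expo (x i) v = combine (?B i) v"
    using row_word_based unfolding based_def run by auto
  show "green_from (Q0, x0) row_word" by fact
  have "exch Q i j = exch Q0 i j" for i j
  proof (cases "i \<in> I \<and> j \<in> I")
    case True
    then show ?thesis using eps[of i j] row_basis_gram[of i j] gram_unit[of i j] wt_pos[of j] by simp
  qed (use out exch_outside in auto)
  then have "Q = Q0" using Q by (intro wquiver.equality) (auto simp: fun_eq_iff)
  moreover have "expo (x (v a)) w = - expo (x0 (v (prv a))) w" if "a < m" for a w
  proof -
    have "prv a < m" using that by (auto simp: prv_def)
    then show ?thesis using x[OF v_in[OF that], of w] that by (simp add: combine_linear E_def combine_unit v_in)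
  qed
  moreover have "expo (x y) w = expo (x0 y) w + c y * expo (x0 (v (p y))) w" if "y \<in> I - v ` {..<m}" for y w
    using x[of y w] that by (simp add: row_basis_ext combine_linear E_def combine_unit v_in p_less)
  ultimately show "\<exists>x. coeff_run row_word (Q0, x0) = (Q0, x) \<and>
     (\<forall>a<m. \<forall>w. expo (x (v a)) w = - expo (x0 (v (prv a))) w) \<and>
     (\<forall>y\<in>I - v ` {..<m}. \<forall>w. expo (x y) w = expo (x0 y) w + c y * expo (x0 (v (p y))) w)"
    using run by auto
qed

end

section \<open>The quiver \<open>Q\<^sub>m\<close>\<close>

text \<open>The linear functional with q^k |-> \<open>f k\<close>. On Q_m a power of q matters only
  through an index shift modulo \<open>m\<close>, which \<open>f\<close> will encode.\<close>

definition coeff_sum :: "(nat \<Rightarrow> int) \<Rightarrow> int poly \<Rightarrow> int" where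
  "coeff_sum f p = (\<Sum>k\<le>degree p. coeff p k * f k)"

lemma coeff_sum_bound:
  assumes "degree p \<le> K"
  shows "coeff_sum f p = (\<Sum>k\<le>K. coeff p k * f k)"
  unfolding coeff_sum_def using assms
  by (intro sum.mono_neutral_left) (auto simp: coeff_eq_0)

lemma coeff_sum_add: "coeff_sum f (p + r) = coeff_sum f p + coeff_sum f r"
proof -
  define K where "K = max (degree p) (degree r)"
  have "degree (p + r) \<le> K" unfolding K_def by (rule degree_add_le_max)
  then show ?thesis
    by (subst (1 2 3) coeff_sum_bound[of _ K]) (auto simp: K_def algebra_simps sum.distrib)
qed

lemma coeff_sum_pCons: "coeff_sum f (pCons a p) = a * f 0 + coeff_sum (\<lambda>k. f (Suc k)) p"
  by (subst coeff_sum_bound[of _ "Suc (degree p)"])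
    (simp_all add: degree_pCons_le sum.atMost_Suc_shift coeff_sum_def del: sum.atMost_Suc)

lemma coeff_sum_0 [simp]: "coeff_sum f 0 = 0"
  by (simp add: coeff_sum_def)

lemma coeff_sum_smult: "coeff_sum f (smult c p) = c * coeff_sum f p"
  by (induction p arbitrary: f) (auto simp: coeff_sum_pCons algebra_simps)

lemma coeff_sum_monom_mult: "coeff_sum f (monom c e * p) = c * coeff_sum (\<lambda>k. f (k + e)) p"
  by (induction e arbitrary: f) (auto simp: monom_0 monom_Suc coeff_sum_smult coeff_sum_pCons)

lemma coeff_sum_nonneg: "nonneg_poly p \<Longrightarrow> (\<And>k. f k \<ge> 0) \<Longrightarrow> coeff_sum f p \<ge> 0"
  by (auto simp: coeff_sum_def nonneg_poly_def intro!: sum_nonneg)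

lemma exch_of_mult: "exch_of d \<sigma> i j = \<sigma> i j * (int (d i) div int (gcd (d i) (d j)))"
  unfolding exch_of_def by (rule div_mult_swap[symmetric]) (simp add: int_dvd_int_iff)

lemma add_mod_eq_iff:
  assumes "j < m" "e \<le> m"
  shows "(x + e) mod m = j \<longleftrightarrow> x mod m = (j + m - e) mod (m::nat)"
proof -
  have "(x + e) mod m = j \<longleftrightarrow> [x + e = (j + m - e) + e] (mod m)"
    using assms by (simp add: cong_def)
  then show ?thesis by (simp only: cong_add_rcancel_nat) (simp add: cong_def)
qed

locale coxeter_data =
  fixes m :: nat and C :: "'s::finite \<Rightarrow> 's \<Rightarrow> int" and d :: "'s \<Rightarrow> nat" and \<sigma> :: "'s \<Rightarrow> 's \<Rightarrow> int"
  assumes m_ge_2: "m \<ge> 2" and GCM: "symmetrizable_GCM C d" and coxeter: "coxeter_quiver C d \<sigma>"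
begin

lemma \<sigma>_antisym: "\<sigma> s t = - \<sigma> t s"
  using coxeter unfolding coxeter_quiver_def by blast

lemma \<sigma>_self [simp]: "\<sigma> s s = 0"
  using \<sigma>_antisym[of s s] by simp

lemma d_pos: "d s > 0"
  using GCM unfolding symmetrizable_GCM_def by blast

lemma d_div_gcd_pos: "int (d s) div int (gcd (d s) (d t)) > 0"
proof -
  have "gcd (d s) (d t) \<le> d s" using d_pos by (simp add: gcd_le1_nat)
  then show ?thesis using d_pos[of s] by (simp add: pos_imp_zdiv_pos_iff)
qed

lemma abs_\<sigma>:
  assumes "s \<noteq> t"
  shows "\<bar>\<sigma> s t\<bar> * (int (d s) div int (gcd (d s) (d t))) = - C t s"
proof -
  have "\<bar>\<sigma> s t * (int (d s) div int (gcd (d s) (d t)))\<bar> = - C t s"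
    using coxeter assms unfolding coxeter_quiver_def exch_of_mult by blast
  then show ?thesis unfolding abs_mult abs_of_pos[OF d_div_gcd_pos] .
qed

lemma \<sigma>_zero_iff:
  assumes "s \<noteq> t"
  shows "\<sigma> s t = 0 \<longleftrightarrow> C t s = 0"
  using abs_\<sigma>[OF assms] less_imp_neq[OF d_div_gcd_pos[of s t]] by auto

sublocale oriented_cartan C "arrow_ori \<sigma>"
proof
  fix s t :: 's
  show "C s s = 2" "s \<noteq> t \<Longrightarrow> C s t \<le> 0" "C s t = 0 \<longleftrightarrow> C t s = 0"
    using GCM unfolding symmetrizable_GCM_def by blast+
  assume "s \<noteq> t" "C s t \<noteq> 0"
  then have "\<sigma> t s \<noteq> 0" using \<sigma>_zero_iff[of t s] by auto
  then show "(1 \<le> \<sigma> s t) = (\<not> 1 \<le> \<sigma> t s)" using \<sigma>_antisym[of s t] by auto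
qed

abbreviation "Q \<equiv> Qm m d \<sigma>"

lemma verts_Q [simp]: "verts Q = Qm_verts m" and wt_Q: "wt Q v = d (fst v)"
  by (simp_all add: Qm_def)

lemma in_Qm_verts [simp]: "(s, i) \<in> Qm_verts m \<longleftrightarrow> i < m"
  by (simp add: Qm_verts_def)

lemma finite_Qm_verts: "finite (Qm_verts m :: ('s \<times> nat) set)"
  by (simp add: Qm_verts_def)

lemma exch_Q: "exch Q v w = (Qm_arrows m \<sigma> v w - Qm_arrows m \<sigma> w v) *
    (int (d (fst v)) div int (gcd (d (fst v)) (d (fst w))))"
  by (simp add: Qm_def exch_of_mult)

lemma exch_Q_outside: "v \<notin> Qm_verts m \<or> w \<notin> Qm_verts m \<Longrightarrow> exch Q v w = 0"
  unfolding exch_Q by (cases v; cases w) auto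

lemma exch_Q_same:
  "i < m \<Longrightarrow> j < m \<Longrightarrow> exch Q (s, i) (s, j) = of_bool (j = Suc i mod m) - of_bool (i = Suc j mod m)"
  unfolding exch_Q using d_pos[of s] by auto

text \<open>Seen from v_j^t, the row of \<open>s\<close> is met at one of its arrows, the one
  starting at index j - 1 if the edge points from \<open>s\<close> to \<open>t\<close> and at j
  otherwise. So the vertices of the other rows are outside vertices in the sense of
  \<open>row_cycle\<close>.\<close>

lemma exch_Q_diff:
  assumes "s \<noteq> t" "j < m" "b < m"
  shows "exch Q (t, j) (s, b) = - C s t * (of_bool ((b + of_bool (\<sigma> s t \<ge> 1)) mod m = j) -
    of_bool ((b + of_bool (\<sigma> s t \<ge> 1)) mod m = Suc j mod m))"
proof -
  define g where "g = int (d t) div int (gcd (d t) (d s))"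
  have g: "\<bar>\<sigma> t s\<bar> * g = - C s t" unfolding g_def using abs_\<sigma>[of t s] assms(1) by simp
  have anti: "\<sigma> t s = - \<sigma> s t" by (rule \<sigma>_antisym)
  have Suc_mod: "Suc b mod m = Suc j mod m \<longleftrightarrow> b = j"
    using assms by (auto simp: mod_Suc)
  consider "\<sigma> s t \<ge> 1" | "\<sigma> s t \<le> - 1" | "\<sigma> s t = 0" by linarith
  then show ?thesis
  proof cases
    case 1
    have "Qm_arrows m \<sigma> (t, j) (s, b) - Qm_arrows m \<sigma> (s, b) (t, j) =
        \<sigma> s t * (of_bool (Suc b mod m = j) - of_bool (b = j))"
      using 1 assms anti by auto
    moreover have "\<sigma> s t * g = - C s t" using g 1 anti by simp
    ultimately show ?thesis using 1 Suc_mod unfolding exch_Q g_def[symmetric] fst_conv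
      by (simp add: mult.commute[of _ g] mult.left_commute[of _ g] mult.assoc[symmetric])
  next
    case 2
    have "Qm_arrows m \<sigma> (t, j) (s, b) - Qm_arrows m \<sigma> (s, b) (t, j) =
        \<sigma> t s * (of_bool (b = j) - of_bool (b = Suc j mod m))"
      using 2 assms anti by auto
    moreover have "\<sigma> t s * g = - C s t" using g 2 anti by simp
    ultimately show ?thesis using 2 assms unfolding exch_Q g_def[symmetric] fst_conv
      by (simp add: mult.commute[of _ g] mult.left_commute[of _ g] mult.assoc[symmetric])
  next
    case 3
    then show ?thesis using g anti assms unfolding exch_Q by simp
  qed
qed

lemma Q_skew:
  assumes "v \<in> Qm_verts m" "w \<in> Qm_verts m"
  shows "exch Q v w * int (wt Q w) = - (exch Q w v * int (wt Q v))"
proof -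
  have "(int a div int (gcd a b)) * int b = (int b div int (gcd b a)) * int a" for a b
    by (simp add: gcd.commute[of b a] div_mult_swap dvd_div_mult mult.commute)
  then show ?thesis unfolding exch_Q wt_Q
    by (simp add: mult.assoc left_diff_distrib)
qed

lemma Q_green_start: "green_start Q"
proof
  show "finite (verts Q)" by (simp add: finite_Qm_verts)
  show "wt Q i > 0" for i using d_pos by (simp add: wt_Q)
  show "exch Q i j * int (wt Q j) = - (exch Q j i * int (wt Q i))" if "i \<in> verts Q" "j \<in> verts Q" for i j
    using that by (intro Q_skew) simp_all
  show "exch Q i j = 0" if "i \<notin> verts Q \<or> j \<notin> verts Q" for i j
    using that by (intro exch_Q_outside) simp
qed

text \<open>Counting positions from the base point \<open>i\<close> turns the reflection sequence
  into \<open>row_word\<close> on the cycle, for every choice of \<open>i\<close>.\<close>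

lemma R_refl_row_word:
  "R_refl m s i = map (\<lambda>a. Mut (s, (i + a) mod m)) [0..<m - 2] @
     [Perm (transpose (s, (i + (m - 2)) mod m) (s, (i + Suc (m - 2)) mod m)),
      Mut (s, (i + Suc (m - 2)) mod m), Mut (s, (i + (m - 2)) mod m)] @
     rev (map (\<lambda>a. Mut (s, (i + a) mod m)) [0..<m - 2])"
proof -
  have e: "m + i - 2 = (m - 2) + i" "m + i - 1 = i + Suc (m - 2)"
    and e': "i + m - 2 = i + (m - 2)" "i + m - Suc 0 = Suc (i + (m - 2))" using m_ge_2 by auto
  have "[i..<m + i - 2] = map (\<lambda>a. a + i) [0..<m - 2]" unfolding e map_add_upt ..
  then have "map (\<lambda>j. Mut (vtx m s j)) [i..<m + i - 2] = map (\<lambda>a. Mut (s, (i + a) mod m)) [0..<m - 2]"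
    by (simp add: vtx_def o_def add.commute)
  then show ?thesis unfolding R_refl_def M_seq_def mseq_inv_def
    by (simp add: e e' vtx_def rev_map[symmetric] o_def add.commute)
qed

lemma R_refl_run:
  assumes pos: "\<And>b. b < m \<Longrightarrow> trop_positive (x0 (s, b))"
  shows "green_from (Q, x0) (R_refl m s i)"
    "\<exists>x. coeff_run (R_refl m s i) (Q, x0) = (Q, x) \<and>
       (\<forall>b<m. \<forall>w. expo (x (s, b)) w = - expo (x0 (s, (b + m - 1) mod m)) w) \<and>
       (\<forall>t j w. t \<noteq> s \<longrightarrow> j < m \<longrightarrow> expo (x (t, j)) w =
          expo (x0 (t, j)) w - C s t * expo (x0 (s, (j + m - of_bool (\<sigma> s t \<ge> 1)) mod m)) w)"
proof -
  define v where "v a = (s, (i + a) mod m)" for a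
  define c where "c x = (if fst x = s then 0 else - C s (fst x))" for x :: "'s \<times> nat"
  define e :: "'s \<Rightarrow> nat" where "e t = of_bool (\<sigma> s t \<ge> 1)" for t
  \<comment> \<open>The position, counted from the base point, of the arrow to which
    \<open>x\<close> is attached. It is computed in the integers, where subtraction does not
    truncate.\<close>
  define p where "p x = nat ((int (snd x) - int i - int (e (fst x))) mod int m)" for x :: "'s \<times> nat"
  have m: "m = Suc (Suc (m - 2))" using m_ge_2 by simp
  have p_lt: "p x < m" for x unfolding p_def using m_ge_2 by (simp add: nat_less_iff)
  have p: "a = p (t, j) \<longleftrightarrow> (i + a + e t) mod m = j mod m" if "a < m" for a t j
  proof -
    have "a = p (t, j) \<longleftrightarrow> int a = (int j - int i - int (e t)) mod int m"
      using m_ge_2 unfolding p_def by auto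
    also have "\<dots> \<longleftrightarrow> int a mod int m = (int j - int i - int (e t)) mod int m" using that by simp
    also have "\<dots> \<longleftrightarrow> (int i + int a + int (e t)) mod int m = int j mod int m"
      unfolding mod_eq_dvd_iff by (simp add: algebra_simps)
    also have "\<dots> \<longleftrightarrow> (i + a + e t) mod m = j mod m"
      by (metis of_nat_add of_nat_eq_iff zmod_int)
    finally show ?thesis .
  qed
  have p_Suc: "a = Suc (p (t, j)) mod m \<longleftrightarrow> (i + a + e t) mod m = Suc j mod m" if "a < m" for a t j
  proof -
    have "[i + p (t, j) + e t = j] (mod m)" using p[of "p (t, j)" t j] p_lt unfolding cong_def by simp
    from cong_add[OF this cong_refl[of 1]] have *: "[i + Suc (p (t, j)) + e t = Suc j] (mod m)" by simp
    have "a = Suc (p (t, j)) mod m \<longleftrightarrow> [a = Suc (p (t, j))] (mod m)" using that by (simp add: cong_def)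
    also have "\<dots> \<longleftrightarrow> [i + a + e t = i + Suc (p (t, j)) + e t] (mod m)"
      by (simp only: cong_add_lcancel_nat cong_add_rcancel_nat)
    also have "\<dots> \<longleftrightarrow> [i + a + e t = Suc j] (mod m)"
      using * unfolding cong_def by simp
    finally show ?thesis by (simp add: cong_def)
  qed
  have surj: "\<exists>a<m. b = (i + a) mod m" if "b < m" for b
  proof -
    define a where "a = nat ((int b - int i) mod int m)"
    have "int ((i + a) mod m) = (int i + (int b - int i) mod int m) mod int m"
      unfolding a_def using m_ge_2 by (simp add: zmod_int)
    also have "\<dots> = int b" using that by (simp add: mod_add_right_eq)
    finally have "(i + a) mod m = b" by simp
    moreover have "a < m" unfolding a_def using m_ge_2 by (simp add: nat_less_iff)
    ultimately show ?thesis by blast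
  qed
  have row: "v ` {..<Suc (Suc (m - 2))} = {s} \<times> {..<m}"
    using surj m_ge_2 unfolding m[symmetric] v_def by fastforce
  have inj: "inj_on v {..<Suc (Suc (m - 2))}"
  proof (rule inj_onI)
    fix a b assume "a \<in> {..<Suc (Suc (m - 2))}" "b \<in> {..<Suc (Suc (m - 2))}" "v a = v b"
    then have "[i + a = i + b] (mod m)" "a < m" "b < m" using m by (auto simp: v_def cong_def)
    then show "a = b" by (simp add: cong_add_lcancel_nat) (simp add: cong_def)
  qed
  interpret row_cycle Q x0 "m - 2" v c p "d s"
  proof (intro_locales, rule Q_green_start, unfold_locales)
    show "inj_on v {..<Suc (Suc (m - 2))}" by fact
    fix a b assume "a < Suc (Suc (m - 2))"
    then have a: "a < m" using m by simp
    show "v a \<in> verts Q" "wt Q (v a) = d s" using m_ge_2 by (simp_all add: v_def wt_Q)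
    show "trop_positive (x0 (v a))" using pos m_ge_2 by (simp add: v_def)
    {
      assume "b < Suc (Suc (m - 2))"
      then have b: "b < m" using m by simp
      have Suc_eq: "(i + y) mod m = Suc ((i + x) mod m) mod m \<longleftrightarrow> y = Suc x mod m" if "y < m" for x y
      proof -
        have "(i + y) mod m = Suc ((i + x) mod m) mod m \<longleftrightarrow> [i + y = i + Suc x] (mod m)"
          by (simp add: cong_def mod_Suc_eq)
        also have "\<dots> \<longleftrightarrow> y = Suc x mod m" using that by (simp only: cong_add_lcancel_nat) (simp add: cong_def)
        finally show ?thesis .
      qed
      show "exch Q (v a) (v b) = of_bool (b = Suc a mod Suc (Suc (m - 2))) - of_bool (a = Suc b mod Suc (Suc (m - 2)))"
        unfolding m[symmetric] v_def using m_ge_2 Suc_eq[OF a] Suc_eq[OF b] by (simp add: exch_Q_same)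
    }
    {
      fix x :: "'s \<times> nat" assume x: "x \<in> verts Q - v ` {..<Suc (Suc (m - 2))}"
      obtain t j where tj: "x = (t, j)" by (cases x)
      then have "t \<noteq> s" "j < m" using x unfolding row by auto
      then have "exch Q x (v a) = c x * (of_bool ((i + a + e t) mod m = j mod m) - of_bool ((i + a + e t) mod m = Suc j mod m))"
        unfolding tj v_def c_def using m_ge_2 by (simp add: exch_Q_diff mod_add_left_eq e_def del: of_bool_eq_iff)
      then show "exch Q x (v a) = c x * (of_bool (a = p x) - of_bool (a = Suc (p x) mod Suc (Suc (m - 2))))"
        unfolding m[symmetric] tj p[OF a] p_Suc[OF a] .
    }
  next
    show "c x \<ge> 0" "p x < Suc (Suc (m - 2))" for x
      using C_nonpos[of s "fst x"] p_lt[of x] m by (auto simp: c_def)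
  qed
  have word: "row_word = R_refl m s i"
    unfolding row_word_def R_refl_row_word v_def ..
  show "green_from (Q, x0) (R_refl m s i)" using row_word_run(1) unfolding word .
  obtain x where x: "coeff_run (R_refl m s i) (Q, x0) = (Q, x)"
     "\<And>a w. a < m \<Longrightarrow> expo (x (v a)) w = - expo (x0 (v (prv a))) w"
     "\<And>y w. y \<in> Qm_verts m - {s} \<times> {..<m} \<Longrightarrow> expo (x y) w = expo (x0 y) w + c y * expo (x0 (v (p y))) w"
  proof -
    from row_word_run(2)[unfolded word row verts_Q, folded m] obtain x
      where A: "coeff_run (R_refl m s i) (Q, x0) = (Q, x)"
      "\<forall>a<m. \<forall>w. expo (x (v a)) w = - expo (x0 (v (prv a))) w"
      "\<forall>y\<in>Qm_verts m - {s} \<times> {..<m}. \<forall>w. expo (x y) w = expo (x0 y) w + c y * expo (x0 (v (p y))) w"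
      by (elim exE conjE)
    show ?thesis by (rule that[OF A(1) A(2)[rule_format] A(3)[rule_format]])
  qed
  have "expo (x (s, b)) w = - expo (x0 (s, (b + m - 1) mod m)) w" if b: "b < m" for b w
  proof -
    obtain a where a: "a < m" "b = (i + a) mod m" using surj[OF b] by (elim exE conjE)
    have "v (prv a) = (s, (b + m - 1) mod m)"
    proof (cases "a = 0")
      case True
      have "(b + m - 1) mod m = (i mod m + (m - 1)) mod m" using a True m_ge_2 by simp
      also have "\<dots> = (i + (m - 1)) mod m" by (rule mod_add_left_eq)
      also have "m - 1 = Suc (m - 2)" using m_ge_2 by simp
      finally show ?thesis using True by (simp add: v_def prv_def)
    next
      case False
      have "(b + m - 1) mod m = ((i + a) mod m + (m - 1)) mod m" using a m_ge_2 by simp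
      also have "\<dots> = (i + a + (m - 1)) mod m" by (rule mod_add_left_eq)
      also have "i + a + (m - 1) = (i + (a - 1)) + m" using False m_ge_2 by simp
      also have "\<dots> mod m = (i + (a - 1)) mod m" by simp
      finally show ?thesis using False by (simp add: v_def prv_def)
    qed
    then show ?thesis using x(2)[OF a(1), of w] a(2) by (simp add: v_def)
  qed
  moreover have "expo (x (t, j)) w = expo (x0 (t, j)) w - C s t * expo (x0 (s, (j + m - e t) mod m)) w"
    if "t \<noteq> s" "j < m" for t j w
  proof -
    have "(i + p (t, j) + e t) mod m = j" using p[of "p (t, j)" t j] p_lt that by simp
    then have "(i + p (t, j)) mod m = (j + m - e t) mod m"
      using that m_ge_2 by (subst (asm) add_mod_eq_iff) (auto simp: e_def)
    then show ?thesis using x(3)[of "(t, j)" w] that by (simp add: v_def c_def)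
  qed
  ultimately show "\<exists>x. coeff_run (R_refl m s i) (Q, x0) = (Q, x) \<and>
       (\<forall>b<m. \<forall>w. expo (x (s, b)) w = - expo (x0 (s, (b + m - 1) mod m)) w) \<and>
       (\<forall>t j w. t \<noteq> s \<longrightarrow> j < m \<longrightarrow> expo (x (t, j)) w =
          expo (x0 (t, j)) w - C s t * expo (x0 (s, (j + m - of_bool (\<sigma> s t \<ge> 1)) mod m)) w)"
    using x(1) unfolding e_def by blast
qed

section \<open>The c-vectors along a word of reflections\<close>

lemma R_word_Nil [simp]: "R_word m' [] js = []"
  and R_word_Cons [simp]: "R_word m' (s # ws) (j # js) = R_refl m' s j @ R_word m' ws js"
  by (simp_all add: R_word_def)

text \<open>A power \<open>q\<^sup>k\<close> in a deformed root stands for the shift of the index \<open>i\<close> of \<open>v\<^sub>i\<^sup>s\<close> by \<open>- k\<close>.\<close>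

definition shifted_expo :: "('s \<Rightarrow> int poly) \<Rightarrow> nat \<Rightarrow> 's \<times> nat \<Rightarrow> int" where
  "shifted_expo \<beta> j w = (if snd w < m then coeff_sum (\<lambda>k. of_bool ((snd w + k) mod m = j)) (\<beta> (fst w)) else 0)"

text \<open>The list acts from its right end, and each reflection replaces \<open>T_w\<close>
  alpha_t by \<open>T_w T_s\<close> alpha_t. Hence the reversed word governs the c-vectors, and the
  next reflection is green because the word performed so far has an ascent at its letter.\<close>

lemma R_word_run:
  assumes "reduced (rev us)" "length js = length us"
  shows "green_from (Q, trop_var) (R_word m us js) \<and>
    (\<exists>x. coeff_run (R_word m us js) (Q, trop_var) = (Q, x) \<and>
      (\<forall>t. \<forall>j<m. \<forall>w. expo (x (t, j)) w = shifted_expo (T (rev us) (unit_vec t)) j w))"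
  using assms
proof (induction us arbitrary: js)
  case Nil
  have "expo (trop_var (t, j)) w = shifted_expo (unit_vec t) j w" if "j < m" for t j w
    using that by (cases w) (auto simp: expo_trop_var shifted_expo_def unit_vec_def coeff_sum_def)
  then show ?case by simp
next
  case (Cons s us)
  obtain i js' where js: "js = i # js'" "length js' = length us" using Cons.prems by (cases js) auto
  have red: "reduced (rev us @ [s])" using Cons.prems by simp
  then obtain x0 where green: "green_from (Q, trop_var) (R_word m us js')"
    and run: "coeff_run (R_word m us js') (Q, trop_var) = (Q, x0)"
    and x0: "\<And>t j w. j < m \<Longrightarrow> expo (x0 (t, j)) w = shifted_expo (T (rev us) (unit_vec t)) j w"
    using Cons.IH[OF _ js(2)] reduced_append1 by blast
  have "nonneg_poly (T (rev us) (unit_vec s) u)" for u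
    by (intro T_ascent_nonneg reduced_snoc_ascent red) (rule reduced_append1[OF red])
  then have pos: "trop_positive (x0 (s, b))" if "b < m" for b
    unfolding trop_positive_def x0[OF that] shifted_expo_def by (auto intro: coeff_sum_nonneg)
  obtain x where x: "coeff_run (R_refl m s i) (Q, x0) = (Q, x)"
     "\<And>b w. b < m \<Longrightarrow> expo (x (s, b)) w = - expo (x0 (s, (b + m - 1) mod m)) w"
     "\<And>t j w. t \<noteq> s \<Longrightarrow> j < m \<Longrightarrow> expo (x (t, j)) w =
        expo (x0 (t, j)) w - C s t * expo (x0 (s, (j + m - of_bool (\<sigma> s t \<ge> 1)) mod m)) w"
    using R_refl_run(2)[of x0 s i, OF pos] by blast
  \<comment> \<open>Multiplication by q^e lowers the index by \<open>e\<close>; adding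
    \<open>m\<close> first keeps the subtraction exact.\<close>
  have shift: "coeff_sum (\<lambda>k. of_bool ((a + (k + e)) mod m = j)) p =
      coeff_sum (\<lambda>k. of_bool ((a + k) mod m = (j + m - e) mod m)) p" if "j < m" "e \<le> 1" for a e j p
    using that m_ge_2 add_mod_eq_iff[of j m e] by (simp add: add.assoc[symmetric])
  have "expo (x (t, j)) w = shifted_expo (T (rev (s # us)) (unit_vec t)) j w" if j: "j < m" for t j w
  proof (cases "t = s")
    case True
    have "T [s] (unit_vec s) = (\<lambda>u. - monom 1 1 * unit_vec s u)" by (simp add: T_def defl_unit_vec)
    then have "T (rev (s # us)) (unit_vec s) = (\<lambda>u. - monom 1 1 * T (rev us) (unit_vec s) u)"
      unfolding rev.simps T_append unfolding T_def by (simp only: word_op_scale)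
    moreover have neg: "monom (- 1) 1 = - (monom 1 1 :: int poly)" by (simp add: minus_monom)
    ultimately have "T (rev (s # us)) (unit_vec s) = (\<lambda>u. monom (- 1) 1 * T (rev us) (unit_vec s) u)"
      unfolding neg by (simp only:)
    then show ?thesis unfolding True x(2)[OF j] using m_ge_2 shift[OF j, of 1]
      by (simp add: x0 shifted_expo_def coeff_sum_monom_mult)
  next
    case False
    have "T [s] (unit_vec t) = (\<lambda>u. unit_vec t u + qcoeff s t * unit_vec s u)"
      using False by (simp add: T_def defl_unit_vec)
    then have "T (rev (s # us)) (unit_vec t) = (\<lambda>u. T (rev us) (unit_vec t) u + qcoeff s t * T (rev us) (unit_vec s) u)"
      unfolding rev.simps T_append by (simp only: T_add_scaled)
    then show ?thesis unfolding x(3)[OF False j] using m_ge_2 shift[OF j, of "of_bool (\<sigma> s t \<ge> 1)"] j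
      by (simp add: x0 shifted_expo_def coeff_sum_add oriented_coeff_def coeff_sum_monom_mult)
  qed
  moreover have "green_from (Q, trop_var) (R_word m (s # us) js)"
    using green run R_refl_run(1)[of x0 s i, OF pos] by (simp add: js green_from_append)
  ultimately show ?case using run x(1) by (auto simp: js coeff_run_append)
qed

lemma mutation_sequence_append:
  "mutation_sequence I (\<phi> @ \<psi>) \<longleftrightarrow> mutation_sequence I \<phi> \<and> mutation_sequence I \<psi>"
  by (auto simp: mutation_sequence_def)

lemma mutation_sequence_R_refl: "mutation_sequence (Qm_verts m) (R_refl m s i)"
proof -
  have in_verts: "(s, k mod m) \<in> Qm_verts m" for k using m_ge_2 by simp
  then have "transpose (s, k mod m) (s, l mod m) permutes Qm_verts m" for k l
    by (intro permutes_swap_id)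
  then show ?thesis using in_verts unfolding R_refl_row_word mutation_sequence_def
    by (simp only: set_append set_rev set_map ball_Un) (simp del: in_Qm_verts)
qed

lemma mutation_sequence_R_word:
  "length js = length us \<Longrightarrow> mutation_sequence (Qm_verts m) (R_word m us js)"
proof (induction us arbitrary: js)
  case Nil
  then show ?case by (simp add: mutation_sequence_def)
next
  case (Cons s us)
  then show ?case
    by (cases js) (auto simp: mutation_sequence_append mutation_sequence_R_refl)
qed

lemma R_word_green:
  assumes "reduced us" "length js = length us"
  shows "green_sequence Q (R_word m us js)"
  unfolding green_sequence_def verts_Q
  using conjunct1[OF R_word_run[OF reduced_rev[OF assms(1)] assms(2)]] mutation_sequence_R_word[OF assms(2)]
  by blast

end

section \<open>Tropicalization of subtraction-free rational functions\<close>

type_synonym int_mpoly = "(nat \<Rightarrow>\<^sub>0 nat) \<Rightarrow>\<^sub>0 int"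

definition monom_weight :: "(nat \<Rightarrow> int) \<Rightarrow> (nat \<Rightarrow>\<^sub>0 nat) \<Rightarrow> int" where
  "monom_weight x k = (\<Sum>i\<in>Poly_Mapping.keys k. int (Poly_Mapping.lookup k i) * x i)"

lemma monom_weight_superset:
  assumes "finite A" "Poly_Mapping.keys k \<subseteq> A"
  shows "monom_weight x k = (\<Sum>i\<in>A. int (Poly_Mapping.lookup k i) * x i)"
  unfolding monom_weight_def using assms
  by (intro sum.mono_neutral_left) (auto simp: in_keys_iff)

lemma monom_weight_add: "monom_weight x (a + b) = monom_weight x a + monom_weight x b"
proof -
  let ?A = "Poly_Mapping.keys a \<union> Poly_Mapping.keys b"
  have "monom_weight x (a + b) = (\<Sum>i\<in>?A. int (Poly_Mapping.lookup (a + b) i) * x i)"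
    by (rule monom_weight_superset) (use Poly_Mapping.keys_add[of a b] in auto)
  also have "\<dots> = (\<Sum>i\<in>?A. int (Poly_Mapping.lookup a i) * x i) + (\<Sum>i\<in>?A. int (Poly_Mapping.lookup b i) * x i)"
    by (simp add: lookup_add algebra_simps sum.distrib)
  also have "\<dots> = monom_weight x a + monom_weight x b"
    by (subst (1 2) monom_weight_superset[of ?A]) auto
  finally show ?thesis .
qed

definition nonneg_mpoly :: "int_mpoly \<Rightarrow> bool" where
  "nonneg_mpoly p \<longleftrightarrow> (\<forall>k. Poly_Mapping.lookup p k \<ge> 0)"

lemma nonneg_mpoly_add: "nonneg_mpoly p \<Longrightarrow> nonneg_mpoly r \<Longrightarrow> nonneg_mpoly (p + r)"
  by (simp add: nonneg_mpoly_def lookup_add)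

lemma nonneg_mpoly_mult:
  assumes "nonneg_mpoly p" "nonneg_mpoly r"
  shows "nonneg_mpoly (p * r)"
  unfolding nonneg_mpoly_def lookup_mult Sum_any.expand_set
  using assms by (auto simp: nonneg_mpoly_def when_def intro!: sum_nonneg mult_nonneg_nonneg)

lemma nonneg_mpoly_single: "c \<ge> 0 \<Longrightarrow> nonneg_mpoly (Poly_Mapping.single k c)"
  by (simp add: nonneg_mpoly_def lookup_single when_def)

definition positive_mpoly :: "int_mpoly \<Rightarrow> bool" where
  "positive_mpoly p \<longleftrightarrow> nonneg_mpoly p \<and> p \<noteq> 0"

lemma keys_add_nonneg:
  assumes "nonneg_mpoly p" "nonneg_mpoly r"
  shows "Poly_Mapping.keys (p + r) = Poly_Mapping.keys p \<union> Poly_Mapping.keys r"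
  using assms by (auto simp: in_keys_iff nonneg_mpoly_def lookup_add add_nonneg_eq_0_iff)

text \<open>Nonnegative coefficients cannot cancel. Splitting one monomial off each factor shows
  that its product survives.\<close>

lemma keys_mult_nonneg:
  assumes "nonneg_mpoly p" "nonneg_mpoly r"
  shows "Poly_Mapping.keys (p * r) = {a + b | a b. a \<in> Poly_Mapping.keys p \<and> b \<in> Poly_Mapping.keys r}"
proof
  show "Poly_Mapping.keys (p * r) \<subseteq> {a + b | a b. a \<in> Poly_Mapping.keys p \<and> b \<in> Poly_Mapping.keys r}"
    by (rule keys_mult)
  have "a + b \<in> Poly_Mapping.keys (p * r)" if "a \<in> Poly_Mapping.keys p" "b \<in> Poly_Mapping.keys r" for a b
  proof -
    define c where "c = Poly_Mapping.lookup p a"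
    define e where "e = Poly_Mapping.lookup r b"
    have pos: "c > 0" "e > 0" using that assms
      by (auto simp: c_def e_def nonneg_mpoly_def in_keys_iff order.strict_iff_order)
    define p' where "p' = p - Poly_Mapping.single a c"
    define r' where "r' = r - Poly_Mapping.single b e"
    have nn: "nonneg_mpoly p'" "nonneg_mpoly r'" using assms
      by (auto simp: nonneg_mpoly_def p'_def r'_def c_def e_def lookup_minus lookup_single when_def)
    have "p * r = Poly_Mapping.single (a + b) (c * e) +
        (Poly_Mapping.single a c * r' + p' * r)"
      by (simp add: p'_def r'_def mult_single[symmetric] algebra_simps)
    moreover have "nonneg_mpoly (Poly_Mapping.single a c * r' + p' * r)"
      using nn assms pos by (intro nonneg_mpoly_add nonneg_mpoly_mult nonneg_mpoly_single) auto
    ultimately have "Poly_Mapping.lookup (p * r) (a + b) \<ge> c * e"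
      by (simp add: lookup_add nonneg_mpoly_def)
    then have "Poly_Mapping.lookup (p * r) (a + b) > 0" using mult_pos_pos[OF pos] by linarith
    then show ?thesis by (simp add: in_keys_iff)
  qed
  then show "{a + b | a b. a \<in> Poly_Mapping.keys p \<and> b \<in> Poly_Mapping.keys r} \<subseteq> Poly_Mapping.keys (p * r)"
    by blast
qed

lemma positive_mpoly_keys: "positive_mpoly p \<Longrightarrow> Poly_Mapping.keys p \<noteq> {}"
  by (simp add: positive_mpoly_def)

lemma positive_mpoly_mult: "positive_mpoly p \<Longrightarrow> positive_mpoly r \<Longrightarrow> positive_mpoly (p * r)"
  by (simp add: positive_mpoly_def nonneg_mpoly_mult)

lemma positive_mpoly_add:
  assumes "positive_mpoly p" "positive_mpoly r"
  shows "positive_mpoly (p + r)"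
proof -
  have "Poly_Mapping.keys (p + r) \<noteq> {}"
    using assms positive_mpoly_keys[of p] by (simp add: keys_add_nonneg positive_mpoly_def)
  then show ?thesis using assms by (auto simp: positive_mpoly_def nonneg_mpoly_add)
qed

text \<open>On \<open>positive_mpoly\<close> this turns sums into minima and products into sums, as
  tropical evaluation should.\<close>

definition trop_val :: "(nat \<Rightarrow> int) \<Rightarrow> int_mpoly \<Rightarrow> int" where
  "trop_val x p = Min (monom_weight x ` Poly_Mapping.keys p)"

lemma trop_val_add:
  assumes "positive_mpoly p" "positive_mpoly r"
  shows "trop_val x (p + r) = min (trop_val x p) (trop_val x r)"
  using assms positive_mpoly_keys[of p] positive_mpoly_keys[of r]
  by (simp add: trop_val_def keys_add_nonneg positive_mpoly_def image_Un Min_Un)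

lemma trop_val_mult:
  assumes "positive_mpoly p" "positive_mpoly r"
  shows "trop_val x (p * r) = trop_val x p + trop_val x r"
proof -
  have keys: "Poly_Mapping.keys (p * r) = {a + b | a b. a \<in> Poly_Mapping.keys p \<and> b \<in> Poly_Mapping.keys r}"
    using assms by (intro keys_mult_nonneg) (auto simp: positive_mpoly_def)
  have fin: "finite (monom_weight x ` Poly_Mapping.keys q)" for q by simp
  have le: "trop_val x q \<le> monom_weight x a" if "a \<in> Poly_Mapping.keys q" for q a
    unfolding trop_val_def using that by (intro Min_le) auto
  have ex: "\<exists>a\<in>Poly_Mapping.keys q. trop_val x q = monom_weight x a" if "positive_mpoly q" for q
  proof -
    have "trop_val x q \<in> monom_weight x ` Poly_Mapping.keys q"
      unfolding trop_val_def using positive_mpoly_keys[OF that] by (intro Min_in) auto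
    then show ?thesis by blast
  qed
  obtain a b where ab: "a \<in> Poly_Mapping.keys p" "trop_val x p = monom_weight x a"
    "b \<in> Poly_Mapping.keys r" "trop_val x r = monom_weight x b"
    using ex assms by meson
  have "a + b \<in> Poly_Mapping.keys (p * r)" using ab keys by blast
  then have "trop_val x (p * r) \<le> trop_val x p + trop_val x r"
    using le[of "a + b" "p * r"] ab by (simp add: monom_weight_add)
  moreover obtain k where k: "k \<in> Poly_Mapping.keys (p * r)" "trop_val x (p * r) = monom_weight x k"
    using ex[OF positive_mpoly_mult[OF assms]] by blast
  moreover obtain a' b' where "k = a' + b'" "a' \<in> Poly_Mapping.keys p" "b' \<in> Poly_Mapping.keys r"
    using k(1) keys by blast
  ultimately show ?thesis using le[of a' p] le[of b' r] by (simp add: monom_weight_add)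
qed

text \<open>A relation, because a rational function has many presentations as a quotient of positive
  polynomials; multiplicativity of \<open>trop_val\<close> shows that all of them give the same
  value.\<close>

definition trop_rel :: "(nat \<Rightarrow> int) \<Rightarrow> ratfun \<Rightarrow> ztrop \<Rightarrow> bool" where
  "trop_rel x f a \<longleftrightarrow> (\<exists>p q. positive_mpoly p \<and> positive_mpoly q \<and> f = Fract p q \<and>
     a = ZTrop (trop_val x p - trop_val x q))"

lemma trop_rel_unique:
  assumes "trop_rel x f a" "trop_rel x f b"
  shows "a = b"
proof -
  obtain p q p' q' where 1: "positive_mpoly p" "positive_mpoly q" "f = Fract p q" "a = ZTrop (trop_val x p - trop_val x q)"
    and 2: "positive_mpoly p'" "positive_mpoly q'" "f = Fract p' q'" "b = ZTrop (trop_val x p' - trop_val x q')"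
    using assms unfolding trop_rel_def by blast
  have "p * q' = p' * q" using 1 2 eq_fract(1)[of q q' p p'] by (simp add: positive_mpoly_def)
  then have "trop_val x (p * q') = trop_val x (p' * q)" by simp
  then show ?thesis using 1 2 by (simp add: trop_val_mult)
qed

text \<open>Coefficient mutation uses only these operations, so such a relation propagates along
  mutation sequences. It will link rational functions, and also Laurent monomials, to
  \<open>ztrop\<close>.\<close>

definition semifield_rel ::
    "('a::{plus, power, inverse} \<Rightarrow> 'b::{plus, power, inverse} \<Rightarrow> bool) \<Rightarrow> bool" where
  "semifield_rel R \<longleftrightarrow> R 1 1 \<and> (\<forall>a a' b b'. R a b \<longrightarrow> R a' b' \<longrightarrow> R (a + a') (b + b') \<and> R (a * a') (b * b')) \<and>
     (\<forall>a b. R a b \<longrightarrow> R (inverse a) (inverse b))"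

lemma semifield_rel_trop: "semifield_rel (trop_rel x)"
  unfolding semifield_rel_def
proof (intro conjI allI impI)
  have one: "positive_mpoly 1" by (simp add: positive_mpoly_def nonneg_mpoly_def lookup_one when_def)
  show "trop_rel x 1 1" unfolding trop_rel_def
    by (intro exI[of _ 1] conjI one) (simp_all add: One_fract_def one_ztrop_def)
  fix f g a b assume "trop_rel x f a" "trop_rel x g b"
  then obtain p q p' q' where 1: "positive_mpoly p" "positive_mpoly q" "f = Fract p q" "a = ZTrop (trop_val x p - trop_val x q)"
    and 2: "positive_mpoly p'" "positive_mpoly q'" "g = Fract p' q'" "b = ZTrop (trop_val x p' - trop_val x q')"
    unfolding trop_rel_def by blast
  note pos = 1(1,2) 2(1,2)
  have nz: "q \<noteq> 0" "q' \<noteq> 0" using pos by (auto simp: positive_mpoly_def)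
  show "trop_rel x (f + g) (a + b)" unfolding trop_rel_def
  proof (intro exI conjI)
    show "f + g = Fract (p * q' + p' * q) (q * q')" using 1 2 nz by simp
    show "positive_mpoly (p * q' + p' * q)" "positive_mpoly (q * q')"
      using pos by (auto intro: positive_mpoly_mult positive_mpoly_add)
    show "a + b = ZTrop (trop_val x (p * q' + p' * q) - trop_val x (q * q'))"
      using 1(4) 2(4) pos by (simp add: plus_ztrop_def trop_val_add trop_val_mult positive_mpoly_mult)
  qed
  show "trop_rel x (f * g) (a * b)" unfolding trop_rel_def
  proof (intro exI conjI)
    show "f * g = Fract (p * p') (q * q')" using 1 2 by simp
    show "positive_mpoly (p * p')" "positive_mpoly (q * q')" using pos by (auto intro: positive_mpoly_mult)
    show "a * b = ZTrop (trop_val x (p * p') - trop_val x (q * q'))"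
      using 1(4) 2(4) pos by (simp add: times_ztrop_def trop_val_mult)
  qed
next
  fix f a assume "trop_rel x f a"
  then obtain p q where 1: "positive_mpoly p" "positive_mpoly q" "f = Fract p q" "a = ZTrop (trop_val x p - trop_val x q)"
    unfolding trop_rel_def by blast
  show "trop_rel x (inverse f) (inverse a)" unfolding trop_rel_def
    by (intro exI[of _ q] exI[of _ p] conjI 1) (use 1 in \<open>simp_all add: inverse_ztrop_def\<close>)
qed

lemma trop_rel_var: "trop_rel (\<lambda>i. y (from_nat i)) (rat_var v) (ZTrop (y v))"
proof -
  let ?k = "Poly_Mapping.single (to_nat v) (1::nat)"
  have "positive_mpoly (Poly_Mapping.single ?k 1)" "positive_mpoly 1"
    by (auto simp: positive_mpoly_def nonneg_mpoly_def lookup_one lookup_single when_def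
        dest: arg_cong[of _ _ "\<lambda>p. Poly_Mapping.lookup p ?k"])
  moreover have "trop_val (\<lambda>i. y (from_nat i)) (Poly_Mapping.single ?k 1) = y v"
    "trop_val (\<lambda>i. y (from_nat i)) 1 = 0"
    by (simp_all add: trop_val_def monom_weight_def)
  ultimately show ?thesis unfolding trop_rel_def rat_var_def by force
qed

lemma semifield_rel_expo: "semifield_rel (\<lambda>a b. b = ZTrop (expo a w))"
  by (simp add: semifield_rel_def one_ztrop_def plus_ztrop_def times_ztrop_def inverse_ztrop_def)

section \<open>Runs in related semifields\<close>

lemma semifield_rel_power_int:
  assumes "semifield_rel R" "R a b"
  shows "R (a powi n) (b powi n)"
proof -
  have pow: "R (a ^ n) (b ^ n)" if "R a b" for a b n
    using assms(1) that by (induction n) (auto simp: semifield_rel_def)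
  show ?thesis using assms pow by (auto simp: power_int_def semifield_rel_def)
qed

lemma semifield_rel_mut_coeff:
  assumes "semifield_rel R" "\<And>i. R (x i) (y i)"
  shows "R (mut_coeff \<epsilon> k x i) (mut_coeff \<epsilon> k y i)"
proof -
  have "R (1 + x k powi n) (1 + y k powi n)" for n
    using assms semifield_rel_power_int[OF assms(1), of "x k" "y k" n] unfolding semifield_rel_def by blast
  then have "R ((1 + x k powi n) powi l) ((1 + y k powi n) powi l)" for n l
    by (rule semifield_rel_power_int[OF assms(1)])
  then show ?thesis using assms unfolding mut_coeff_def semifield_rel_def by simp
qed

lemma semifield_rel_coeff_run:
  assumes "semifield_rel R" "\<And>i. R (x i) (y i)"
  shows "fst (coeff_run \<phi> (Q, x)) = fst (coeff_run \<phi> (Q, y)) \<and>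
    (\<forall>i. R (snd (coeff_run \<phi> (Q, x)) i) (snd (coeff_run \<phi> (Q, y)) i))"
proof (induction \<phi>)
  case Nil
  then show ?case using assms(2) by simp
next
  case (Cons f \<phi>)
  obtain Q1 x1 where 1: "coeff_run \<phi> (Q, x) = (Q1, x1)" by fastforce
  obtain Q2 y2 where 2: "coeff_run \<phi> (Q, y) = (Q2, y2)" by fastforce
  have "Q1 = Q2" "\<And>i. R (x1 i) (y2 i)" using Cons 1 2 by auto
  then show ?case
    by (cases f) (auto simp: 1 2 relabel_def intro: semifield_rel_mut_coeff[OF assms(1)])
qed

lemma seed_run_coeff_run:
  "fst (seed_run \<phi> (Q, X, A)) = fst (coeff_run \<phi> (Q, X)) \<and>
   fst (snd (seed_run \<phi> (Q, X, A))) = snd (coeff_run \<phi> (Q, X))"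
proof (induction \<phi>)
  case Nil
  then show ?case by (simp add: seed_run_def)
next
  case (Cons f \<phi>)
  obtain Q1 X1 A1 where 1: "seed_run \<phi> (Q, X, A) = (Q1, X1, A1)" by (metis prod_cases3)
  then have 2: "coeff_run \<phi> (Q, X) = (Q1, X1)" using Cons by (metis fst_conv prod.collapse snd_conv)
  have "seed_run (f # \<phi>) (Q, X, A) = seed_step f (Q1, X1, A1)"
    using 1 by (simp add: seed_run_def)
  then show ?case by (cases f) (auto simp: 2)
qed

lemma quiver_run_coeff_run: "quiver_run \<phi> Q = fst (coeff_run \<phi> (Q, x))"
proof (induction \<phi>)
  case (Cons f \<phi>)
  obtain Q1 x1 where 1: "coeff_run \<phi> (Q, x) = (Q1, x1)" by fastforce
  have "quiver_run (f # \<phi>) Q = quiver_step f (quiver_run \<phi> Q)" by (simp add: quiver_run_def)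
  then show ?case using Cons by (cases f) (simp_all add: 1)
qed (simp add: quiver_run_def)

section \<open>Invertibility of mutation over the tropical integers\<close>

lemma unZTrop_power: "unZTrop (a ^ n) = int n * unZTrop a"
  by (induction n) (auto simp: one_ztrop_def times_ztrop_def algebra_simps)

lemma unZTrop_power_int [simp]: "unZTrop (a powi n) = n * unZTrop a"
  by (auto simp: power_int_def unZTrop_power inverse_ztrop_def)

lemma unZTrop_mut_coeff:
  "unZTrop (mut_coeff \<epsilon> k x i) =
    (if i = k then - unZTrop (x k)
     else unZTrop (x i) - \<epsilon> i k * min 0 (- sgn (\<epsilon> i k) * unZTrop (x k)))"
  by (auto simp: mut_coeff_def inverse_ztrop_def times_ztrop_def plus_ztrop_def one_ztrop_def)

lemma mut_exch_twice: "mut_exch (mut_exch \<epsilon> k) k = \<epsilon>"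
proof (intro ext)
  fix i j
  \<comment> \<open>The numerator is even, so the integer division is exact and commutes with
    negation.\<close>
  have e: "even (\<bar>a\<bar> * b + a * \<bar>b\<bar>)" for a b :: int
    by (cases "a \<ge> 0"; cases "b \<ge> 0") auto
  show "mut_exch (mut_exch \<epsilon> k) k i j = \<epsilon> i j"
  proof (cases "k = i \<or> k = j")
    case False
    have "(- a - b) div 2 = - ((a + b) div 2)" if "even (a + b)" for a b :: int
      using that by presburger
    from this[OF e[of "\<epsilon> i k" "\<epsilon> k j"]] show ?thesis using False by (simp add: mut_exch_def)
  qed (auto simp: mut_exch_def)
qed

lemma mut_coeff_twice: "mut_coeff (mut_exch \<epsilon> k) k (mut_coeff \<epsilon> k x) = (x :: _ \<Rightarrow> ztrop)"
proof (intro ext ztrop.expand)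
  fix i
  have "mut_exch \<epsilon> k i k = - \<epsilon> i k" by (simp add: mut_exch_def)
  then show "unZTrop (mut_coeff (mut_exch \<epsilon> k) k (mut_coeff \<epsilon> k x) i) = unZTrop (x i)"
    by (simp add: unZTrop_mut_coeff)
qed

lemma coeff_step_inverse:
  fixes z :: "'v wquiver \<times> ('v \<Rightarrow> ztrop)"
  assumes "valid_step I f"
  shows "coeff_step f (coeff_step (step_inv f) z) = z"
proof (cases f; cases z)
  fix k Q x assume "f = Mut k" "z = (Q, x)"
  then show ?thesis by (simp add: mut_exch_twice mut_coeff_twice)
next
  fix \<pi> Q x assume f: "f = Perm \<pi>" "z = (Q, x)"
  then have "bij \<pi>" using assms by (auto intro: permutes_bij)
  then have "inv (inv \<pi>) (inv \<pi> i) = i" for i by (simp add: inv_inv_eq bij_is_surj surj_f_inv_f)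
  then show ?thesis using f by (simp add: relabel_def fun_eq_iff)
qed

lemma coeff_run_inverse:
  fixes z :: "'v wquiver \<times> ('v \<Rightarrow> ztrop)"
  assumes "mutation_sequence I \<phi>"
  shows "coeff_run \<phi> (coeff_run (mseq_inv \<phi>) z) = z"
  using assms
proof (induction \<phi> arbitrary: z)
  case (Cons f \<phi>)
  have "mseq_inv (f # \<phi>) = mseq_inv \<phi> @ [step_inv f]" by (simp add: mseq_inv_def)
  then show ?case using Cons coeff_step_inverse[of I f]
    by (simp add: coeff_run_append mutation_sequence_def)
qed (simp add: mseq_inv_def)

lemma mut_coeff_outside:
  fixes x :: "'v \<Rightarrow> ztrop"
  shows "\<epsilon> i k = 0 \<Longrightarrow> i \<noteq> k \<Longrightarrow> mut_coeff \<epsilon> k x i = x i"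
  by (rule ztrop.expand) (simp add: unZTrop_mut_coeff)

text \<open>Quivers and coefficient tuples are total functions, while preservation is only required
  on the vertices. Control of the remaining values lets equality of whole states be
  concluded.\<close>

lemma coeff_run_outside:
  fixes x :: "'v \<Rightarrow> ztrop"
  assumes "mutation_sequence I \<phi>" "\<And>i j. i \<notin> I \<or> j \<notin> I \<Longrightarrow> exch Q i j = 0"
    "coeff_run \<phi> (Q, x) = (Q', x')"
  shows "verts Q' = verts Q \<and> (\<forall>i j. i \<notin> I \<or> j \<notin> I \<longrightarrow> exch Q' i j = 0) \<and>
    (\<forall>i. i \<notin> I \<longrightarrow> wt Q' i = wt Q i \<and> x' i = x i)"
  using assms(1,3)
proof (induction \<phi> arbitrary: Q' x')
  case Nil
  then show ?case using assms(2) by simp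
next
  case (Cons f \<phi>)
  obtain Q1 x1 where 1: "coeff_run \<phi> (Q, x) = (Q1, x1)" by fastforce
  have IH: "verts Q1 = verts Q" "\<And>i j. i \<notin> I \<or> j \<notin> I \<Longrightarrow> exch Q1 i j = 0"
    "\<And>i. i \<notin> I \<Longrightarrow> wt Q1 i = wt Q i \<and> x1 i = x i"
    using Cons.IH[OF _ 1] Cons.prems(1) by (auto simp: mutation_sequence_def)
  show ?case
  proof (cases f)
    case (Mut k)
    then have "k \<in> I" using Cons.prems(1) by (simp add: mutation_sequence_def)
    have Q': "Q' = Q1\<lparr>exch := mut_exch (exch Q1) k\<rparr>" "x' = mut_coeff (exch Q1) k x1"
      using Cons.prems(2) Mut 1 by auto
    have "mut_exch (exch Q1) k i j = 0" if "i \<notin> I \<or> j \<notin> I" for i j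
      using that IH(2) by (auto simp: mut_exch_def)
    moreover have "x' i = x i" if "i \<notin> I" for i
      unfolding Q' using that IH(2,3) \<open>k \<in> I\<close> by (subst mut_coeff_outside) auto
    ultimately show ?thesis using IH Q'(1) by simp
  next
    case (Perm \<pi>)
    then have \<pi>: "\<pi> permutes I" using Cons.prems(1) by (simp add: mutation_sequence_def)
    have in_I: "inv \<pi> i \<in> I \<longleftrightarrow> i \<in> I" for i
      using permutes_in_image[OF permutes_inv[OF \<pi>]] .
    have out: "inv \<pi> i = i" if "i \<notin> I" for i
      using permutes_not_in[OF permutes_inv[OF \<pi>] that] .
    have "Q' = quiver_step (Perm \<pi>) Q1" "x' = relabel \<pi> x1"
      using Cons.prems(2) Perm 1 by auto
    then show ?thesis using IH in_I out by (auto simp: relabel_def)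
  qed
qed

text \<open>Mutations are subtraction-free, so an identity between the rational \<open>X\<close>-variables of two
  sequences passes to the tropical semifield.\<close>

lemma modular_rel_trop_map:
  fixes Q :: "'v::countable wquiver"
  assumes "(\<phi>, \<psi>) \<in> modular_rel Q"
    and out: "\<And>i j. i \<notin> verts Q \<or> j \<notin> verts Q \<Longrightarrow> exch Q i j = 0"
  shows "trop_map Q \<psi> y = trop_map Q \<phi> y"
proof -
  let ?\<chi> = "mseq_inv \<psi> @ \<phi>"
  let ?y = "\<lambda>j. ZTrop (y j)"
  have pres: "preserves_seed Q ?\<chi>" and seq: "mutation_sequence (verts Q) \<psi>"
    using assms(1) by (auto simp: modular_rel_def preserves_quiver_def)
  then have pq: "preserves_quiver Q ?\<chi>" by (simp add: preserves_seed_def)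
  obtain Q1 x1 where 1: "coeff_run ?\<chi> (Q, ?y) = (Q1, x1)" by fastforce
  have Q1: "Q1 = quiver_run ?\<chi> Q" using quiver_run_coeff_run[of ?\<chi> Q ?y] 1 by simp
  have outside: "verts Q1 = verts Q \<and> (\<forall>i j. i \<notin> verts Q \<or> j \<notin> verts Q \<longrightarrow> exch Q1 i j = 0) \<and>
    (\<forall>i. i \<notin> verts Q \<longrightarrow> wt Q1 i = wt Q i \<and> x1 i = ?y i)"
    by (rule coeff_run_outside[OF _ out 1]) (use pq in \<open>auto simp: preserves_quiver_def\<close>)
  have "exch Q1 i j = exch Q i j" for i j
    using outside out pq unfolding preserves_quiver_def Q1[symmetric]
    by (cases "i \<in> verts Q \<and> j \<in> verts Q") auto
  moreover have "wt Q1 i = wt Q i" for i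
    using outside pq unfolding preserves_quiver_def Q1[symmetric]
    by (cases "i \<in> verts Q") auto
  ultimately have "Q1 = Q" using outside by (intro wquiver.equality) (auto simp: fun_eq_iff)
  have "x1 i = ?y i" for i
  proof (cases "i \<in> verts Q")
    case True
    obtain Q' X A where s: "seed_run ?\<chi> (Q, rat_var, rat_var) = (Q', X, A)" by (metis prod_cases3)
    have "X i = rat_var i" using pres True unfolding preserves_seed_def s by auto
    moreover have "snd (coeff_run ?\<chi> (Q, rat_var)) = X"
      using seed_run_coeff_run[of ?\<chi> Q "rat_var :: 'v \<Rightarrow> ratfun" rat_var] s by simp
    moreover have "trop_rel (\<lambda>i. y (from_nat i)) (snd (coeff_run ?\<chi> (Q, rat_var)) i) (snd (coeff_run ?\<chi> (Q, ?y)) i)"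
      using semifield_rel_coeff_run[OF semifield_rel_trop, where x = rat_var and y = ?y, OF trop_rel_var] by blast
    ultimately have "trop_rel (\<lambda>i. y (from_nat i)) (rat_var i) (x1 i)" using 1 by simp
    then show ?thesis using trop_rel_var by (rule trop_rel_unique)
  qed (use outside in blast)
  then have "x1 = ?y" by blast
  have "coeff_run \<psi> (Q, ?y) = coeff_run \<psi> (coeff_run ?\<chi> (Q, ?y))"
    unfolding 1 \<open>Q1 = Q\<close> \<open>x1 = ?y\<close> ..
  also have "\<dots> = coeff_run \<phi> (Q, ?y)"
    unfolding coeff_run_append by (rule coeff_run_inverse[OF seq])
  finally show ?thesis unfolding trop_map_def by simp
qed

text \<open>Reading off the exponent of u_i is a semifield homomorphism to \<open>ztrop\<close>
  sending the principal coefficients to \<open>l_plus i\<close>. The Donaldson-Thomas condition thus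
  becomes a statement about c-vectors.\<close>

lemma trop_map_l_plus:
  "trop_map Q \<phi> (l_plus i) j = expo (snd (coeff_run \<phi> (Q, trop_var)) j) i"
proof -
  have "ZTrop (l_plus i j) = ZTrop (expo (trop_var j) i)" for j
    by (simp add: l_plus_def expo_trop_var)
  from conjunct2[OF semifield_rel_coeff_run[OF semifield_rel_expo,
      where x = trop_var and y = "\<lambda>j. ZTrop (l_plus i j)", OF this]]
  show ?thesis unfolding trop_map_def by simp
qed

section \<open>The Donaldson-Thomas transformation\<close>

lemma cong_mod_cancel:
  fixes x y n m :: nat
  shows "(x + n) mod m = (y + n) mod m \<longleftrightarrow> x mod m = y mod m"
  using cong_add_rcancel_nat[of x n y m] by (simp add: cong_def)

lemma Suc_mod_cancel: "(x + n) mod m = Suc ((y + n) mod m) mod m \<longleftrightarrow> x mod m = Suc y mod m"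
  using cong_mod_cancel[of x n m "Suc y"] by (simp add: mod_Suc_eq)

locale longest_adapted_data = coxeter_data m C d \<sigma>
  for m and C :: "'s::finite \<Rightarrow> 's \<Rightarrow> int" and d \<sigma> +
  fixes w0 ws
  assumes w0_longest: "longest_element C w0" and ws_expr: "reduced_expression C w0 ws"
    and ws_adapted: "adapted \<sigma> ws"
begin

lemma W_ws: "W ws = w0" and ws_red: "reduced ws"
  using ws_expr reduced_expression_iff by auto

sublocale adapted_longest_word C \<sigma> d ws
proof
  fix s t :: 's and us
  show "int (d s) * C s t = int (d t) * C t s" using GCM unfolding symmetrizable_GCM_def by blast
  show "d s > 0" by (rule d_pos)
  show "reduced ws" by (rule ws_red)
  show "length us \<le> length ws" if us: "reduced us"
  proof -
    have "W us \<in> weyl_group C" by (simp add: weyl_group_def W_weyl_elt)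
    then have "weyl_length C (W us) \<le> weyl_length C (W ws)"
      using w0_longest unfolding longest_element_def W_ws by blast
    then show ?thesis by (simp add: weyl_length_reduced us ws_red)
  qed
  show "adapted \<sigma> ws" by (rule ws_adapted)
  show "\<sigma> s t = - \<sigma> t s" by (rule \<sigma>_antisym)
  show "\<forall>s t. s \<noteq> t \<longrightarrow> C s t \<noteq> 0 \<longrightarrow> \<sigma> s t \<noteq> 0" using \<sigma>_zero_iff C_zero_iff by metis
qed

section \<open>The seed isomorphism sigma_Q\<close>

definition shift_map :: "'s \<times> nat \<Rightarrow> 's \<times> nat" where
  "shift_map = sigma_Q_inv m (dynkin_involution w0) ws"

lemma shift_map: "i < m \<Longrightarrow> shift_map (s, i) = (star s, (i + count_list ws (star s)) mod m)"
  by (simp add: shift_map_def star_def vtx_def W_ws)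

lemma shift_map_permutes: "shift_map permutes Qm_verts m"
proof (rule bij_imp_permutes)
  have sub: "shift_map ` Qm_verts m \<subseteq> Qm_verts m"
  proof (rule image_subsetI)
    fix v :: "'s \<times> nat" assume "v \<in> Qm_verts m"
    then show "shift_map v \<in> Qm_verts m" using m_ge_2 by (cases v) (simp add: shift_map)
  qed
  moreover have "inj_on shift_map (Qm_verts m)"
  proof (rule inj_onI)
    fix v w assume "v \<in> Qm_verts m" "w \<in> Qm_verts m" "shift_map v = shift_map w"
    then show "v = w"
      by (cases v; cases w) (auto simp: shift_map cong_mod_cancel)
  qed
  ultimately show "bij_betw shift_map (Qm_verts m) (Qm_verts m)"
    unfolding bij_betw_def using endo_inj_surj[OF finite_Qm_verts] by blast
  show "shift_map v = v" if "v \<notin> Qm_verts m" for v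
    using that by (cases v) (simp add: shift_map_def)
qed

abbreviation "\<sigma>Q \<equiv> sigma_Q m (dynkin_involution w0) ws"

lemma inv_sigma_Q: "inv \<sigma>Q = shift_map"
  using permutes_bij[OF shift_map_permutes] by (simp add: sigma_Q_def shift_map_def inv_inv_eq)

lemma sigma_Q_permutes: "\<sigma>Q permutes Qm_verts m"
  using permutes_inv[OF shift_map_permutes] by (simp add: sigma_Q_def shift_map_def)

text \<open>Within a row both indices shift equally. Between two rows the shifts may differ, and by
  \<open>count_star\<close> the difference compensates exactly for the change of the attachment
  offset caused by the orientation of the starred edge.\<close>

lemma exch_shift_map:
  assumes "v \<in> Qm_verts m" "w \<in> Qm_verts m"
  shows "exch Q (shift_map v) (shift_map w) = exch Q v w"
proof -
  obtain t j s b where vw: "v = (t, j)" "w = (s, b)" by (cases v; cases w)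
  then have lt: "j < m" "b < m" "0 < m" using assms by auto
  show ?thesis
  proof (cases "s = t")
    case True
    then show ?thesis using lt unfolding vw
      by (simp add: shift_map exch_Q_same Suc_mod_cancel)
  next
    case False
    show ?thesis
    proof (cases "C s t = 0")
      case True
      then show ?thesis using lt \<open>s \<noteq> t\<close> unfolding vw by (simp add: shift_map exch_Q_diff)
    next
      case nz: False
      define n where "n = count_list ws (star t)"
      define e where "e = (of_bool (\<sigma> s t \<ge> 1) :: nat)"
      define e' where "e' = (of_bool (\<sigma> (star s) (star t) \<ge> 1) :: nat)"
      define b' where "b' = (b + count_list ws (star s)) mod m"
      \<comment> \<open>\<open>count_star\<close> is applied to the starred pair, for which the
        involution returns \<open>s\<close> and \<open>t\<close>.\<close>
      have "e' + count_list ws (star s) = e + n"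
        using count_star[of "star s" "star t"] False nz by (simp add: e_def e'_def n_def)
      then have "b + count_list ws (star s) + e' = b + e + n" by linarith
      then have b': "(b' + e') mod m = (b + e + n) mod m" unfolding b'_def by (metis mod_add_left_eq)
      have "exch Q (star t, (j + n) mod m) (star s, b') = - C (star s) (star t) *
          (of_bool ((b' + e') mod m = (j + n) mod m) - of_bool ((b' + e') mod m = Suc ((j + n) mod m) mod m))"
        unfolding e'_def by (rule exch_Q_diff) (use lt False in \<open>simp_all add: b'_def\<close>)
      also have "\<dots> = - C s t * (of_bool ((b + e) mod m = j) - of_bool ((b + e) mod m = Suc j mod m))"
        unfolding b' cong_mod_cancel Suc_mod_cancel using lt by simp
      also have "\<dots> = exch Q (t, j) (s, b)"
        unfolding e_def by (rule exch_Q_diff[symmetric]) (use lt False in simp_all)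
      finally show ?thesis using lt unfolding vw b'_def n_def by (simp add: shift_map)
    qed
  qed
qed

lemma sigma_Q_seed_isomorphism: "seed_isomorphism Q \<sigma>Q"
  unfolding seed_isomorphism_def by (simp add: sigma_Q_permutes inv_sigma_Q exch_shift_map)

lemma sigma_Q_R_word_preserves_quiver:
  assumes "length js = length ws"
  shows "preserves_quiver Q (Perm \<sigma>Q # R_word m ws js)"
proof -
  have "reduced (rev ws)" by (rule reduced_rev[OF ws_red])
  then have "quiver_run (R_word m ws js) Q = Q"
    using R_word_run[OF _ assms] quiver_run_coeff_run[of "R_word m ws js" Q trop_var] by auto
  then have run: "quiver_run (Perm \<sigma>Q # R_word m ws js) Q = quiver_step (Perm \<sigma>Q) Q"
    by (simp add: quiver_run_def)
  have "wt Q (shift_map v) = wt Q v" if "v \<in> Qm_verts m" for v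
    using that by (cases v) (simp add: wt_Q shift_map)
  then show ?thesis unfolding preserves_quiver_def run
    using mutation_sequence_R_word[OF assms]
    by (simp add: mutation_sequence_def sigma_Q_permutes relabel_def inv_sigma_Q exch_shift_map)
qed

text \<open>The relabelling reads the coefficient in the row of star t with the index raised by
  \<open>n\<close>. The c-vector there is given by -q^n alpha_t, and q^n lowers the index by
  \<open>n\<close> again.\<close>

lemma trop_map_sigma_Q_R_word:
  assumes "length js = length ws" "v \<in> Qm_verts m" "w \<in> Qm_verts m"
  shows "trop_map Q (Perm \<sigma>Q # R_word m ws js) (l_plus w) v = l_minus w v"
proof -
  obtain x where run: "coeff_run (R_word m ws js) (Q, trop_var) = (Q, x)"
    and x: "\<And>t j w. j < m \<Longrightarrow> expo (x (t, j)) w = shifted_expo (T (rev ws) (unit_vec t)) j w"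
    using R_word_run[OF reduced_rev[OF ws_red] assms(1)] by blast
  obtain t j r a where vw: "v = (t, j)" "w = (r, a)" by (cases v; cases w)
  then have lt: "j < m" "a < m" "0 < m" using assms by auto
  define n where "n = count_list ws (star t)"
  have neg: "- monom 1 n = (monom (- 1) n * 1 :: int poly)" by (simp add: minus_monom)
  have "trop_map Q (Perm \<sigma>Q # R_word m ws js) (l_plus w) v = expo (x (shift_map v)) w"
    unfolding trop_map_l_plus by (simp add: run relabel_def inv_sigma_Q)
  also have "\<dots> = coeff_sum (\<lambda>k. of_bool ((a + k) mod m = (j + n) mod m)) (- monom 1 n * unit_vec t r)"
    using lt unfolding vw by (simp add: shift_map x shifted_expo_def T_rev_ws T_ws_unit n_def)
  also have "\<dots> = (if t = r then - of_bool ((a + n) mod m = (j + n) mod m) else 0)"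
    unfolding neg mult.assoc coeff_sum_monom_mult by (simp add: unit_vec_def coeff_sum_def)
  also have "\<dots> = l_minus w v"
    using lt unfolding vw l_minus_def by (auto simp: cong_mod_cancel)
  finally show ?thesis .
qed

text \<open>The tropical map is computed for one representative; \<open>modular_rel_trop_map\<close>
  carries the result over to every member of its class.\<close>

lemma sigma_Q_R_word_DT:
  assumes "length js = length ws"
  shows "cluster_DT Q (modular_rel Q `` {Perm \<sigma>Q # R_word m ws js})"
  unfolding cluster_DT_def
proof (intro conjI ballI)
  show "modular_rel Q `` {Perm \<sigma>Q # R_word m ws js} \<in> carrier (modular_group Q)"
    using sigma_Q_R_word_preserves_quiver[OF assms] by (simp add: modular_group_def quotientI)
  fix \<phi> v w
  assume "\<phi> \<in> modular_rel Q `` {Perm \<sigma>Q # R_word m ws js}" "w \<in> verts Q" "v \<in> verts Q"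
  then show "trop_map Q \<phi> (l_plus w) v = l_minus w v"
    using modular_rel_trop_map[of "Perm \<sigma>Q # R_word m ws js" \<phi> Q] exch_Q_outside
      trop_map_sigma_Q_R_word[OF assms] by simp
qed

end

theorem theorem2:
  fixes m :: nat
    and C :: "'s::finite \<Rightarrow> 's \<Rightarrow> int"
    and d :: "'s \<Rightarrow> nat"
    and \<sigma> :: "'s \<Rightarrow> 's \<Rightarrow> int"
  assumes "m \<ge> 2"
    and "symmetrizable_GCM C d"
    and "coxeter_quiver C d \<sigma>"
  shows "(\<forall>w \<in> weyl_group C. \<forall>ws js.
            reduced_expression C w ws \<longrightarrow> length js = length ws \<longrightarrow>
            green_sequence (Qm m d \<sigma>) (R_word m ws js)) \<and>
         (finite_type C d \<longrightarrow>
          (\<forall>w0 ws js.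
             longest_element C w0 \<longrightarrow> reduced_expression C w0 ws \<longrightarrow> adapted \<sigma> ws \<longrightarrow>
             length js = length ws \<longrightarrow>
             (let \<sigma>\<^sub>Q = sigma_Q m (dynkin_involution w0) ws in
                seed_isomorphism (Qm m d \<sigma>) \<sigma>\<^sub>Q \<and>
                cluster_DT (Qm m d \<sigma>) (modular_rel (Qm m d \<sigma>) `` {Perm \<sigma>\<^sub>Q # R_word m ws js}))))"
proof -
  interpret coxeter_data m C d \<sigma> using assms by unfold_locales
  show ?thesis
  proof (intro conjI ballI allI impI)
    fix w ws and js :: "nat list"
    assume "reduced_expression C w ws" "length js = length ws"
    then show "green_sequence Q (R_word m ws js)"
      using reduced_expression_iff by (intro R_word_green) auto
  next
    fix w0 ws and js :: "nat list"
    assume w0: "longest_element C w0" "reduced_expression C w0 ws" "adapted \<sigma> ws" "length js = length ws"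
    then interpret longest_adapted_data m C d \<sigma> w0 ws by unfold_locales
    show "let \<sigma>\<^sub>Q = sigma_Q m (dynkin_involution w0) ws in
        seed_isomorphism Q \<sigma>\<^sub>Q \<and> cluster_DT Q (modular_rel Q `` {Perm \<sigma>\<^sub>Q # R_word m ws js})"
      using sigma_Q_seed_isomorphism sigma_Q_R_word_DT[OF w0(4)] by (simp add: Let_def)
  qed
qed

end
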